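(* Let $M$ be a $C^1$ Finsler manifold modeled on a Banach space $X$ that admits a $C^1$ Lipschitz bump function, and let $p\in M$ and $\delta>0$. Let $f\colon B(p,4\delta)\to\mathbb{R}$ be a lower semicontinuous function satisfying $\|\xi\|_x\le K$ for every $x\in B(p,4\delta)$ and every $\xi\in D^-f(x)$. Then $f$ is $K$-Lipschitz on $B(p,\delta)$ with respect to the Finsler metric $d$ of $M$, that is, $|f(y)-f(z)|\le K\,d(y,z)$ for all $y,z\in B(p,\delta)$.
   Context: $C^1$ Finsler manifold (in the sense of Palais): a connected, paracompact $C^1$ Banach manifold $M$ modeled on a Banach space $(X,\|\cdot\|)$, with a continuous map $\|\cdot\|_M:TM\to[0,\infty)$ such that: (P1) for every $x\in M$ the restriction $\|\cdot\|_x$ of $\|\cdot\|_M$ to $T_xM$ is a norm such that for every chart $\varphi:U\to X$ with $x\in U$, the norm $v\in X\mapsto\|d\varphi^{-1}(\varphi(x))(v)\|_x$ is equivalent to $\|\cdot\|$; (P2) for every $x_0\in M$, $\varepsilon>0$ and chart $\varphi:U\to X$ with $x_0\in U$ there is an open neighborhood $W$ of $x_0$ such that for all $x\in W$, $v\in X$, $\frac{1}{1+\varepsilon}\|d\varphi^{-1}(\varphi(x_0))(v)\|_{x_0}\le\|d\varphi^{-1}(\varphi(x))(v)\|_x\le(1+\varepsilon)\|d\varphi^{-1}(\varphi(x_0))(v)\|_{x_0}$. Finsler metric: $d(p,q)$ is the infimum of the lengths $\ell(c)=\int_a^b\|c'(t)\|_{c(t)}\,dt$ over piecewise $C^1$ paths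 $c:[a,b]\to M$ connecting $p$ to $q$. $B(p,r)$ is the open $d$-ball of center $p$ and radius $r$. $C^1$ Lipschitz bump function on $X$: a $C^1$, Lipschitz function $b:X\to\mathbb{R}$ with bounded, non-empty support. Subdifferential: for $f$ defined on an open set $\Omega\subset M$ and $x\in\Omega$, $D^-f(x)=\{dg(x): g:M\to\mathbb{R}\text{ is }C^1\text{ and }f-g\text{ attains a local minimum at }x\}\subset T_xM^*$. For $\xi\in T_xM^*$, $\|\xi\|_x$ denotes the dual norm $\sup\{|\xi(v)|:v\in T_xM,\ \|v\|_x=1\}$. *)

theory Defs
  imports "HOL-Analysis.Analysis"
begin

section \<open>Banach manifolds of class \<open>C\<^sup>1\<close>\<close>

text \<open>
  The manifold is the whole type \<open>'m\<close>; its topology is that of the type class, and the sort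
  \<open>t2_space\<close> carries the Hausdorff axiom. A chart is a pair of its domain and
  its coordinate map; values of the coordinate map off the domain are irrelevant.
\<close>

type_synonym ('m, 'x) chart = "'m set \<times> ('m \<Rightarrow> 'x)"

text \<open>Only used for open \<open>S\<close>; the derivative is continuous for the operator norm.\<close>

definition C1_on :: "'a::real_normed_vector set \<Rightarrow> ('a \<Rightarrow> 'b::real_normed_vector) \<Rightarrow> bool" where
  "C1_on S f \<longleftrightarrow> (\<exists>f' :: 'a \<Rightarrow> 'a \<Rightarrow>\<^sub>L 'b.
     (\<forall>x\<in>S. (f has_derivative blinfun_apply (f' x)) (at x)) \<and> continuous_on S f')"

definition chart_inv :: "('m, 'x) chart \<Rightarrow> 'x \<Rightarrow> 'm" where
  "chart_inv c = inv_into (fst c) (snd c)"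

definition is_chart :: "('m::t2_space, 'x::banach) chart \<Rightarrow> bool" where
  "is_chart c \<longleftrightarrow> open (fst c) \<and> open (snd c ` fst c) \<and>
     homeomorphism (fst c) (snd c ` fst c) (snd c) (chart_inv c)"

definition C1_compatible :: "('m::t2_space, 'x::banach) chart \<Rightarrow> ('m, 'x) chart \<Rightarrow> bool" where
  "C1_compatible c c' \<longleftrightarrow>
     C1_on (snd c ` (fst c \<inter> fst c')) (snd c' \<circ> chart_inv c) \<and>
     C1_on (snd c' ` (fst c \<inter> fst c')) (snd c \<circ> chart_inv c')"

definition C1_atlas :: "('m::t2_space, 'x::banach) chart set \<Rightarrow> bool" where
  "C1_atlas A \<longleftrightarrow> (\<forall>c\<in>A. is_chart c) \<and> (\<Union>c\<in>A. fst c) = UNIV \<and>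
     (\<forall>c\<in>A. \<forall>c'\<in>A. C1_compatible c c')"

text \<open>The maximal atlas determined by \<open>A\<close>: ``every chart'' always refers to it.\<close>

definition charts :: "('m::t2_space, 'x::banach) chart set \<Rightarrow> ('m, 'x) chart set" where
  "charts A = {c. is_chart c \<and> (\<forall>c'\<in>A. C1_compatible c c')}"

definition charts_at :: "('m::t2_space, 'x::banach) chart set \<Rightarrow> 'm \<Rightarrow> ('m, 'x) chart set" where
  "charts_at A x = {c \<in> charts A. x \<in> fst c}"

definition paracompact_space :: "'m::t2_space itself \<Rightarrow> bool" where
  "paracompact_space _ \<longleftrightarrow>
     (\<forall>\<C> :: 'm set set. (\<forall>U\<in>\<C>. open U) \<and> \<Union>\<C> = UNIV \<longrightarrow>
        (\<exists>\<V>. (\<forall>V\<in>\<V>. open V) \<and> \<Union>\<V> = UNIV \<and> (\<forall>V\<in>\<V>. \<exists>U\<in>\<C>. V \<subseteq> U) \<and>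
             locally_finite_in euclidean \<V>))"

definition C1_banach_manifold :: "('m::t2_space, 'x::banach) chart set \<Rightarrow> bool" where
  "C1_banach_manifold A \<longleftrightarrow>
     C1_atlas A \<and> connected (UNIV :: 'm set) \<and> paracompact_space TYPE('m)"


section \<open>The tangent bundle\<close>

definition transition_deriv ::
    "('m, 'x::real_normed_vector) chart \<Rightarrow> ('m, 'x) chart \<Rightarrow> 'm \<Rightarrow> 'x \<Rightarrow> 'x" where
  "transition_deriv c c' x = frechet_derivative (snd c' \<circ> chart_inv c) (at (snd c x))"

text \<open>
  A tangent vector at \<open>x\<close> is identified with the family of its coordinate vectors in all charts
  around \<open>x\<close>, which transform under the derivatives of the transition maps: \<open>t c\<close> is
  \<open>d\<phi>(x)(t)\<close> for \<open>c = (U, \<phi>)\<close>. The family is set to \<open>0\<close> at all other charts, so that the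
  vector space operations of the tangent space are the pointwise ones.
\<close>

type_synonym ('m, 'x) tangent = "('m, 'x) chart \<Rightarrow> 'x"

definition tangent_space ::
    "('m::t2_space, 'x::banach) chart set \<Rightarrow> 'm \<Rightarrow> ('m, 'x) tangent set" where
  "tangent_space A x = {t. (\<forall>c. c \<notin> charts_at A x \<longrightarrow> t c = 0) \<and>
     (\<forall>c\<in>charts_at A x. \<forall>c'\<in>charts_at A x. t c' = transition_deriv c c' x (t c))}"

text \<open>\<open>tangent_lift A c x v\<close> is \<open>d\<phi>\<^sup>-\<^sup>1(\<phi>(x))(v)\<close> for \<open>c = (U, \<phi>)\<close>.\<close>

definition tangent_lift ::
    "('m::t2_space, 'x::banach) chart set \<Rightarrow> ('m, 'x) chart \<Rightarrow> 'm \<Rightarrow> 'x \<Rightarrow> ('m, 'x) tangent" where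
  "tangent_lift A c x v = (\<lambda>c'. if c' \<in> charts_at A x then transition_deriv c c' x v else 0)"

definition tangent_bundle ::
    "('m::t2_space, 'x::banach) chart set \<Rightarrow> ('m \<times> ('m, 'x) tangent) set" where
  "tangent_bundle A = (SIGMA x:UNIV. tangent_space A x)"

text \<open>
  The topology of the tangent bundle, generated by the preimages of open sets under the bundle
  charts \<open>(x, t) \<mapsto> (\<phi>(x), d\<phi>(x)(t))\<close> on \<open>TU\<close>.
\<close>

definition tangent_topology ::
    "('m::t2_space, 'x::banach) chart set \<Rightarrow> ('m \<times> ('m, 'x) tangent) topology" where
  "tangent_topology A = topology_generated_by
     {{(x, t) \<in> tangent_bundle A. x \<in> fst c \<and> (snd c x, t c) \<in> W} | c W.
        c \<in> charts A \<and> open W}"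


section \<open>Finsler structures\<close>

definition is_norm_on_tangent_space ::
    "('m::t2_space, 'x::banach) chart set \<Rightarrow> 'm \<Rightarrow> (('m, 'x) tangent \<Rightarrow> real) \<Rightarrow> bool" where
  "is_norm_on_tangent_space A x n \<longleftrightarrow>
     (\<forall>t\<in>tangent_space A x. 0 \<le> n t \<and> (n t = 0 \<longleftrightarrow> t = (\<lambda>c. 0))) \<and>
     (\<forall>t\<in>tangent_space A x. \<forall>r::real. n (\<lambda>c. r *\<^sub>R t c) = \<bar>r\<bar> * n t) \<and>
     (\<forall>s\<in>tangent_space A x. \<forall>t\<in>tangent_space A x. n (\<lambda>c. s c + t c) \<le> n s + n t)"

definition finsler_P1 ::
    "('m::t2_space, 'x::banach) chart set \<Rightarrow> ('m \<times> ('m, 'x) tangent \<Rightarrow> real) \<Rightarrow> bool" where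
  "finsler_P1 A F \<longleftrightarrow> (\<forall>x.
     is_norm_on_tangent_space A x (\<lambda>t. F (x, t)) \<and>
     (\<forall>c\<in>charts_at A x. \<exists>k>0. \<exists>K>0. \<forall>v.
        k * norm v \<le> F (x, tangent_lift A c x v) \<and> F (x, tangent_lift A c x v) \<le> K * norm v))"

definition finsler_P2 ::
    "('m::t2_space, 'x::banach) chart set \<Rightarrow> ('m \<times> ('m, 'x) tangent \<Rightarrow> real) \<Rightarrow> bool" where
  "finsler_P2 A F \<longleftrightarrow> (\<forall>x0. \<forall>\<epsilon>>0. \<forall>c\<in>charts_at A x0.
     \<exists>W. open W \<and> x0 \<in> W \<and> W \<subseteq> fst c \<and> (\<forall>x\<in>W. \<forall>v.
        1 / (1 + \<epsilon>) * F (x0, tangent_lift A c x0 v) \<le> F (x, tangent_lift A c x v) \<and>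
        F (x, tangent_lift A c x v) \<le> (1 + \<epsilon>) * F (x0, tangent_lift A c x0 v)))"

definition C1_finsler_manifold ::
    "('m::t2_space, 'x::banach) chart set \<Rightarrow> ('m \<times> ('m, 'x) tangent \<Rightarrow> real) \<Rightarrow> bool" where
  "C1_finsler_manifold A F \<longleftrightarrow> C1_banach_manifold A \<and>
     continuous_map (tangent_topology A) (top_of_set {0..}) F \<and>
     finsler_P1 A F \<and> finsler_P2 A F"


section \<open>The Finsler metric\<close>

text \<open>\<open>C\<^sup>1\<close> on a compact interval, with one-sided derivatives at the endpoints.\<close>

definition C1_path_on ::
    "('m::t2_space, 'x::banach) chart set \<Rightarrow> (real \<Rightarrow> 'm) \<Rightarrow> real \<Rightarrow> real \<Rightarrow> bool" where
  "C1_path_on A \<gamma> a b \<longleftrightarrow> continuous_on {a..b} \<gamma> \<and>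
     (\<forall>c\<in>charts A. \<exists>D :: real \<Rightarrow> 'x.
        (\<forall>t\<in>{a..b} \<inter> \<gamma> -` fst c. ((snd c \<circ> \<gamma>) has_vector_derivative D t) (at t within {a..b})) \<and>
        continuous_on ({a..b} \<inter> \<gamma> -` fst c) D)"

definition piecewise_C1_path ::
    "('m::t2_space, 'x::banach) chart set \<Rightarrow> (real \<Rightarrow> 'm) \<Rightarrow> real \<Rightarrow> real \<Rightarrow> bool" where
  "piecewise_C1_path A \<gamma> a b \<longleftrightarrow> a < b \<and> continuous_on {a..b} \<gamma> \<and>
     (\<exists>(n::nat) (s :: nat \<Rightarrow> real). s 0 = a \<and> s n = b \<and>
        (\<forall>i<n. s i < s (Suc i) \<and> C1_path_on A \<gamma> (s i) (s (Suc i))))"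

text \<open>
  The velocity of a piecewise \<open>C\<^sup>1\<close> path is meaningless at its finitely many corners, which
  do not contribute to the length.
\<close>

definition velocity ::
    "('m::t2_space, 'x::banach) chart set \<Rightarrow> (real \<Rightarrow> 'm) \<Rightarrow> real \<Rightarrow> real \<Rightarrow> real \<Rightarrow> ('m, 'x) tangent" where
  "velocity A \<gamma> a b t = (\<lambda>c. if c \<in> charts_at A (\<gamma> t)
      then vector_derivative (snd c \<circ> \<gamma>) (at t within {a..b}) else 0)"

definition finsler_length ::
    "('m::t2_space, 'x::banach) chart set \<Rightarrow> ('m \<times> ('m, 'x) tangent \<Rightarrow> real) \<Rightarrow>
     (real \<Rightarrow> 'm) \<Rightarrow> real \<Rightarrow> real \<Rightarrow> real" where
  "finsler_length A F \<gamma> a b = integral {a..b} (\<lambda>t. F (\<gamma> t, velocity A \<gamma> a b t))"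

definition finsler_dist ::
    "('m::t2_space, 'x::banach) chart set \<Rightarrow> ('m \<times> ('m, 'x) tangent \<Rightarrow> real) \<Rightarrow> 'm \<Rightarrow> 'm \<Rightarrow> real" where
  "finsler_dist A F p q =
     Inf {finsler_length A F \<gamma> a b | \<gamma> a b. piecewise_C1_path A \<gamma> a b \<and> \<gamma> a = p \<and> \<gamma> b = q}"

definition finsler_ball ::
    "('m::t2_space, 'x::banach) chart set \<Rightarrow> ('m \<times> ('m, 'x) tangent \<Rightarrow> real) \<Rightarrow> 'm \<Rightarrow> real \<Rightarrow> 'm set" where
  "finsler_ball A F p r = {q. finsler_dist A F p q < r}"


section \<open>Bump functions, lower semicontinuity and subdifferentials\<close>

definition C1_lipschitz_bump :: "('x::real_normed_vector \<Rightarrow> real) \<Rightarrow> bool" where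
  "C1_lipschitz_bump b \<longleftrightarrow> C1_on UNIV b \<and> (\<exists>L. L-lipschitz_on UNIV b) \<and>
     bounded (closure {x. b x \<noteq> 0}) \<and> closure {x. b x \<noteq> 0} \<noteq> {}"

definition lsc_on :: "'a::topological_space set \<Rightarrow> ('a \<Rightarrow> real) \<Rightarrow> bool" where
  "lsc_on S f \<longleftrightarrow> (\<forall>x\<in>S. \<forall>a<f x. eventually (\<lambda>y. a < f y) (at x within S))"

definition C1_on_manifold ::
    "('m::t2_space, 'x::banach) chart set \<Rightarrow> ('m \<Rightarrow> real) \<Rightarrow> bool" where
  "C1_on_manifold A g \<longleftrightarrow> (\<forall>c\<in>charts A. C1_on (snd c ` fst c) (g \<circ> chart_inv c))"

text \<open>
  The differential of a \<open>C\<^sup>1\<close> function, as a functional on the tangent space at \<open>x\<close>; it does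
  not depend on the chart used to compute it.
\<close>

definition differential ::
    "('m::t2_space, 'x::banach) chart set \<Rightarrow> ('m \<Rightarrow> real) \<Rightarrow> 'm \<Rightarrow> ('m, 'x) tangent \<Rightarrow> real" where
  "differential A g x = (\<lambda>t\<in>tangent_space A x.
     let c = (SOME c. c \<in> charts_at A x)
     in frechet_derivative (g \<circ> chart_inv c) (at (snd c x)) (t c))"

text \<open>The subdifferential at \<open>x\<close> of a function \<open>f\<close> regarded as defined on the open set \<open>\<Omega>\<close> only.\<close>

definition subdifferential ::
    "('m::t2_space, 'x::banach) chart set \<Rightarrow> 'm set \<Rightarrow> ('m \<Rightarrow> real) \<Rightarrow> 'm \<Rightarrow>
     (('m, 'x) tangent \<Rightarrow> real) set" where
  "subdifferential A \<Omega> f x = {differential A g x | g. C1_on_manifold A g \<and>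
     eventually (\<lambda>y. f x - g x \<le> f y - g y) (at x within \<Omega>)}"

definition dual_norm ::
    "('m::t2_space, 'x::banach) chart set \<Rightarrow> ('m \<times> ('m, 'x) tangent \<Rightarrow> real) \<Rightarrow> 'm \<Rightarrow>
     (('m, 'x) tangent \<Rightarrow> real) \<Rightarrow> real" where
  "dual_norm A F x \<xi> = Sup {\<bar>\<xi> t\<bar> | t. t \<in> tangent_space A x \<and> F (x, t) = 1}"

end

theory Submission
  imports Defs
begin

text \<open>
  The smooth variational principle of Deville, Godefroy and Zizler, obtained by subtracting a rapidly
  decreasing sequence of bumps, gives an approximate mean value theorem in the model space: if
  \<open>f(z) - f(y) > a\<close>, then some \<open>C\<^sup>1\<close> function touches \<open>f\<close> from below at a point near the segment
  \<open>[y, z]\<close> and its derivative there in the direction \<open>z - y\<close> exceeds \<open>a\<close>. In a chart where the norms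
  of the tangent spaces vary by a factor of at most \<open>1 + \<epsilon>\<close>, the bound on the subdifferential therefore
  yields \<open>\<bar>f(y) - f(x)\<bar> \<le> K (1 + \<epsilon>) N\<^sub>x(y - x)\<close> for \<open>y\<close> near \<open>x\<close>, where \<open>N\<^sub>x\<close> is the norm of the tangent
  space at \<open>x\<close> read in the chart. Along a \<open>C\<^sup>1\<close> path this pointwise estimate integrates to
  \<open>K\<close> times the length. Almost shortest paths between points of \<open>B(p, \<delta>)\<close> stay in \<open>B(p, 4\<delta>)\<close>.
\<close>

section \<open>Functions of class \<open>C\<^sup>1\<close> on normed spaces\<close>

text \<open>The norm of \<open>X\<close> need not be differentiable, so perturbations by multiples
  of the norm, as in Ekeland's principle, would not produce elements of the subdifferential; sums of
  rescaled bumps do. Two further obstacles shape the proof. Elements of the subdifferential come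
  from functions of class C1 on all of \<open>M\<close>, so a function found in a chart has to be
  cut off and extended by zero. This requires coordinate balls that are closed in \<open>M\<close>,
  and paracompactness supplies them through regularity. Moreover \<open>K\<close> may be negative:
  the dual norm is a supremum over unit vectors, hence over the empty set if \<open>X = 0\<close>. A
  negative \<open>K\<close> turns out to force \<open>X = 0\<close>, and then all distances vanish.
  The factor 4 has a simple origin: two points \<open>y\<close>, \<open>z\<close> of the small ball
  are less than \<open>2 * \<delta>\<close> apart, so some path from \<open>y\<close> to
  \<open>z\<close> is shorter than \<open>3 * \<delta>\<close>, and each of its points is reached
  from \<open>p\<close> through \<open>y\<close> within
  \<open>\<delta> + 3 * \<delta>\<close>.\<close>

lemma C1_on_subset: "C1_on S f \<Longrightarrow> T \<subseteq> S \<Longrightarrow> C1_on T f"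
  unfolding C1_on_def by (meson continuous_on_subset subsetD)

lemma C1_on_imp_differentiable:
  assumes "C1_on S f" "x \<in> S"
  shows "f differentiable (at x)"
  using assms unfolding C1_on_def differentiable_def by blast

lemma C1_on_imp_continuous_on:
  assumes "C1_on S f"
  shows "continuous_on S f"
  using assms unfolding C1_on_def
  by (meson continuous_at_imp_continuous_on has_derivative_continuous)

lemma C1_on_compose:
  assumes f: "C1_on S f" and g: "C1_on T g" and sub: "f ` S \<subseteq> T"
  shows "C1_on S (g \<circ> f)"
proof -
  obtain f' where f': "\<And>x. x \<in> S \<Longrightarrow> (f has_derivative blinfun_apply (f' x)) (at x)"
    and cf: "continuous_on S f'"
    using f unfolding C1_on_def by blast
  obtain g' where g': "\<And>x. x \<in> T \<Longrightarrow> (g has_derivative blinfun_apply (g' x)) (at x)"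
    and cg: "continuous_on T g'"
    using g unfolding C1_on_def by blast
  show ?thesis
    unfolding C1_on_def
  proof (intro exI[of _ "\<lambda>x. g' (f x) o\<^sub>L f' x"] conjI ballI)
    fix x assume "x \<in> S"
    then have "(g \<circ> f has_derivative g' (f x) \<circ> f' x) (at x)"
      using f' g' sub by (intro diff_chain_at) auto
    then show "(g \<circ> f has_derivative blinfun_apply (g' (f x) o\<^sub>L f' x)) (at x)"
      by (simp add: blinfun_compose.rep_eq)
  next
    have "continuous_on S (\<lambda>x. g' (f x))"
      using cg C1_on_imp_continuous_on[OF f] sub by (rule continuous_on_compose2)
    then show "continuous_on S (\<lambda>x. g' (f x) o\<^sub>L f' x)"
      using cf by (intro bounded_bilinear.continuous_on[OF bounded_bilinear_blinfun_compose])
  qed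
qed

lemma C1_on_mult:
  fixes f g :: "'a::real_normed_vector \<Rightarrow> real"
  assumes "C1_on S f" "C1_on S g"
  shows "C1_on S (\<lambda>x. f x * g x)"
proof -
  obtain f' where f': "\<And>x. x \<in> S \<Longrightarrow> (f has_derivative blinfun_apply (f' x)) (at x)"
    and cf: "continuous_on S f'"
    using assms(1) unfolding C1_on_def by blast
  obtain g' where g': "\<And>x. x \<in> S \<Longrightarrow> (g has_derivative blinfun_apply (g' x)) (at x)"
    and cg: "continuous_on S g'"
    using assms(2) unfolding C1_on_def by blast
  note c = C1_on_imp_continuous_on[OF assms(1)] C1_on_imp_continuous_on[OF assms(2)]
  show ?thesis
    unfolding C1_on_def
  proof (intro exI[of _ "\<lambda>x. f x *\<^sub>R g' x + g x *\<^sub>R f' x"] conjI ballI)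
    fix x assume "x \<in> S"
    then show "((\<lambda>x. f x * g x) has_derivative blinfun_apply (f x *\<^sub>R g' x + g x *\<^sub>R f' x)) (at x)"
      using has_derivative_mult[OF f' g']
      by (simp add: plus_blinfun.rep_eq scaleR_blinfun.rep_eq mult.commute)
  next
    show "continuous_on S (\<lambda>x. f x *\<^sub>R g' x + g x *\<^sub>R f' x)"
      using c cf cg by (intro continuous_intros)
  qed
qed

lemma C1_on_cong:
  assumes "C1_on S f" "open S" "\<And>x. x \<in> S \<Longrightarrow> f x = g x"
  shows "C1_on S g"
proof -
  obtain f' where "\<And>x. x \<in> S \<Longrightarrow> (f has_derivative blinfun_apply (f' x)) (at x)"
    and "continuous_on S f'"
    using assms(1) unfolding C1_on_def by blast
  then show ?thesis
    using assms(2,3) unfolding C1_on_def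
    by (intro exI[of _ f']) (auto intro: has_derivative_transform_within_open)
qed

text \<open>Uniqueness of derivatives glues the local derivative fields: \<open>D\<close>, chosen
  pointwise through \<open>frechet_derivative\<close>, coincides on each \<open>T\<close> with the
  field given there and inherits its continuity.\<close>

lemma C1_on_local:
  assumes "\<And>x. x \<in> S \<Longrightarrow> \<exists>T. open T \<and> x \<in> T \<and> C1_on T f"
  shows "C1_on S f"
proof -
  define D where "D x = Blinfun (frechet_derivative f (at x))" for x
  have *: "(f has_derivative blinfun_apply (D x)) (at x) \<and> isCont D x" if x: "x \<in> S" for x
  proof -
    obtain T f' where T: "open T" "x \<in> T"
      and f': "\<And>x. x \<in> T \<Longrightarrow> (f has_derivative blinfun_apply (f' x)) (at x)"
      and c: "continuous_on T f'"
      using assms[OF x] unfolding C1_on_def by blast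
    have D: "D y = f' y" if "y \<in> T" for y
      unfolding D_def frechet_derivative_at[OF f'[OF that], symmetric] by (rule blinfun_apply_inverse)
    have "continuous_on T D"
      using c D by (metis continuous_on_cong)
    then have "isCont D x"
      using T continuous_on_eq_continuous_at by blast
    then show ?thesis
      using T f' D by simp
  qed
  then show ?thesis
    unfolding C1_on_def by (metis continuous_at_imp_continuous_on)
qed

text \<open>Difference quotients along each ray \<open>x + t *\<^sub>R h\<close> are bounded by
  \<open>L * norm h\<close>, and the bound survives the limit. It turns the Lipschitz constant of
  the given bump into the derivative bound that a series of bumps requires.\<close>

lemma norm_derivative_le_lipschitz:
  fixes f :: "'a::real_normed_vector \<Rightarrow> 'b::real_normed_vector"
  assumes lip: "L-lipschitz_on UNIV f" and der: "(f has_derivative blinfun_apply D) (at x)"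
  shows "norm D \<le> L"
proof (rule norm_blinfun_bound)
  show "0 \<le> L" using lip by (rule lipschitz_on_nonneg)
  fix h
  have "((\<lambda>t::real. x + t *\<^sub>R h) has_derivative (\<lambda>t. t *\<^sub>R h)) (at 0)"
    by (auto intro!: derivative_eq_intros)
  moreover have "(f has_derivative blinfun_apply D) (at (x + 0 *\<^sub>R h))"
    using der by simp
  ultimately have "(f \<circ> (\<lambda>t. x + t *\<^sub>R h) has_derivative D \<circ> (\<lambda>t. t *\<^sub>R h)) (at 0)"
    by (rule diff_chain_at)
  then have "((\<lambda>t. f (x + t *\<^sub>R h)) has_vector_derivative D h) (at 0)"
    by (simp add: has_vector_derivative_def comp_def blinfun.bilinear_simps)
  then have "((\<lambda>t. norm (f (x + t *\<^sub>R h) - f x - t *\<^sub>R D h) / \<bar>t\<bar>) \<longlongrightarrow> 0) (at 0)"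
    by (simp add: has_vector_derivative_def has_derivative_at)
  then have lim: "((\<lambda>t. norm (f (x + t *\<^sub>R h) - f x - t *\<^sub>R D h) / \<bar>t\<bar> + L * norm h) \<longlongrightarrow> 0 + L * norm h) (at 0)"
    by (intro tendsto_intros)
  have "norm (D h) \<le> norm (f (x + t *\<^sub>R h) - f x - t *\<^sub>R D h) / \<bar>t\<bar> + L * norm h" if "t \<noteq> 0" for t
  proof -
    have "norm (f (x + t *\<^sub>R h) - f x) \<le> L * (\<bar>t\<bar> * norm h)"
      using lipschitz_onD[OF lip, of "x + t *\<^sub>R h" x] by (simp add: dist_norm)
    moreover have "\<bar>t\<bar> * norm (D h) \<le> norm (f (x + t *\<^sub>R h) - f x - t *\<^sub>R D h) + norm (f (x + t *\<^sub>R h) - f x)"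
      using norm_triangle_ineq4[of "f (x + t *\<^sub>R h) - f x" "f (x + t *\<^sub>R h) - f x - t *\<^sub>R D h"]
      by simp
    ultimately show ?thesis
      using that by (simp add: field_simps)
  qed
  then show "norm (D h) \<le> L * norm h"
    by (intro tendsto_lowerbound[OF lim, simplified]) (simp_all add: eventually_at_filter)
qed


section \<open>A smooth variational principle\<close>

text \<open>Vanishing outside the unit ball makes \<open>r\<close> the size of the rescaled bump
  \<open>\<beta> ((1 / r) *\<^sub>R (u - c))\<close>. The value 1 at the centre is the maximum, so
  the derivative is zero there.\<close>

definition unit_bump ::
    "('x::real_normed_vector \<Rightarrow> real) \<Rightarrow> ('x \<Rightarrow> 'x \<Rightarrow>\<^sub>L real) \<Rightarrow> real \<Rightarrow> bool" where
  "unit_bump \<beta> \<beta>' L \<longleftrightarrow> (\<forall>u. (\<beta> has_derivative blinfun_apply (\<beta>' u)) (at u)) \<and>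
     continuous_on UNIV \<beta>' \<and> (\<forall>u. norm (\<beta>' u) \<le> L) \<and> \<beta> 0 = 1 \<and>
     (\<forall>u. 0 \<le> \<beta> u \<and> \<beta> u \<le> 1) \<and> (\<forall>u. 1 \<le> norm u \<longrightarrow> \<beta> u = 0)"

text \<open>The normalisation composes with \<open>w \<mapsto> 2w\<^sup>2 / (1 + w\<^sup>4)\<close>, which has values in \<open>[0,1]\<close>, attains \<open>1\<close> at \<open>w = 1\<close>, vanishes at
  \<open>0\<close> and has a bounded derivative.\<close>

lemma unit_bump_exists:
  fixes b :: "'x::real_normed_vector \<Rightarrow> real"
  assumes "C1_lipschitz_bump b"
  obtains \<beta> :: "'x \<Rightarrow> real" and \<beta>' L where "unit_bump \<beta> \<beta>' L"
proof -
  obtain b' L where b': "\<And>x. (b has_derivative blinfun_apply (b' x)) (at x)"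
    and cb: "continuous_on UNIV b'" and lip: "L-lipschitz_on UNIV b"
    and bdd: "bounded (closure {x. b x \<noteq> 0})" and ne: "closure {x. b x \<noteq> 0} \<noteq> {}"
    using assms unfolding C1_lipschitz_bump_def C1_on_def by auto
  obtain x1 where x1: "b x1 \<noteq> 0" using ne by auto
  obtain R0 where "\<forall>x\<in>closure {x. b x \<noteq> 0}. norm x \<le> R0"
    using bdd unfolding bounded_iff by (rule exE)
  then have R0: "norm x \<le> R0" if "b x \<noteq> 0" for x
    using that closure_subset[of "{x. b x \<noteq> 0}"] by (simp add: subset_iff)
  \<comment> \<open>With this choice \<open>1 \<le> norm u\<close> moves
    \<open>x1 + R *\<^sub>R u\<close> out of the ball of radius \<open>R0\<close>, which contains
    all points where \<open>b\<close> is nonzero.\<close>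
  define R where "R = norm x1 + R0 + 1"
  have "norm x1 \<le> R0" using R0 x1 by blast
  then have Rpos: "R > 0" unfolding R_def using norm_ge_zero[of x1] by linarith
  define w where "w u = b (x1 + R *\<^sub>R u) / b x1" for u
  define w' where "w' u = (R / b x1) *\<^sub>R b' (x1 + R *\<^sub>R u)" for u
  have w': "(w has_derivative blinfun_apply (w' u)) (at u)" for u
  proof -
    have "((\<lambda>u. x1 + R *\<^sub>R u) has_derivative (\<lambda>h. R *\<^sub>R h)) (at u)"
      by (auto intro!: derivative_eq_intros)
    from diff_chain_at[OF this b']
    have "((\<lambda>u. b (x1 + R *\<^sub>R u)) has_derivative (\<lambda>h. R * b' (x1 + R *\<^sub>R u) h)) (at u)"
      by (simp add: comp_def scaleR_blinfun.rep_eq blinfun.bilinear_simps)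
    then have "((\<lambda>u. b (x1 + R *\<^sub>R u) / b x1) has_derivative (\<lambda>h. R * b' (x1 + R *\<^sub>R u) h / b x1)) (at u)"
      unfolding divide_inverse by (rule has_derivative_mult_left)
    then show ?thesis
      unfolding w_def w'_def by (simp add: scaleR_blinfun.rep_eq)
  qed
  have cw': "continuous_on UNIV w'"
    unfolding w'_def by (intro continuous_intros continuous_on_compose2[OF cb]) simp
  have cw: "continuous_on UNIV w"
    using has_derivative_continuous[OF w'] by (simp add: continuous_at_imp_continuous_on)
  have nw': "norm (w' u) \<le> R / \<bar>b x1\<bar> * L" for u
  proof -
    have "norm (w' u) = R / \<bar>b x1\<bar> * norm (b' (x1 + R *\<^sub>R u))"
      using Rpos by (simp add: w'_def)
    also have "\<dots> \<le> R / \<bar>b x1\<bar> * L"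
      by (intro mult_left_mono norm_derivative_le_lipschitz[OF lip b']) (use Rpos in simp)
    finally show ?thesis .
  qed
  \<comment> \<open>\<open>b\<close> may change sign and \<open>w\<close> may exceed 1. This even
    function tames both: \<open>1 - \<theta> s = (s^2 - 1)^2 / (1 + s^4)\<close> is
    nonnegative.\<close>
  define \<theta> :: "real \<Rightarrow> real" where "\<theta> s = 2 * s^2 / (1 + s^4)" for s
  define \<theta>' :: "real \<Rightarrow> real" where "\<theta>' s = 4 * s * (1 - s^4) / (1 + s^4)^2" for s
  have s4: "0 \<le> s^4" for s :: real
    by simp
  then have p4: "1 + s^4 > 0" for s :: real
    by (simp add: add_pos_nonneg)
  have \<theta>': "(\<theta> has_real_derivative \<theta>' s) (at s)" for s
  proof -
    have "((\<lambda>s. 2 * s^2 / (1 + s^4)) has_real_derivative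
        ((2 * (2 * s)) * (1 + s^4) - (2 * s^2) * (4 * s^3)) / ((1 + s^4) * (1 + s^4))) (at s)"
      using p4[of s] by (intro DERIV_divide) (auto intro!: derivative_eq_intros)
    moreover have "(2 * (2 * s)) * (1 + s^4) - (2 * s^2) * (4 * s^3) = 4 * s * (1 - s^4)"
      by algebra
    ultimately show ?thesis
      unfolding \<theta>_def \<theta>'_def power2_eq_square by simp
  qed
  have n\<theta>': "\<bar>\<theta>' s\<bar> \<le> 4" for s
  proof -
    have s: "\<bar>s\<bar> \<le> 1 + s^4"
    proof (cases "\<bar>s\<bar> \<le> 1")
      case True then show ?thesis using s4[of s] by linarith
    next
      case False
      then have "\<bar>s\<bar> ^ 1 \<le> \<bar>s\<bar> ^ 4" by (intro power_increasing) linarith+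
      then show ?thesis by (simp add: power_even_abs)
    qed
    have "\<bar>1 - s^4\<bar> \<le> 1 + s^4" using s4[of s] by linarith
    with s have "\<bar>s\<bar> * \<bar>1 - s^4\<bar> \<le> (1 + s^4) * (1 + s^4)"
      by (intro mult_mono) (use p4[of s] in linarith | simp)+
    then have "4 * (\<bar>s\<bar> * \<bar>1 - s^4\<bar>) \<le> 4 * (1 + s^4)^2"
      unfolding power2_eq_square by linarith
    moreover have "0 < (1 + s^4)^2"
      using p4[of s] by simp
    moreover have "\<bar>\<theta>' s\<bar> = 4 * (\<bar>s\<bar> * \<bar>1 - s^4\<bar>) / (1 + s^4)^2"
      unfolding \<theta>'_def abs_divide abs_mult by simp
    ultimately show ?thesis
      by (simp only: pos_divide_le_eq)
  qed
  have c\<theta>': "continuous_on UNIV \<theta>'"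
    unfolding \<theta>'_def
  proof (intro continuous_intros ballI)
    show "(1 + s^4)\<^sup>2 \<noteq> 0" for s :: real using p4[of s] by simp
  qed
  have "unit_bump (\<lambda>u. \<theta> (w u)) (\<lambda>u. \<theta>' (w u) *\<^sub>R w' u) (4 * (R / \<bar>b x1\<bar> * L))"
    unfolding unit_bump_def
  proof (intro conjI allI impI)
    fix u
    have "(\<theta> has_derivative (*) (\<theta>' (w u))) (at (w u))"
      using \<theta>'[of "w u"] unfolding has_field_derivative_def .
    from diff_chain_at[OF w' this]
    show "((\<lambda>u. \<theta> (w u)) has_derivative blinfun_apply (\<theta>' (w u) *\<^sub>R w' u)) (at u)"
      by (simp add: comp_def scaleR_blinfun.rep_eq blinfun.bilinear_simps)
    show "norm (\<theta>' (w u) *\<^sub>R w' u) \<le> 4 * (R / \<bar>b x1\<bar> * L)"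
      unfolding norm_scaleR real_norm_def
      by (intro mult_mono n\<theta>' nw') simp_all
    show "0 \<le> \<theta> (w u)"
      unfolding \<theta>_def using p4[of "w u"] by simp
    have "0 \<le> ((w u)^2 - 1)^2" by simp
    also have "\<dots> = 1 + w u ^ 4 - 2 * (w u)^2" by algebra
    finally show "\<theta> (w u) \<le> 1"
      unfolding \<theta>_def using p4[of "w u"] by (simp add: pos_divide_le_eq)
  next
    show "continuous_on UNIV (\<lambda>u. \<theta>' (w u) *\<^sub>R w' u)"
      using cw cw' by (intro continuous_intros continuous_on_compose2[OF c\<theta>']) auto
    show "\<theta> (w 0) = 1" using x1 by (simp add: w_def \<theta>_def)
  next
    fix u :: 'x assume u: "1 \<le> norm u"
    have "R \<le> norm (R *\<^sub>R u)" using u Rpos by simp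
    also have "\<dots> \<le> norm (x1 + R *\<^sub>R u) + norm x1"
      using norm_triangle_ineq4[of "x1 + R *\<^sub>R u" x1] by simp
    finally have "R0 < norm (x1 + R *\<^sub>R u)" unfolding R_def by linarith
    then have "b (x1 + R *\<^sub>R u) = 0" using R0[of "x1 + R *\<^sub>R u"] by linarith
    then show "\<theta> (w u) = 0" by (simp add: w_def \<theta>_def)
  qed
  then show ?thesis by (rule that)
qed

lemma unit_bump_scaled_derivative:
  assumes "unit_bump \<beta> \<beta>' L"
  shows "((\<lambda>u. \<beta> ((1 / r) *\<^sub>R (u - c))) has_derivative
           blinfun_apply ((1 / r) *\<^sub>R \<beta>' ((1 / r) *\<^sub>R (u - c)))) (at u)"
proof -
  have "((\<lambda>u. (1 / r) *\<^sub>R (u - c)) has_derivative (\<lambda>h. (1 / r) *\<^sub>R h)) (at u)"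
    by (auto intro!: derivative_eq_intros)
  moreover have "(\<beta> has_derivative blinfun_apply (\<beta>' ((1 / r) *\<^sub>R (u - c)))) (at ((1 / r) *\<^sub>R (u - c)))"
    using assms by (simp add: unit_bump_def)
  ultimately have "(\<beta> \<circ> (\<lambda>u. (1 / r) *\<^sub>R (u - c)) has_derivative
      blinfun_apply (\<beta>' ((1 / r) *\<^sub>R (u - c))) \<circ> (\<lambda>h. (1 / r) *\<^sub>R h)) (at u)"
    by (rule diff_chain_at)
  then show ?thesis
    by (simp only: comp_def scaleR_blinfun.rep_eq blinfun.scaleR_right)
qed

lemma unit_bump_scaled_continuous:
  assumes "unit_bump \<beta> \<beta>' L"
  shows "continuous_on UNIV (\<lambda>u. (1 / r) *\<^sub>R \<beta>' ((1 / r) *\<^sub>R (u - c)))"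
proof -
  have "continuous_on UNIV \<beta>'"
    using assms by (simp add: unit_bump_def)
  then have "continuous_on UNIV (\<lambda>u. \<beta>' ((1 / r) *\<^sub>R (u - c)))"
    by (rule continuous_on_compose2) (intro continuous_intros, simp)
  then show ?thesis
    by (rule continuous_on_scaleR[OF continuous_on_const])
qed

text \<open>The Weierstrass test in the operator norm makes the derivatives converge uniformly. This
  gives continuity of their sum and, evaluated at \<open>h\<close>, the estimate by
  \<open>e * norm h\<close> that termwise differentiation asks for.\<close>

lemma C1_series:
  fixes g :: "nat \<Rightarrow> 'a::real_normed_vector \<Rightarrow> real"
  assumes der: "\<And>n u. (g n has_derivative blinfun_apply (g' n u)) (at u)"
    and cont: "\<And>n. continuous_on UNIV (g' n)"
    and M: "\<And>n u. \<bar>g n u\<bar> \<le> M n" "summable M"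
    and M': "\<And>n u. norm (g' n u) \<le> M' n" "summable M'"
  shows "((\<lambda>u. \<Sum>n. g n u) has_derivative blinfun_apply (\<Sum>n. g' n u)) (at u)"
    and "continuous_on UNIV (\<lambda>u. \<Sum>n. g' n u)"
    and "norm (\<Sum>n. g' n u) \<le> suminf M'"
proof -
  have unif: "uniform_limit UNIV (\<lambda>n u. \<Sum>i<n. g' i u) (\<lambda>u. \<Sum>i. g' i u) sequentially"
    using M' by (intro Weierstrass_m_test) auto
  show "continuous_on UNIV (\<lambda>u. \<Sum>n. g' n u)"
    by (intro uniform_limit_theorem[OF _ unif] always_eventually allI continuous_on_sum cont) simp
  have sn: "summable (\<lambda>n. norm (g' n u))" for u
    by (rule summable_comparison_test'[OF M'(2), of 0]) (simp add: M'(1))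
  show "norm (\<Sum>n. g' n u) \<le> suminf M'"
  proof (rule order_trans)
    show "norm (\<Sum>n. g' n u) \<le> (\<Sum>n. norm (g' n u))"
      using sn by (rule summable_norm)
    show "(\<Sum>n. norm (g' n u)) \<le> suminf M'"
      using M'(1) sn M'(2) by (rule suminf_le)
  qed
  have sg: "(\<lambda>n. g n u) sums (\<Sum>n. g n u)" for u
    by (rule summable_sums, rule summable_comparison_test'[OF M(2), of 0]) (simp add: M(1))
  have "\<exists>G. \<forall>u\<in>UNIV. (\<lambda>n. g n u) sums G u \<and> (G has_derivative blinfun_apply (\<Sum>n. g' n u)) (at u)"
  proof (rule has_derivative_series[OF _ _ _ _ sg])
    fix e :: real assume "e > 0"
    then have "\<forall>\<^sub>F n in sequentially. \<forall>u\<in>UNIV. dist (\<Sum>i<n. g' i u) (\<Sum>i. g' i u) < e"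
      using uniform_limitD[OF unif] by simp
    then show "\<forall>\<^sub>F n in sequentially. \<forall>u\<in>UNIV. \<forall>h.
        norm ((\<Sum>i<n. blinfun_apply (g' i u) h) - blinfun_apply (\<Sum>n. g' n u) h) \<le> e * norm h"
    proof eventually_elim
      case (elim n)
      show ?case
      proof safe
        fix u h
        have "norm (blinfun_apply ((\<Sum>i<n. g' i u) - (\<Sum>n. g' n u)) h) \<le> e * norm h"
          using elim by (intro order_trans[OF norm_blinfun] mult_right_mono) (auto simp: dist_norm less_imp_le)
        then show "norm ((\<Sum>i<n. blinfun_apply (g' i u) h) - blinfun_apply (\<Sum>n. g' n u) h) \<le> e * norm h"
          by (simp only: blinfun.diff_left blinfun.sum_left)
      qed
    qed
  qed (use der in auto)
  then obtain G where G: "\<And>u. (\<lambda>n. g n u) sums G u"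
      "\<And>u. (G has_derivative blinfun_apply (\<Sum>n. g' n u)) (at u)" by auto
  have "(\<lambda>u. \<Sum>n. g n u) = G"
    using G(1) by (auto simp: sums_iff)
  then show "((\<lambda>u. \<Sum>n. g n u) has_derivative blinfun_apply (\<Sum>n. g' n u)) (at u)"
    using G(2) by simp
qed

text \<open>The filter in \<open>lsc_on\<close> is punctured; terms with \<open>X n = x\<close> are
  covered by \<open>a < f x\<close>.\<close>

lemma lsc_on_sequentially:
  fixes x :: "'a::metric_space"
  assumes "lsc_on S f" "x \<in> S" "a < f x" "\<And>n. X n \<in> S" "X \<longlonglongrightarrow> x"
  shows "\<forall>\<^sub>F n in sequentially. a < f (X n)"
proof -
  obtain d where "d > 0" and d: "\<And>y. y \<in> S \<Longrightarrow> y \<noteq> x \<Longrightarrow> dist y x < d \<Longrightarrow> a < f y"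
    using assms(1-3) unfolding lsc_on_def eventually_at by blast
  have "\<forall>\<^sub>F n in sequentially. dist (X n) x < d"
    using assms(5) \<open>d > 0\<close> by (rule tendstoD)
  then show ?thesis
    by eventually_elim (use d assms(3,4) in metis)
qed

text \<open>Each step subtracts from the function a bump of height \<open>\<epsilon>\<^sub>n\<close> centred at a point \<open>x\<^sub>n\<close> that
  minimises it up to \<open>\<epsilon>\<^sub>n / 2\<close>. All later almost minimisers then lie in the support of that bump,
  whose radius \<open>r\<^sub>n\<close> tends to \<open>0\<close>, while \<open>\<epsilon>\<^sub>n / r\<^sub>n\<close> is summable.\<close>

theorem smooth_variational_principle:
  fixes \<Phi> \<beta> :: "'x::banach \<Rightarrow> real"
  assumes bump: "unit_bump \<beta> \<beta>' L"
    and D: "closed D" "D \<noteq> {}" and lsc: "lsc_on D \<Phi>"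
    and lower: "\<And>u. u \<in> D \<Longrightarrow> B \<le> \<Phi> u" and "\<epsilon> > 0"
  obtains x g g' where "x \<in> D" "\<And>u. (g has_derivative blinfun_apply (g' u)) (at u)"
    "continuous_on UNIV g'" "\<And>u. 0 \<le> g u \<and> g u \<le> \<epsilon>" "\<And>u. norm (g' u) \<le> \<epsilon>"
    "\<And>u. u \<in> D \<Longrightarrow> \<Phi> x - g x \<le> \<Phi> u - g u"
proof -
  have \<beta>01: "0 \<le> \<beta> u" "\<beta> u \<le> 1" and \<beta>0: "\<beta> 0 = 1" and \<beta>out: "1 \<le> norm u \<Longrightarrow> \<beta> u = 0"
    and \<beta>'L: "norm (\<beta>' u) \<le> L" for u
    using bump by (auto simp: unit_bump_def)
  have L0: "0 \<le> L" using order_trans[OF norm_ge_zero \<beta>'L] .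
  \<comment> \<open>The geometric series contributes a factor 2: the bumps add up to at most
    \<open>2 * e\<close>, their derivatives to at most \<open>2 * L * e\<close>, and both are at
    most \<open>\<epsilon>\<close>.\<close>
  define e where "e = \<epsilon> / (2 * (1 + L))"
  have e0: "e > 0" using \<open>\<epsilon> > 0\<close> L0 by (simp add: e_def)
  have e2: "e * 2 \<le> \<epsilon>" "L * e * 2 \<le> \<epsilon>"
    using \<open>\<epsilon> > 0\<close> L0 by (auto simp: e_def divide_simps algebra_simps)
  \<comment> \<open>Powers of 4 against powers of 2 leave \<open>e * (1/2)^n\<close> for
    \<open>E n / r n\<close>, which bounds the derivatives up to the factor \<open>L\<close>. The
    strict decrease of \<open>E\<close> is what forces consecutive almost minimisers
    together.\<close>
  define E where "E n = e / 4^n" for n :: nat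
  define r where "r n = (1/2::real)^n" for n :: nat
  have E0: "E n > 0" and r0: "r n > 0" for n using e0 by (auto simp: E_def r_def)
  have Er: "E n / r n = e * (1/2)^n" for n
  proof -
    have "(4::real)^n = 2^n * 2^n" by (simp flip: power_mult_distrib)
    then show ?thesis by (simp add: E_def r_def power_divide)
  qed
  have Ele: "E n \<le> e * (1/2)^n" for n
  proof -
    have "E n / 1 \<le> E n / r n"
      using E0[of n] r0[of n] by (intro divide_left_mono) (auto simp: r_def power_le_one)
    then show ?thesis by (simp add: Er)
  qed
  define step where "step n x u = E n * \<beta> ((1 / r n) *\<^sub>R (u - x))" for n and x u :: 'x
  have step0: "0 \<le> step n x u" and stepE: "step n x u \<le> E n" for n x u
    using E0[of n] \<beta>01 by (auto simp: step_def mult_left_le)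
  \<comment> \<open>A state pairs the current almost minimiser with the current function.
    \<open>Q\<close> determines the next function completely, so the choice concerns only the new
    point. The lower bound in \<open>P\<close> survives because a step removes at most
    \<open>E n\<close>.\<close>
  define P where "P n s \<longleftrightarrow> (n = 0 \<longrightarrow> snd s = \<Phi>) \<and> fst s \<in> D \<and>
     (\<exists>B. \<forall>u\<in>D. B \<le> snd s u) \<and> (\<forall>u\<in>D. snd s (fst s) \<le> snd s u + E n / 2)"
    for n :: nat and s :: "'x \<times> ('x \<Rightarrow> real)"
  define Q where "Q n s s' \<longleftrightarrow> (\<forall>u. snd s' u = snd s u - step n (fst s) u)"
    for n :: nat and s s' :: "'x \<times> ('x \<Rightarrow> real)"
  have almost_min: "\<exists>x\<in>D. \<forall>u\<in>D. \<phi> x \<le> \<phi> u + \<eta>" if lo: "\<forall>u\<in>D. B \<le> \<phi> u" and \<eta>: "\<eta> > 0"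
    for \<phi> :: "'x \<Rightarrow> real" and B \<eta>
  proof -
    have bb: "bdd_below (\<phi> ` D)" using lo by (auto intro!: bdd_belowI2)
    obtain x where x: "x \<in> D" "\<phi> x < Inf (\<phi> ` D) + \<eta>"
      using cInf_lessD[of "\<phi> ` D" "Inf (\<phi> ` D) + \<eta>"] D(2) \<eta> by auto
    have "Inf (\<phi> ` D) \<le> \<phi> u" if "u \<in> D" for u
      using bb that by (simp add: cINF_lower)
    then show ?thesis using x by (intro bexI[of _ x]) fastforce+
  qed
  have "\<exists>s. \<forall>n. P n (s n) \<and> Q n (s n) (s (Suc n))"
  proof (rule dependent_nat_choice)
    obtain x where "x \<in> D" "\<forall>u\<in>D. \<Phi> x \<le> \<Phi> u + E 0 / 2"
      using almost_min[of B \<Phi> "E 0 / 2"] lower E0 by auto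
    then show "\<exists>s. P 0 s"
      using lower by (intro exI[of _ "(x, \<Phi>)"]) (auto simp: P_def)
  next
    fix s n assume "P n s"
    then obtain C where C: "\<forall>u\<in>D. C \<le> snd s u" by (auto simp: P_def)
    define \<phi> where "\<phi> u = snd s u - step n (fst s) u" for u
    have C': "\<forall>u\<in>D. C - E n \<le> \<phi> u"
      using C stepE[of n "fst s"] by (auto simp: \<phi>_def intro!: diff_mono)
    obtain x where "x \<in> D" "\<forall>u\<in>D. \<phi> x \<le> \<phi> u + E (Suc n) / 2"
      using almost_min[OF C', of "E (Suc n) / 2"] E0[of "Suc n"] by auto
    then show "\<exists>s'. P (Suc n) s' \<and> Q n s s'"
      using C' by (intro exI[of _ "(x, \<phi>)"]) (auto simp: P_def Q_def \<phi>_def)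
  qed
  then obtain s where s: "\<And>n. P n (s n)" "\<And>n. Q n (s n) (s (Suc n))" by auto
  define X where "X n = fst (s n)" for n
  define \<phi> where "\<phi> n = snd (s n)" for n
  have XD: "X n \<in> D" and Xmin: "\<And>u. u \<in> D \<Longrightarrow> \<phi> n (X n) \<le> \<phi> n u + E n / 2" for n
    using s(1)[of n] by (auto simp: P_def X_def \<phi>_def)
  have \<phi>0: "\<phi> 0 = \<Phi>" using s(1)[of 0] by (auto simp: P_def \<phi>_def)
  have \<phi>S: "\<phi> (Suc n) u = \<phi> n u - step n (X n) u" for n u
    using s(2)[of n] by (auto simp: Q_def X_def \<phi>_def)
  have \<phi>n: "\<phi> n u = \<Phi> u - (\<Sum>k<n. step k (X k) u)" for n u
    by (induction n) (auto simp: \<phi>0 \<phi>S)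
  \<comment> \<open>If \<open>X (Suc n)\<close> were outside the bump around \<open>X n\<close>, the
    function would be unchanged there, hence at least \<open>\<phi> n (X n) - E n / 2\<close>, while
    at \<open>X n\<close> it drops by \<open>E n\<close>. Almost minimality up to
    \<open>E (Suc n) / 2\<close> would give \<open>E n \<le> E (Suc n)\<close>.\<close>
  have dX: "dist (X n) (X (Suc n)) \<le> r n" for n
  proof (rule ccontr)
    assume "\<not> ?thesis"
    then have "1 \<le> norm ((1 / r n) *\<^sub>R (X (Suc n) - X n))"
      using r0[of n] by (simp add: dist_norm norm_minus_commute pos_le_divide_eq)
    then have "step n (X n) (X (Suc n)) = 0" by (simp only: step_def \<beta>out mult_zero_right)
    then have "\<phi> (Suc n) (X (Suc n)) = \<phi> n (X (Suc n))" by (simp add: \<phi>S)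
    moreover have "\<phi> (Suc n) (X n) = \<phi> n (X n) - E n" by (simp add: \<phi>S step_def \<beta>0)
    ultimately have "E n \<le> E (Suc n)"
      using Xmin[OF XD[of n], of "Suc n"] Xmin[OF XD[of "Suc n"], of n] by linarith
    then show False using e0 by (simp add: E_def divide_simps)
  qed
  have "convergent X"
  proof -
    have "summable (\<lambda>n. X (Suc n) - X n)"
      by (rule summable_comparison_test'[of r 0])
         (use dX in \<open>auto simp: r_def[abs_def] dist_norm norm_minus_commute intro!: summable_geometric\<close>)
    then have "convergent (\<lambda>n. \<Sum>k<n. X (Suc k) - X k)"
      by (simp add: summable_iff_convergent)
    then have "convergent (\<lambda>n. X n - X 0)"
      by (simp add: sum_lessThan_telescope)
    then show ?thesis by (simp add: convergent_diff_const_right_iff)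
  qed
  then obtain x where X: "X \<longlonglongrightarrow> x" by (auto simp: convergent_def)
  have xD: "x \<in> D" using D(1) XD X by (rule closed_sequentially)
  define h where "h n u = step n (X n) u" for n u
  define h' where "h' n u = E n *\<^sub>R ((1 / r n) *\<^sub>R \<beta>' ((1 / r n) *\<^sub>R (u - X n)))" for n u
  have hder: "(h n has_derivative blinfun_apply (h' n u)) (at u)" for n u
    using has_derivative_mult_right[OF unit_bump_scaled_derivative[OF bump, of "r n" "X n" u], of "E n"]
    unfolding h_def[abs_def] h'_def step_def by (simp add: scaleR_blinfun.rep_eq)
  have hcont: "continuous_on UNIV (h' n)" for n
    unfolding h'_def[abs_def]
    by (rule continuous_on_scaleR[OF continuous_on_const unit_bump_scaled_continuous[OF bump]])
  have hM: "\<bar>h n u\<bar> \<le> e * (1/2)^n" for n u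
    using step0[of n "X n" u] stepE[of n "X n" u] Ele[of n] by (simp add: h_def)
  have hM': "norm (h' n u) \<le> L * e * (1/2)^n" for n u
  proof -
    have "norm (h' n u) = (E n / r n) * norm (\<beta>' ((1 / r n) *\<^sub>R (u - X n)))"
      using E0[of n] r0[of n] by (simp add: h'_def)
    also have "\<dots> \<le> (E n / r n) * L"
      using E0[of n] r0[of n] by (intro mult_left_mono \<beta>'L) auto
    finally show ?thesis by (simp add: Er mult_ac)
  qed
  have sums: "(\<lambda>n. c * (1/2)^n) sums (c * 2)" for c :: real
    using sums_mult[OF geometric_sums[of "1/2::real"], of c] by simp
  define g where "g u = (\<Sum>n. h n u)" for u
  define g' where "g' u = (\<Sum>n. h' n u)" for u
  note series = C1_series[of h h', OF hder hcont hM sums_summable[OF sums] hM' sums_summable[OF sums]]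
  have gder: "(g has_derivative blinfun_apply (g' u)) (at u)" for u
    using series(1) unfolding g_def[abs_def] g'_def .
  have sh: "summable (\<lambda>n. h n u)" for u
    by (rule summable_comparison_test'[OF sums_summable[OF sums[of e]], of 0]) (simp add: hM)
  have part: "(\<Sum>k<n. h k u) \<le> g u" for n u
    unfolding g_def using sh by (intro sum_le_suminf) (auto simp: h_def step0)
  show ?thesis
  proof (rule that[OF xD gder])
    show "continuous_on UNIV g'" using series(2) by (simp add: g'_def[abs_def])
    show "0 \<le> g u \<and> g u \<le> \<epsilon>" for u
    proof
      show "0 \<le> g u" using part[of u 0] by simp
      have "g u \<le> e * 2"
        unfolding g_def sums_unique[OF sums[of e]]
        using hM[of _ u] by (intro suminf_le sh sums_summable[OF sums]) (simp add: abs_le_iff)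
      then show "g u \<le> \<epsilon>" using e2 by linarith
    qed
    show "norm (g' u) \<le> \<epsilon>" for u
      using series(3)[of u] e2(2) unfolding g'_def sums_unique[OF sums[of "L * e"], symmetric]
      by linarith
    \<comment> \<open>A point \<open>u\<close> beating \<open>x\<close> by \<open>4 * \<eta>\<close>
      is excluded by comparing at \<open>X n\<close> for large \<open>n\<close>. Since
      \<open>\<Phi> - g\<close> lies below \<open>\<phi> n\<close>, almost minimality of
      \<open>X n\<close> loses at most \<open>\<eta>\<close> for semicontinuity at \<open>x\<close>,
      \<open>\<eta>\<close> for continuity of \<open>g\<close>, \<open>\<eta>\<close> for the tail
      of the series at \<open>u\<close> and \<open>\<eta> / 2\<close> for
      \<open>E n / 2\<close>.\<close>
    show "\<Phi> x - g x \<le> \<Phi> u - g u" if u: "u \<in> D" for u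
    proof (rule ccontr)
      assume "\<not> ?thesis"
      moreover define \<eta> where "\<eta> = ((\<Phi> x - g x) - (\<Phi> u - g u)) / 4"
      ultimately have \<eta>: "\<eta> > 0" "4 * \<eta> = (\<Phi> x - g x) - (\<Phi> u - g u)"
        by simp_all
      have "\<forall>\<^sub>F n in sequentially. \<Phi> x - \<eta> < \<Phi> (X n)"
        using \<eta>(1) by (intro lsc_on_sequentially[OF lsc xD _ XD X]) simp
      moreover have "(\<lambda>n. g (X n)) \<longlonglongrightarrow> g x"
        using has_derivative_continuous[OF gder] X by (rule isCont_tendsto_compose)
      then have "\<forall>\<^sub>F n in sequentially. g (X n) < g x + \<eta>"
        using \<eta>(1) by (intro order_tendstoD) auto
      moreover have "(\<lambda>n. \<phi> n u) \<longlonglongrightarrow> \<Phi> u - g u"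
        unfolding \<phi>n g_def using summable_LIMSEQ[OF sh[of u]]
        by (intro tendsto_diff tendsto_const) (simp add: h_def)
      then have "\<forall>\<^sub>F n in sequentially. \<phi> n u < \<Phi> u - g u + \<eta>"
        using \<eta>(1) by (intro order_tendstoD) auto
      moreover have "(\<lambda>n. e * (1/2)^n) \<longlonglongrightarrow> 0"
        using sums_summable[OF sums] by (rule summable_LIMSEQ_zero)
      then have "\<forall>\<^sub>F n in sequentially. e * (1/2)^n < \<eta>"
        using \<eta>(1) by (intro order_tendstoD) auto
      ultimately have "\<forall>\<^sub>F n in sequentially. False"
      proof eventually_elim
        case (elim n)
        have "\<Phi> (X n) - g (X n) \<le> \<phi> n (X n)"
          using part[where n=n and u="X n"] by (simp add: \<phi>n h_def)
        moreover have "E n < \<eta>"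
          using Ele[of n] elim(4) by (rule le_less_trans)
        ultimately show False
          using elim(1,2,3) Xmin[OF u, of n] E0[of n] \<eta>(2) by argo
      qed
      then show False by simp
    qed
  qed
qed

lemma unit_bump_lipschitz:
  fixes \<beta> :: "'x::real_normed_vector \<Rightarrow> real"
  assumes "unit_bump \<beta> \<beta>' L"
  shows "\<bar>\<beta> u - \<beta> v\<bar> \<le> L * norm (u - v)"
  using differentiable_bound[OF convex_UNIV, of \<beta> "\<lambda>u. blinfun_apply (\<beta>' u)" L u v] assms
  by (simp add: unit_bump_def norm_blinfun.rep_eq)

text \<open>The idea is to minimise \<open>f x - t a + c (1 - \<beta> ((x - y - t h) / \<rho>))\<close> with \<open>h = z - y\<close>, up to a small
  smooth perturbation, jointly in \<open>x\<close> and \<open>t \<in> [0, 1]\<close>. The minimum is not attained at \<open>t = 1\<close>, so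
  its right derivative in \<open>t\<close> is nonnegative, which says that the derivative at \<open>x\<close> of the smooth
  function touching \<open>f\<close> from below is at least about \<open>a\<close> in the direction \<open>h\<close>.\<close>

theorem approximate_mean_value:
  fixes f \<beta> :: "'x::banach \<Rightarrow> real"
  assumes bump: "unit_bump \<beta> \<beta>' L"
    and "r > 0" and lsc: "lsc_on (cball x0 r) f" and lower: "\<And>u. u \<in> cball x0 r \<Longrightarrow> B \<le> f u"
    and y: "y \<in> ball x0 (r / 2)" and z: "z \<in> ball x0 (r / 2)" and a: "a < f z - f y"
  obtains x g g' where "x \<in> ball x0 r" "\<And>u. (g has_derivative blinfun_apply (g' u)) (at u)"
    "continuous_on UNIV g'" "\<And>u. u \<in> cball x0 r \<Longrightarrow> f x - g x \<le> f u - g u"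
    "a < blinfun_apply (g' x) (z - y)"
proof -
  have \<beta>01: "0 \<le> \<beta> u" "\<beta> u \<le> 1" and \<beta>0: "\<beta> 0 = 1" and \<beta>out: "1 \<le> norm u \<Longrightarrow> \<beta> u = 0" for u
    using bump by (auto simp: unit_bump_def)
  have L0: "0 \<le> L"
    using bump order_trans[OF norm_ge_zero] unfolding unit_bump_def by blast
  define h where "h = z - y"
  \<comment> \<open>\<open>f z - f y = a + 4 * \<kappa>\<close>, so \<open>a1\<close> is the
    midpoint of \<open>a\<close> and \<open>f z - f y\<close>. The upper half of the gap excludes
    \<open>t = 1\<close>, the lower half absorbs the derivative of the perturbation.\<close>
  define \<kappa> where "\<kappa> = (f z - f y - a) / 4"
  define a1 where "a1 = a + 2 * \<kappa>"
  have \<kappa>: "\<kappa> > 0" and fz: "f z - a1 = f y + 2 * \<kappa>"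
    using a by (simp_all add: \<kappa>_def a1_def field_simps)
  have zr: "z \<in> cball x0 r" and yr: "y \<in> cball x0 r"
    using y z \<open>r > 0\<close> by auto
  obtain \<rho>1 where "\<rho>1 > 0" and \<rho>1: "\<And>u. u \<in> cball x0 r \<Longrightarrow> u \<noteq> z \<Longrightarrow> dist u z < \<rho>1 \<Longrightarrow> f z - \<kappa> < f u"
    using lsc zr \<kappa> unfolding lsc_on_def eventually_at by (metis diff_less_eq less_add_same_cancel1)
  define \<rho> where "\<rho> = min \<rho>1 (r / 2)"
  have \<rho>: "\<rho> > 0" "\<rho> \<le> r / 2"
    using \<open>\<rho>1 > 0\<close> \<open>r > 0\<close> by (auto simp: \<rho>_def)
  have near_z: "f z - \<kappa> < f u" if "u \<in> cball x0 r" "dist u z < \<rho>" for u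
    using that \<rho>1[of u] \<kappa> by (cases "u = z") (auto simp: \<rho>_def)
  \<comment> \<open>Away from the moving centre \<open>y + t *\<^sub>R h\<close> the bump vanishes
    and the functional is at least \<open>B + c - \<bar>a1\<bar> = f y + 1\<close>. This exceeds its
    value \<open>f y\<close> at \<open>x = y\<close>, \<open>t = 0\<close> by more than the
    perturbation can compensate.\<close>
  define c where "c = f y + 1 - B + \<bar>a1\<bar>"
  have c0: "c \<ge> 1" using lower[OF yr] by (simp add: c_def)
  define \<Psi> where "\<Psi> t x = c * (1 - \<beta> ((1 / \<rho>) *\<^sub>R (x - (y + t *\<^sub>R h)))) - t * a1" for t x
  have \<beta>cont: "continuous_on UNIV \<beta>"
    using bump unfolding unit_bump_def
    by (meson continuous_at_imp_continuous_on has_derivative_continuous)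
  have \<Psi>cont: "continuous_on {0..1} (\<lambda>t. \<Psi> t x)" for x
    unfolding \<Psi>_def by (intro continuous_intros continuous_on_compose2[OF \<beta>cont]) simp
  have \<Psi>lip: "\<bar>\<Psi> t x - \<Psi> t x'\<bar> \<le> c * L / \<rho> * norm (x - x')" for t x x'
  proof -
    have "\<bar>\<Psi> t x - \<Psi> t x'\<bar> = c * \<bar>\<beta> ((1 / \<rho>) *\<^sub>R (x' - (y + t *\<^sub>R h))) - \<beta> ((1 / \<rho>) *\<^sub>R (x - (y + t *\<^sub>R h)))\<bar>"
      using c0 by (simp add: \<Psi>_def abs_mult flip: right_diff_distrib)
    also have "\<dots> \<le> c * (L * norm ((1 / \<rho>) *\<^sub>R (x' - (y + t *\<^sub>R h)) - (1 / \<rho>) *\<^sub>R (x - (y + t *\<^sub>R h))))"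
      using c0 by (intro mult_left_mono unit_bump_lipschitz[OF bump]) simp
    also have "(1 / \<rho>) *\<^sub>R (x' - (y + t *\<^sub>R h)) - (1 / \<rho>) *\<^sub>R (x - (y + t *\<^sub>R h)) = (1 / \<rho>) *\<^sub>R (x' - x)"
      by (simp add: algebra_simps)
    finally show ?thesis
      using \<rho> by (simp add: norm_minus_commute)
  qed
  \<comment> \<open>Minimising out the compact parameter \<open>t\<close> leaves a problem in
    \<open>'x\<close> alone, to which the variational principle applies. The marginal function
    \<open>m\<close> is Lipschitz as an infimum of functions with a common Lipschitz
    constant.\<close>
  have "\<exists>\<tau>\<in>{0..1}. \<forall>t\<in>{0..1}. \<Psi> \<tau> x \<le> \<Psi> t x" for x
    using \<Psi>cont by (intro continuous_attains_inf) auto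
  then obtain \<tau> where \<tau>01: "\<And>x. \<tau> x \<in> {0..1}" and \<tau>: "\<And>x t. t \<in> {0..1} \<Longrightarrow> \<Psi> (\<tau> x) x \<le> \<Psi> t x"
    by metis
  define m where "m x = \<Psi> (\<tau> x) x" for x
  have m_le: "m x \<le> \<Psi> t x" if "t \<in> {0..1}" for t x
    using \<tau>[OF that] by (simp add: m_def)
  have m_lip: "m x \<le> m x' + c * L / \<rho> * norm (x - x')" for x x'
    using m_le[OF \<tau>01, of x x'] \<Psi>lip[of "\<tau> x'" x x'] by (simp add: m_def)
  have m_cont: "continuous_on UNIV m"
  proof (rule lipschitz_on_continuous_on)
    show "(c * L / \<rho>)-lipschitz_on UNIV m"
    proof (rule lipschitz_onI)
      show "dist (m u) (m v) \<le> c * L / \<rho> * dist u v" for u v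
        using m_lip[of u v] m_lip[of v u] by (simp add: dist_norm norm_minus_commute abs_le_iff)
      show "0 \<le> c * L / \<rho>" using c0 L0 \<rho> by simp
    qed
  qed
  have lsc': "lsc_on (cball x0 r) (\<lambda>u. f u + m u)"
    unfolding lsc_on_def
  proof (intro ballI allI impI)
    fix u b assume u: "u \<in> cball x0 r" and b: "b < f u + m u"
    define \<eta> where "\<eta> = (f u + m u - b) / 2"
    have \<eta>: "\<eta> > 0" using b by (simp add: \<eta>_def)
    have "\<forall>\<^sub>F v in at u within cball x0 r. f u - \<eta> < f v"
      using lsc u \<eta> by (simp add: lsc_on_def)
    moreover have "(m \<longlongrightarrow> m u) (at u within cball x0 r)"
      using m_cont unfolding continuous_on_def by (meson UNIV_I subset_UNIV tendsto_within_subset)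
    then have "\<forall>\<^sub>F v in at u within cball x0 r. m u - \<eta> < m v"
      using \<eta> by (intro order_tendstoD) auto
    ultimately show "\<forall>\<^sub>F v in at u within cball x0 r. b < f v + m v"
    proof eventually_elim
      case (elim v)
      then show ?case unfolding \<eta>_def by argo
    qed
  qed
  have \<Psi>lower: "- \<bar>a1\<bar> \<le> \<Psi> t x" if "t \<in> {0..1}" for t x
  proof -
    have "t * a1 \<le> \<bar>a1\<bar>"
      using that mult_mono[of t 1 "\<bar>a1\<bar>" "\<bar>a1\<bar>"] abs_le_D1[of "t * a1" "t * \<bar>a1\<bar>"]
      by (simp add: abs_mult)
    moreover have "0 \<le> c * (1 - \<beta> ((1 / \<rho>) *\<^sub>R (x - (y + t *\<^sub>R h))))"
      using c0 \<beta>01 by simp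
    ultimately show ?thesis by (simp add: \<Psi>_def)
  qed
  \<comment> \<open>\<open>\<epsilon> < \<kappa>\<close> excludes \<open>t = 1\<close>,
    \<open>\<epsilon> < 1\<close> excludes leaving the bump, and
    \<open>\<epsilon> * norm h \<le> \<kappa>\<close> limits the perturbation in the direction
    \<open>h\<close>; the denominator \<open>1 + norm h\<close> also covers
    \<open>h = 0\<close>.\<close>
  define \<epsilon> where "\<epsilon> = min (min (\<kappa> / 2) (1 / 2)) (\<kappa> / (1 + norm h))"
  have n1: "0 < 1 + norm h" using norm_ge_zero[of h] by linarith
  have \<epsilon>: "\<epsilon> > 0" "\<epsilon> < \<kappa>" "\<epsilon> < 1" using \<kappa> n1 by (auto simp: \<epsilon>_def)
  have "\<epsilon> * norm h \<le> \<kappa> / (1 + norm h) * (1 + norm h)"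
    using \<kappa> n1 \<epsilon> by (intro mult_mono) (auto simp: \<epsilon>_def)
  then have \<epsilon>h: "\<epsilon> * norm h \<le> \<kappa>" using n1 by simp
  have low2: "B - \<bar>a1\<bar> \<le> f u + m u" if "u \<in> cball x0 r" for u
    using lower[OF that] \<Psi>lower[OF \<tau>01, of u u] by (simp add: m_def)
  obtain x g g' where x: "x \<in> cball x0 r" and g: "\<And>u. (g has_derivative blinfun_apply (g' u)) (at u)"
    and cg': "continuous_on UNIV g'" and g\<epsilon>: "\<And>u. 0 \<le> g u \<and> g u \<le> \<epsilon>" and g'\<epsilon>: "\<And>u. norm (g' u) \<le> \<epsilon>"
    and min: "\<And>u. u \<in> cball x0 r \<Longrightarrow> f x + m x - g x \<le> f u + m u - g u"
    using smooth_variational_principle[OF bump closed_cball _ lsc' low2 \<epsilon>(1)] zr by blast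
  define t where "t = \<tau> x"
  have t01: "t \<in> {0..1}" using \<tau>01 by (simp add: t_def)
  have min2: "f x + \<Psi> t x - g x \<le> f u + \<Psi> s u - g u" if "u \<in> cball x0 r" "s \<in> {0..1}" for u s
    using min[OF that(1)] m_le[OF that(2), of u] by (simp add: t_def m_def)
  have "\<Psi> 0 y = 0" by (simp add: \<Psi>_def \<beta>0)
  then have val: "f x + \<Psi> t x \<le> f y + \<epsilon>"
    using min2[OF yr, of 0] g\<epsilon>[of x] g\<epsilon>[of y] by simp
  have close: "dist x (y + t *\<^sub>R h) < \<rho>"
  proof (rule ccontr)
    assume "\<not> ?thesis"
    then have "1 \<le> norm ((1 / \<rho>) *\<^sub>R (x - (y + t *\<^sub>R h)))"
      using \<rho> by (simp add: dist_norm pos_le_divide_eq)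
    then have "\<Psi> t x = c - t * a1" by (simp only: \<Psi>_def \<beta>out) simp
    moreover have "t * a1 \<le> \<bar>a1\<bar>"
      using t01 mult_mono[of t 1 "\<bar>a1\<bar>" "\<bar>a1\<bar>"] abs_le_D1[of "t * a1" "t * \<bar>a1\<bar>"]
      by (simp add: abs_mult)
    ultimately show False
      using val lower[OF x] \<epsilon>(3) by (simp add: c_def)
  qed
  have xin: "x \<in> ball x0 r"
  proof -
    have "y + t *\<^sub>R h = (1 - t) *\<^sub>R y + t *\<^sub>R z"
      by (simp add: h_def algebra_simps)
    then have "y + t *\<^sub>R h \<in> ball x0 (r / 2)"
      using t01 convexD_alt[OF convex_ball y z, of t] by simp
    then show ?thesis
      using close \<rho>(2) dist_triangle[of x0 x "y + t *\<^sub>R h"] by (simp add: dist_commute)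
  qed
  \<comment> \<open>At \<open>t = 1\<close> the point \<open>x\<close> would be within
    \<open>\<rho>\<close> of \<open>z\<close>, where semicontinuity keeps \<open>f\<close> above
    \<open>f z - \<kappa>\<close>. The functional would then exceed \<open>f y + \<kappa>\<close>,
    against \<open>val\<close>.\<close>
  have t1: "t < 1"
  proof (rule ccontr)
    assume "\<not> t < 1"
    then have "t = 1" using t01 by simp
    then have "dist x z < \<rho>" using close by (simp add: h_def)
    then have "f z - \<kappa> < f x" using near_z x by simp
    moreover have "- a1 \<le> \<Psi> t x"
      using c0 \<beta>01 by (simp add: \<Psi>_def \<open>t = 1\<close>)
    ultimately show False using val fz \<epsilon>(2) by linarith
  qed
  define D where "D = \<beta>' ((1 / \<rho>) *\<^sub>R (x - (y + t *\<^sub>R h)))"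
  \<comment> \<open>Moving the centre of the bump along \<open>h\<close> acts like moving
    \<open>x\<close> along \<open>- h\<close>, so the derivative of \<open>\<Psi>\<close> in
    \<open>t\<close> is \<open>c * D h / \<rho> - a1\<close>. If it were negative, a slightly larger
    \<open>t\<close>, available because \<open>t < 1\<close>, would do better than
    \<open>\<tau> x\<close>.\<close>
  have D: "c * D h / \<rho> \<ge> a1"
  proof (rule ccontr)
    assume neg: "\<not> ?thesis"
    have "((\<lambda>t. (1 / \<rho>) *\<^sub>R (x - (y + t *\<^sub>R h))) has_derivative (\<lambda>s. (1 / \<rho>) *\<^sub>R (- (s *\<^sub>R h)))) (at t)"
      by (auto intro!: derivative_eq_intros)
    moreover have "(\<beta> has_derivative blinfun_apply D) (at ((1 / \<rho>) *\<^sub>R (x - (y + t *\<^sub>R h))))"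
      using bump by (simp add: unit_bump_def D_def)
    ultimately have "(\<beta> \<circ> (\<lambda>t. (1 / \<rho>) *\<^sub>R (x - (y + t *\<^sub>R h))) has_derivative
        blinfun_apply D \<circ> (\<lambda>s. (1 / \<rho>) *\<^sub>R (- (s *\<^sub>R h)))) (at t)"
      by (rule diff_chain_at)
    moreover have "blinfun_apply D \<circ> (\<lambda>s. (1 / \<rho>) *\<^sub>R (- (s *\<^sub>R h))) = (*) (- D h / \<rho>)"
      by (simp add: fun_eq_iff blinfun.scaleR_right blinfun.minus_right)
    ultimately have d: "((\<lambda>t. \<beta> ((1 / \<rho>) *\<^sub>R (x - (y + t *\<^sub>R h)))) has_real_derivative - D h / \<rho>) (at t)"
      by (simp add: has_field_derivative_def comp_def)
    have "((\<lambda>t. \<Psi> t x) has_real_derivative (c * (0 - - D h / \<rho>) - a1)) (at t)"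
      unfolding \<Psi>_def by (rule derivative_eq_intros d refl | simp)+
    moreover have "c * (0 - - D h / \<rho>) - a1 < 0" using neg by simp
    ultimately obtain d where "d > 0" and d: "\<And>s. 0 < s \<Longrightarrow> s < d \<Longrightarrow> \<Psi> (t + s) x < \<Psi> t x"
      using DERIV_neg_dec_right by blast
    define s where "s = min (d / 2) (1 - t)"
    have "0 < s" "s < d" "t + s \<in> {0..1}"
      using \<open>d > 0\<close> t1 t01 by (auto simp: s_def)
    then show False using d[of s] \<tau>[of "t + s" x] by (simp add: t_def)
  qed
  define G where "G u = g u - \<Psi> t u" for u
  define G' where "G' u = g' u + c *\<^sub>R ((1 / \<rho>) *\<^sub>R \<beta>' ((1 / \<rho>) *\<^sub>R (u - (y + t *\<^sub>R h))))" for u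
  show ?thesis
  proof (rule that[OF xin])
    show "(G has_derivative blinfun_apply (G' u)) (at u)" for u
    proof -
      have "((\<lambda>u. g u + c * \<beta> ((1 / \<rho>) *\<^sub>R (u - (y + t *\<^sub>R h))) + (t * a1 - c)) has_derivative
          (\<lambda>v. g' u v + c * ((1 / \<rho>) *\<^sub>R \<beta>' ((1 / \<rho>) *\<^sub>R (u - (y + t *\<^sub>R h)))) v + 0)) (at u)"
        by (intro has_derivative_add has_derivative_const has_derivative_mult_right g
            unit_bump_scaled_derivative[OF bump])
      moreover have "(\<lambda>u. g u + c * \<beta> ((1 / \<rho>) *\<^sub>R (u - (y + t *\<^sub>R h))) + (t * a1 - c)) = G"
        by (simp add: G_def \<Psi>_def fun_eq_iff algebra_simps)
      ultimately show ?thesis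
        by (simp add: G'_def plus_blinfun.rep_eq scaleR_blinfun.rep_eq)
    qed
    show "continuous_on UNIV G'"
      unfolding G'_def[abs_def]
      by (intro continuous_on_add cg' continuous_on_scaleR[OF continuous_on_const]
          unit_bump_scaled_continuous[OF bump])
    show "f x - G x \<le> f u - G u" if "u \<in> cball x0 r" for u
      using min2[OF that t01] by (simp add: G_def)
    have "- \<epsilon> * norm h \<le> g' x h"
      using norm_blinfun[of "g' x" h] mult_right_mono[OF g'\<epsilon>[of x] norm_ge_zero[of h]] by simp
    then show "a < G' x (z - y)"
      using D \<kappa> \<epsilon>h
      by (simp add: G'_def D_def h_def[symmetric] a1_def plus_blinfun.rep_eq scaleR_blinfun.rep_eq)
  qed
qed

section \<open>Regularity, semicontinuity under composition, and increments on intervals\<close>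

lemma paracompact_regular:
  fixes x :: "'m::t2_space"
  assumes "paracompact_space TYPE('m)" "open U" "x \<in> U"
  obtains V where "open V" "x \<in> V" "closure V \<subseteq> U"
proof -
  \<comment> \<open>Members of a refinement of this cover not contained in \<open>U\<close> have
    closures missing \<open>x\<close>. By local finiteness closure commutes with their union, so the
    closure of the union misses \<open>x\<close> as well; its complement is the required
    \<open>V\<close>.\<close>
  define C where "C = insert U {W. open W \<and> x \<notin> closure W}"
  have "\<Union>C = UNIV"
  proof -
    have "\<exists>W\<in>C. y \<in> W" for y
    proof (cases "y = x")
      case True then show ?thesis using assms(3) by (auto simp: C_def)
    next
      case False
      then obtain V W where VW: "open V" "open W" "x \<in> V" "y \<in> W" "V \<inter> W = {}"
        using hausdorff[of x y] by auto
      then have "x \<notin> closure W"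
        by (metis disjoint_iff open_Int_closure_eq_empty)
      then show ?thesis using VW by (auto simp: C_def)
    qed
    then show ?thesis by auto
  qed
  moreover have "\<forall>W\<in>C. open W" using assms(2) by (auto simp: C_def)
  ultimately have "\<exists>\<V>. (\<forall>V\<in>\<V>. open V) \<and> \<Union>\<V> = UNIV \<and> (\<forall>V\<in>\<V>. \<exists>W\<in>C. V \<subseteq> W) \<and>
      locally_finite_in euclidean \<V>"
    using assms(1)[unfolded paracompact_space_def, rule_format, of C] by simp
  then obtain \<V> where \<V>: "\<forall>V\<in>\<V>. open V" "\<Union>\<V> = UNIV" "\<forall>V\<in>\<V>. \<exists>W\<in>C. V \<subseteq> W"
      "locally_finite_in euclidean \<V>"
    by (elim exE conjE)
  define \<V>' where "\<V>' = {V \<in> \<V>. \<not> V \<subseteq> U}"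
  have "locally_finite_in euclidean \<V>'"
    using \<V>(4) by (rule locally_finite_in_subset) (auto simp: \<V>'_def)
  then have cl: "closure (\<Union>\<V>') = \<Union>(closure ` \<V>')"
    using closure_of_locally_finite_Union[of euclidean \<V>'] by simp
  have "x \<notin> closure V" if "V \<in> \<V>'" for V
  proof -
    have "V \<in> \<V>" "\<not> V \<subseteq> U" using that by (auto simp: \<V>'_def)
    then obtain W where "W \<in> C" "V \<subseteq> W" using \<V>(3) by blast
    then have "x \<notin> closure W" using \<open>\<not> V \<subseteq> U\<close> by (auto simp: C_def)
    then show ?thesis using closure_mono[OF \<open>V \<subseteq> W\<close>] by blast
  qed
  then have x: "x \<in> - closure (\<Union>\<V>')" by (simp add: cl)
  have op: "open (\<Union>\<V>')" using \<V>(1) by (auto simp: \<V>'_def)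
  have "- \<Union>\<V>' \<subseteq> U"
  proof
    fix y assume y: "y \<in> - \<Union>\<V>'"
    have "y \<in> \<Union>\<V>" using \<V>(2) by simp
    then show "y \<in> U" using y by (auto simp: \<V>'_def)
  qed
  moreover have "closure (- closure (\<Union>\<V>')) \<subseteq> - \<Union>\<V>'"
    using op closure_subset[of "\<Union>\<V>'"] by (intro closure_minimal) auto
  ultimately show ?thesis
    using x by (intro that[of "- closure (\<Union>\<V>')"]) auto
qed

text \<open>\<open>h\<close> may return to the value \<open>h u\<close> at points other than
  \<open>u\<close>, so the punctured filter is first replaced by \<open>nhds (h u)\<close>; at
  \<open>h u\<close> itself the inequality is \<open>a < f (h u)\<close>.\<close>

lemma lsc_on_compose:
  assumes f: "lsc_on T f" and h: "continuous_on S h" and sub: "h ` S \<subseteq> T"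
  shows "lsc_on S (\<lambda>u. f (h u))"
  unfolding lsc_on_def
proof (intro ballI allI impI)
  fix u a assume u: "u \<in> S" and a: "a < f (h u)"
  have "\<forall>\<^sub>F y in at (h u) within T. a < f y"
    using f u a sub unfolding lsc_on_def by blast
  then have "\<forall>\<^sub>F y in nhds (h u). y \<in> T \<longrightarrow> a < f y"
    unfolding eventually_at_filter by eventually_elim (use a in auto)
  moreover have "filterlim h (nhds (h u)) (at u within S)"
    using h u by (simp add: continuous_on_def)
  ultimately have "\<forall>\<^sub>F v in at u within S. h v \<in> T \<longrightarrow> a < f (h v)"
    by (rule eventually_compose_filterlim)
  moreover have "\<forall>\<^sub>F v in at u within S. v \<in> S"
    by (simp add: eventually_at_filter)
  ultimately show "\<forall>\<^sub>F v in at u within S. a < f (h v)"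
    by eventually_elim (use sub in auto)
qed

text \<open>Bisection: the inequality is additive over adjacent intervals, and near each
  \<open>t\<close> it holds for intervals containing \<open>t\<close>, since for monotone
  \<open>V\<close> the comparisons of both ends with \<open>t\<close> add up. \<open>loc\<close>
  compares with the base point \<open>t\<close> only, which is all that differentiability of a path
  provides.\<close>

lemma local_increment_bound:
  fixes u V :: "real \<Rightarrow> real"
  assumes "a \<le> b" and mono: "\<And>s t. a \<le> s \<Longrightarrow> s \<le> t \<Longrightarrow> t \<le> b \<Longrightarrow> V s \<le> V t"
    and loc: "\<And>t. t \<in> {a..b} \<Longrightarrow> \<forall>\<^sub>F s in at t within {a..b}. \<bar>u s - u t\<bar> \<le> \<bar>V s - V t\<bar>"
  shows "\<bar>u b - u a\<bar> \<le> V b - V a"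
proof -
  define P where "P x y \<longleftrightarrow> (a \<le> x \<longrightarrow> x \<le> y \<longrightarrow> y \<le> b \<longrightarrow> \<bar>u y - u x\<bar> \<le> V y - V x)" for x y
  have "P a b"
    using \<open>a \<le> b\<close>
  proof (induction rule: Bolzano)
    case (trans x y z)
    then show ?case unfolding P_def by (auto simp: abs_le_iff)
  next
    case (local t)
    then have t: "t \<in> {a..b}" by simp
    from loc[OF t] obtain d where "d > 0"
      and d: "\<And>s. s \<in> {a..b} \<Longrightarrow> s \<noteq> t \<Longrightarrow> dist s t < d \<Longrightarrow> \<bar>u s - u t\<bar> \<le> \<bar>V s - V t\<bar>"
      unfolding eventually_at by blast
    have d': "\<bar>u s - u t\<bar> \<le> \<bar>V s - V t\<bar>" if "a \<le> s" "s \<le> b" "\<bar>s - t\<bar> < d" for s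
      using d[of s] that by (cases "s = t") (auto simp: dist_real_def)
    show ?case
    proof (intro exI[of _ d] conjI allI impI)
      fix x y assume xy: "x \<le> t \<and> t \<le> y \<and> y - x < d"
      show "P x y"
        unfolding P_def
      proof (intro impI)
        assume "a \<le> x" "x \<le> y" "y \<le> b"
        then have "\<bar>u x - u t\<bar> \<le> V t - V x" "\<bar>u y - u t\<bar> \<le> V y - V t"
          using xy d'[of x] d'[of y] mono[of x t] mono[of t y] by auto
        then show "\<bar>u y - u x\<bar> \<le> V y - V x" by linarith
      qed
    qed (fact \<open>d > 0\<close>)
  qed
  then show ?thesis using \<open>a \<le> b\<close> by (simp add: P_def)
qed


lemma has_derivative_cong_nhds:
  assumes "(f has_derivative D) (at x)" "\<forall>\<^sub>F u in nhds x. f u = g u"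
  shows "(g has_derivative D) (at x)"
proof -
  obtain T where "open T" "x \<in> T" "\<And>u. u \<in> T \<Longrightarrow> f u = g u"
    using assms(2) unfolding eventually_nhds by (elim exE conjE) simp
  with assms(1) show ?thesis by (rule has_derivative_transform_within_open)
qed


section \<open>Charts and tangent vectors\<close>

locale finsler_manifold =
  fixes A :: "('m::t2_space, 'x::banach) chart set"
    and F :: "'m \<times> ('m, 'x) tangent \<Rightarrow> real"
  assumes finsler: "C1_finsler_manifold A F"
begin

lemma atlas: "C1_atlas A"
  using finsler by (simp add: C1_finsler_manifold_def C1_banach_manifold_def)

lemma atlas_covers:
  obtains c where "c \<in> A" "x \<in> fst c"
  using atlas unfolding C1_atlas_def by (metis UNIV_I UN_E)

lemma chart_open:
  assumes "c \<in> charts A"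
  shows "open (fst c)" "open (snd c ` fst c)"
  using assms by (auto simp: charts_def is_chart_def)

lemma chart_continuous:
  assumes "c \<in> charts A"
  shows "continuous_on (fst c) (snd c)" "continuous_on (snd c ` fst c) (chart_inv c)"
  using assms by (auto simp: charts_def is_chart_def homeomorphism_def)

lemma chart_inv_chart [simp]:
  assumes "c \<in> charts A" "x \<in> fst c"
  shows "chart_inv c (snd c x) = x"
  using assms by (auto simp: charts_def is_chart_def homeomorphism_def)

lemma chart_inv_in:
  assumes "c \<in> charts A" "u \<in> snd c ` fst c"
  shows "chart_inv c u \<in> fst c" "snd c (chart_inv c u) = u"
  using assms by auto

lemma chart_image_open:
  assumes c: "c \<in> charts A" and "open V"
  shows "open (snd c ` (fst c \<inter> V))"
proof -
  have "snd c ` (fst c \<inter> V) = snd c ` fst c \<inter> chart_inv c -` V"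
    using c by auto
  then show ?thesis
    using continuous_open_preimage[OF chart_continuous(2)[OF c] chart_open(2)[OF c] \<open>open V\<close>] by simp
qed

lemma chart_preimage_open:
  assumes c: "c \<in> charts A" and "open V"
  shows "open (fst c \<inter> snd c -` V)"
  using continuous_open_preimage[OF chart_continuous(1)[OF c] chart_open(1)[OF c] \<open>open V\<close>] .

lemma chart_eventually:
  assumes c: "c \<in> charts A" and x: "x \<in> fst c" and P: "\<forall>\<^sub>F u in nhds (snd c x). P u"
  shows "\<forall>\<^sub>F y in nhds x. y \<in> fst c \<and> P (snd c y)"
proof -
  obtain V where "open V" "snd c x \<in> V" "\<forall>u\<in>V. P u"
    using P unfolding eventually_nhds by blast
  then show ?thesis
    unfolding eventually_nhds using chart_preimage_open[OF c \<open>open V\<close>] x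
    by (intro exI[of _ "fst c \<inter> snd c -` V"]) auto
qed

lemma charts_at_exists:
  obtains c where "c \<in> charts_at A x"
proof -
  obtain c where "c \<in> A" "x \<in> fst c"
    by (rule atlas_covers)
  then have "c \<in> charts_at A x"
    using atlas by (auto simp: C1_atlas_def charts_at_def charts_def)
  then show ?thesis by (rule that)
qed

text \<open>The maximal atlas is defined by compatibility with \<open>A\<close> only. Near a given
  point the transition factors through a chart \<open>c0\<close> of \<open>A\<close>, and both
  factors are of class C1.\<close>

lemma transition_C1:
  assumes c: "c \<in> charts A" and c': "c' \<in> charts A"
  shows "C1_on (snd c ` (fst c \<inter> fst c')) (snd c' \<circ> chart_inv c)"
proof (rule C1_on_local)
  fix u assume "u \<in> snd c ` (fst c \<inter> fst c')"
  then obtain x where x: "x \<in> fst c" "x \<in> fst c'" "u = snd c x" by auto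
  obtain c0 where c0: "c0 \<in> A" "x \<in> fst c0"
    by (rule atlas_covers)
  then have c0': "c0 \<in> charts A"
    using atlas by (auto simp: C1_atlas_def charts_def)
  define T where "T = snd c ` (fst c \<inter> (fst c' \<inter> fst c0))"
  have oT: "open T"
    unfolding T_def using chart_open(1)[OF c'] chart_open(1)[OF c0'] by (intro chart_image_open[OF c]) auto
  have 1: "C1_on T (snd c0 \<circ> chart_inv c)"
    using c c0(1) by (auto simp: charts_def C1_compatible_def T_def intro: C1_on_subset)
  have 2: "C1_on (snd c0 ` (fst c' \<inter> fst c0)) (snd c' \<circ> chart_inv c0)"
    using c' c0(1) by (auto simp: charts_def C1_compatible_def)
  have "C1_on T ((snd c' \<circ> chart_inv c0) \<circ> (snd c0 \<circ> chart_inv c))"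
    by (rule C1_on_compose[OF 1 2]) (use c in \<open>auto simp: T_def\<close>)
  then have "C1_on T (snd c' \<circ> chart_inv c)"
    using oT by (rule C1_on_cong) (use c c0' in \<open>auto simp: T_def\<close>)
  then show "\<exists>T. open T \<and> u \<in> T \<and> C1_on T (snd c' \<circ> chart_inv c)"
    using oT x c0(2) by (intro exI[of _ T]) (auto simp: T_def)
qed

lemma charts_atD:
  assumes "c \<in> charts_at A x"
  shows "c \<in> charts A" "x \<in> fst c"
  using assms by (auto simp: charts_at_def)

lemma transition_deriv:
  assumes "c \<in> charts_at A x" "c' \<in> charts_at A x"
  shows "((snd c' \<circ> chart_inv c) has_derivative transition_deriv c c' x) (at (snd c x))"
proof -
  have "(snd c' \<circ> chart_inv c) differentiable (at (snd c x))"
    using assms by (intro C1_on_imp_differentiable[OF transition_C1]) (auto simp: charts_at_def)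
  then show ?thesis
    unfolding transition_deriv_def by (simp only: frechet_derivative_works)
qed

lemma chart_image_nhds:
  assumes "c \<in> charts_at A x" "open V" "x \<in> V"
  shows "\<forall>\<^sub>F u in nhds (snd c x). u \<in> snd c ` fst c \<and> chart_inv c u \<in> V"
  unfolding eventually_nhds
  using assms chart_image_open[of c V] by (intro exI[of _ "snd c ` (fst c \<inter> V)"]) (auto simp: charts_at_def)

text \<open>Chain rule, for a composite that agrees with the direct transition near
  \<open>snd c x\<close> only. It puts the families built by \<open>tangent_lift\<close> into the
  tangent space.\<close>

lemma transition_deriv_cocycle:
  assumes "c \<in> charts_at A x" "c' \<in> charts_at A x" "c'' \<in> charts_at A x"
  shows "transition_deriv c' c'' x (transition_deriv c c' x v) = transition_deriv c c'' x v"
proof -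
  have eq: "(snd c' \<circ> chart_inv c) (snd c x) = snd c' x"
    using assms by (auto simp: charts_at_def)
  have "((snd c'' \<circ> chart_inv c') \<circ> (snd c' \<circ> chart_inv c) has_derivative
      transition_deriv c' c'' x \<circ> transition_deriv c c' x) (at (snd c x))"
    by (rule diff_chain_at[OF transition_deriv[OF assms(1,2)]])
       (use transition_deriv[OF assms(2,3)] eq in simp)
  moreover have "\<forall>\<^sub>F u in nhds (snd c x). ((snd c'' \<circ> chart_inv c') \<circ> (snd c' \<circ> chart_inv c)) u =
      (snd c'' \<circ> chart_inv c) u"
    using chart_image_nhds[OF assms(1) chart_open(1)[OF charts_atD(1)[OF assms(2)]] charts_atD(2)[OF assms(2)]]
    by eventually_elim (use assms in \<open>auto simp: charts_at_def\<close>)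
  ultimately have "((snd c'' \<circ> chart_inv c) has_derivative
      transition_deriv c' c'' x \<circ> transition_deriv c c' x) (at (snd c x))"
    by (rule has_derivative_cong_nhds)
  then have "transition_deriv c' c'' x \<circ> transition_deriv c c' x = transition_deriv c c'' x"
    using transition_deriv[OF assms(1,3)] by (rule has_derivative_unique)
  then show ?thesis by (metis comp_apply)
qed

lemma tangent_lift_in:
  assumes "c \<in> charts_at A x"
  shows "tangent_lift A c x v \<in> tangent_space A x"
  using assms by (auto simp: tangent_space_def tangent_lift_def transition_deriv_cocycle)

lemma tangent_lift_of_tangent:
  assumes "c \<in> charts_at A x" "t \<in> tangent_space A x"
  shows "tangent_lift A c x (t c) = t"
proof
  fix c'
  have "c' \<in> charts_at A x \<Longrightarrow> t c' = transition_deriv c c' x (t c)" "c' \<notin> charts_at A x \<Longrightarrow> t c' = 0"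
    using assms unfolding tangent_space_def by blast+
  then show "tangent_lift A c x (t c) c' = t c'"
    by (metis tangent_lift_def)
qed

lemma tangent_lift_scaleR:
  assumes "c \<in> charts_at A x"
  shows "tangent_lift A c x (r *\<^sub>R v) = (\<lambda>c'. r *\<^sub>R tangent_lift A c x v c')"
proof
  show "tangent_lift A c x (r *\<^sub>R v) c' = r *\<^sub>R tangent_lift A c x v c'" for c'
    using linear_cmul[OF has_derivative_linear[OF transition_deriv[OF assms]], of c']
    by (simp add: tangent_lift_def)
qed

lemma tangent_lift_add:
  assumes "c \<in> charts_at A x"
  shows "tangent_lift A c x (v + w) = (\<lambda>c'. tangent_lift A c x v c' + tangent_lift A c x w c')"
proof
  show "tangent_lift A c x (v + w) c' = tangent_lift A c x v c' + tangent_lift A c x w c'" for c'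
    using linear_add[OF has_derivative_linear[OF transition_deriv[OF assms]], of c']
    by (simp add: tangent_lift_def)
qed

section \<open>Tangent norms transported to the model space by a chart\<close>

definition chart_norm :: "('m, 'x) chart \<Rightarrow> 'm \<Rightarrow> 'x \<Rightarrow> real" where
  "chart_norm c x v = F (x, tangent_lift A c x v)"

lemma tangent_norm: "is_norm_on_tangent_space A x (\<lambda>t. F (x, t))"
  using finsler by (simp add: C1_finsler_manifold_def finsler_P1_def)

lemma F_zero [simp]: "F (x, \<lambda>c. 0) = 0"
proof -
  have "(\<lambda>c. 0) \<in> tangent_space A x"
    using linear_0[OF has_derivative_linear[OF transition_deriv]] by (auto simp: tangent_space_def)
  then show ?thesis using tangent_norm[of x] by (auto simp: is_norm_on_tangent_space_def)
qed

lemma chart_norm_nonneg: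
  assumes "c \<in> charts_at A x"
  shows "0 \<le> chart_norm c x v"
  using tangent_norm[of x] tangent_lift_in[OF assms]
  by (simp add: chart_norm_def is_norm_on_tangent_space_def)

lemma chart_norm_scaleR:
  assumes "c \<in> charts_at A x"
  shows "chart_norm c x (r *\<^sub>R v) = \<bar>r\<bar> * chart_norm c x v"
  using tangent_norm[of x] tangent_lift_in[OF assms]
  by (simp add: chart_norm_def is_norm_on_tangent_space_def tangent_lift_scaleR[OF assms])

lemma chart_norm_minus:
  assumes "c \<in> charts_at A x"
  shows "chart_norm c x (v - w) = chart_norm c x (w - v)"
  using chart_norm_scaleR[OF assms, of "-1" "w - v"] by simp

lemma chart_norm_triangle:
  assumes "c \<in> charts_at A x"
  shows "chart_norm c x (v + w) \<le> chart_norm c x v + chart_norm c x w"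
  using tangent_norm[of x] tangent_lift_in[OF assms]
  by (simp add: chart_norm_def is_norm_on_tangent_space_def tangent_lift_add[OF assms])

lemma chart_norm_equiv:
  assumes "c \<in> charts_at A x"
  obtains k C where "k > 0" "C > 0" "\<And>v. k * norm v \<le> chart_norm c x v" "\<And>v. chart_norm c x v \<le> C * norm v"
proof -
  have "finsler_P1 A F" using finsler by (simp add: C1_finsler_manifold_def)
  then have "\<exists>k>0. \<exists>C>0. \<forall>v. k * norm v \<le> chart_norm c x v \<and> chart_norm c x v \<le> C * norm v"
    using assms unfolding finsler_P1_def chart_norm_def by simp
  then show ?thesis using that by (elim exE conjE) simp
qed

text \<open>(P2) freed of its quotient. Uniformity in \<open>v\<close> matters in
  \<open>speed_continuous\<close>, where base point and vector move together.\<close>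

lemma chart_norm_locally_constant:
  assumes "c \<in> charts_at A x" "\<epsilon> > 0"
  shows "\<forall>\<^sub>F y in nhds x. y \<in> fst c \<and> (\<forall>v. chart_norm c x v \<le> (1 + \<epsilon>) * chart_norm c y v \<and>
     chart_norm c y v \<le> (1 + \<epsilon>) * chart_norm c x v)"
proof -
  obtain W where W: "open W" "x \<in> W" "W \<subseteq> fst c"
    "\<And>y v. y \<in> W \<Longrightarrow> 1 / (1 + \<epsilon>) * chart_norm c x v \<le> chart_norm c y v \<and>
      chart_norm c y v \<le> (1 + \<epsilon>) * chart_norm c x v"
  proof -
    have "finsler_P2 A F" using finsler by (simp add: C1_finsler_manifold_def)
    then have "\<exists>W. open W \<and> x \<in> W \<and> W \<subseteq> fst c \<and> (\<forall>y\<in>W. \<forall>v.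
        1 / (1 + \<epsilon>) * chart_norm c x v \<le> chart_norm c y v \<and>
        chart_norm c y v \<le> (1 + \<epsilon>) * chart_norm c x v)"
      using assms unfolding finsler_P2_def chart_norm_def by simp
    then show ?thesis using that by (elim exE conjE) simp
  qed
  have "chart_norm c x v \<le> (1 + \<epsilon>) * chart_norm c y v" if "y \<in> W" for y v
    using W(4)[OF that, of v] \<open>\<epsilon> > 0\<close> by (simp add: field_simps)
  then show ?thesis
    unfolding eventually_nhds using W by (intro exI[of _ W]) auto
qed


text \<open>In infinite dimensions a closed coordinate ball may fail to be closed in the manifold; by
  regularity, small ones are closed.\<close>

lemma small_chart_balls_closed:
  assumes c: "c \<in> charts_at A x"
  obtains R where "R > 0" "\<And>r. r \<le> R \<Longrightarrow> cball (snd c x) r \<subseteq> snd c ` fst c"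
    "\<And>r. r \<le> R \<Longrightarrow> closed (chart_inv c ` cball (snd c x) r)"
proof -
  have cA: "c \<in> charts A" and xc: "x \<in> fst c" using c by (auto simp: charts_at_def)
  have para: "paracompact_space TYPE('m)"
    using finsler by (simp add: C1_finsler_manifold_def C1_banach_manifold_def)
  obtain V where V: "open V" "x \<in> V" "closure V \<subseteq> fst c"
    using paracompact_regular[OF para chart_open(1)[OF cA] xc] .
  have "open (snd c ` (fst c \<inter> V))" "snd c x \<in> snd c ` (fst c \<inter> V)"
    using chart_image_open[OF cA V(1)] xc V(2) by auto
  then obtain R where R: "R > 0" "cball (snd c x) R \<subseteq> snd c ` (fst c \<inter> V)"
    unfolding open_contains_cball by blast
  show ?thesis
  proof (rule that[OF R(1)])
    fix r assume r: "r \<le> R"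
    have sub: "cball (snd c x) r \<subseteq> snd c ` (fst c \<inter> V)"
      using R(2) subset_cball[OF r] by blast
    then show "cball (snd c x) r \<subseteq> snd c ` fst c" by blast
    have Q: "chart_inv c ` cball (snd c x) r = fst c \<inter> snd c -` cball (snd c x) r"
    proof (intro equalityI subsetI)
      show "y \<in> fst c \<inter> snd c -` cball (snd c x) r" if y: "y \<in> chart_inv c ` cball (snd c x) r" for y
        using y sub chart_inv_in[OF cA] by blast
      show "y \<in> chart_inv c ` cball (snd c x) r" if y: "y \<in> fst c \<inter> snd c -` cball (snd c x) r" for y
        using y cA by (intro image_eqI[of y _ "snd c y"]) auto
    qed
    have QV: "chart_inv c ` cball (snd c x) r \<subseteq> V"
      using sub cA by (auto dest!: subsetD[OF sub])
    have "closedin (top_of_set (fst c)) (chart_inv c ` cball (snd c x) r)"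
      unfolding Q using chart_continuous(1)[OF cA] by (intro continuous_closedin_preimage) auto
    then obtain T where T: "closed T" "chart_inv c ` cball (snd c x) r = fst c \<inter> T"
      by (auto simp: closedin_closed)
    \<comment> \<open>Relative closedness in the chart domain is upgraded: the closure of the ball
      stays in \<open>closure V\<close>, hence in \<open>fst c\<close>, where relative closedness
      applies.\<close>
    have "closure (chart_inv c ` cball (snd c x) r) \<subseteq> fst c"
      using closure_mono[OF QV] V(3) by blast
    moreover have "closure (chart_inv c ` cball (snd c x) r) \<subseteq> T"
      using T by (intro closure_minimal) auto
    ultimately have "closure (chart_inv c ` cball (snd c x) r) \<subseteq> chart_inv c ` cball (snd c x) r"
      using T(2) by blast
    then show "closed (chart_inv c ` cball (snd c x) r)"
      by (metis closure_subset_eq)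
  qed
qed

section \<open>Subdifferentials read in a chart and the local Lipschitz estimate\<close>

lemma C1_on_manifold_extend:
  assumes c: "c \<in> charts A" and g: "C1_on UNIV g"
    and out: "\<And>u. u \<notin> S \<Longrightarrow> g u = 0" and S: "S \<subseteq> snd c ` fst c" and closed: "closed (chart_inv c ` S)"
  shows "C1_on_manifold A (\<lambda>y. if y \<in> fst c then g (snd c y) else 0)" (is "C1_on_manifold A ?G")
  unfolding C1_on_manifold_def
proof (intro ballI C1_on_local)
  fix c' u assume c': "c' \<in> charts A" and "u \<in> snd c' ` fst c'"
  then obtain y where y: "y \<in> fst c'" "u = snd c' y" by auto
  show "\<exists>T. open T \<and> u \<in> T \<and> C1_on T (?G \<circ> chart_inv c')"
  proof (cases "y \<in> fst c")
    case True
    define T where "T = snd c' ` (fst c' \<inter> fst c)"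
    have oT: "open T"
      unfolding T_def by (intro chart_image_open[OF c'] chart_open(1)[OF c])
    have "C1_on T (g \<circ> (snd c \<circ> chart_inv c'))"
      unfolding T_def by (rule C1_on_compose[OF transition_C1[OF c' c] g]) simp
    then have "C1_on T (?G \<circ> chart_inv c')"
      using oT by (rule C1_on_cong) (use c' in \<open>auto simp: T_def\<close>)
    then show ?thesis using oT True y by (intro exI[of _ T]) (auto simp: T_def)
  next
    case False
    \<comment> \<open>Near a point outside \<open>fst c\<close> the function vanishes because the
      closed image of \<open>S\<close> leaves a neighbourhood free. A relatively closed support
      could accumulate at such a point.\<close>
    define T where "T = snd c' ` (fst c' \<inter> - (chart_inv c ` S))"
    have oT: "open T"
      unfolding T_def using closed by (intro chart_image_open[OF c']) auto
    have "y \<notin> chart_inv c ` S"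
      using False S chart_inv_in(1)[OF c] by blast
    then have "u \<in> T" using y by (auto simp: T_def)
    moreover have "C1_on T (\<lambda>u. 0 :: real)"
      unfolding C1_on_def by (intro exI[of _ "\<lambda>_. 0"]) (auto simp: zero_blinfun.rep_eq)
    then have "C1_on T (?G \<circ> chart_inv c')"
      using oT
    proof (rule C1_on_cong)
      fix w assume "w \<in> T"
      then obtain m where m: "m \<in> fst c'" "m \<notin> chart_inv c ` S" "w = snd c' m"
        by (auto simp: T_def)
      have "snd c m \<notin> S" if "m \<in> fst c"
        using m(2) c that by (metis chart_inv_chart image_eqI)
      then show "0 = (?G \<circ> chart_inv c') w"
        using m c' out by simp
    qed
    ultimately show ?thesis using oT by blast
  qed
qed

text \<open>\<open>differential\<close> is computed in an arbitrary chart \<open>c0\<close>; the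
  chain rule through the transition from \<open>c\<close> to \<open>c0\<close> turns it into the
  derivative in \<open>c\<close>. A representative \<open>g\<close> valid near
  \<open>snd c x\<close> suffices, which suits cut-off functions.\<close>

lemma differential_in_chart:
  assumes G: "C1_on_manifold A G" and c: "c \<in> charts_at A x"
    and g: "(g has_derivative D) (at (snd c x))"
    and eq: "\<forall>\<^sub>F u in nhds (snd c x). G (chart_inv c u) = g u"
  shows "differential A G x (tangent_lift A c x v) = D v"
proof -
  define c0 where "c0 = (SOME c. c \<in> charts_at A x)"
  have c0: "c0 \<in> charts_at A x"
    unfolding c0_def using c by (rule someI)
  define D0 where "D0 = frechet_derivative (G \<circ> chart_inv c0) (at (snd c0 x))"
  have "(G \<circ> chart_inv c0) differentiable (at (snd c0 x))"
    using G c0 by (intro C1_on_imp_differentiable[of "snd c0 ` fst c0"])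
      (auto simp: C1_on_manifold_def charts_at_def)
  then have "((G \<circ> chart_inv c0) has_derivative D0) (at (snd c0 x))"
    unfolding D0_def by (simp only: frechet_derivative_works)
  moreover have "(snd c0 \<circ> chart_inv c) (snd c x) = snd c0 x"
    using c by (auto simp: charts_at_def)
  ultimately have "((G \<circ> chart_inv c0) \<circ> (snd c0 \<circ> chart_inv c) has_derivative
      D0 \<circ> transition_deriv c c0 x) (at (snd c x))"
    using diff_chain_at[OF transition_deriv[OF c c0]] by simp
  moreover have "\<forall>\<^sub>F u in nhds (snd c x). ((G \<circ> chart_inv c0) \<circ> (snd c0 \<circ> chart_inv c)) u = g u"
    using eq chart_image_nhds[OF c chart_open(1)[OF charts_atD(1)[OF c0]] charts_atD(2)[OF c0]]
    by eventually_elim (use c0 in \<open>auto simp: charts_at_def\<close>)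
  ultimately have "(g has_derivative D0 \<circ> transition_deriv c c0 x) (at (snd c x))"
    by (rule has_derivative_cong_nhds)
  then have "D = D0 \<circ> transition_deriv c c0 x"
    using g has_derivative_unique by blast
  moreover have "differential A G x (tangent_lift A c x v) = D0 (tangent_lift A c x v c0)"
    using tangent_lift_in[OF c] by (simp add: differential_def D0_def c0_def Let_def)
  ultimately show ?thesis
    using c0 by (simp add: tangent_lift_def)
qed

text \<open>A function touching \<open>f\<close> from below in a chart is made global by multiplying it with a bump \<open>\<zeta>\<close>.
  If it is normalised to the value \<open>1\<close> at the contact point, then \<open>\<zeta> \<le> 1\<close> keeps it below \<open>f\<close>, and
  \<open>d\<zeta> = 0\<close> there keeps its differential.\<close>

lemma subdifferential_bound:
  fixes \<beta> :: "'x \<Rightarrow> real"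
  assumes bump: "unit_bump \<beta> \<beta>' L"
    and bound: "\<And>\<xi>. \<xi> \<in> subdifferential A \<Omega> f x \<Longrightarrow> dual_norm A F x \<xi> \<le> K"
    and c: "c \<in> charts_at A x"
    and g: "\<And>u. (g has_derivative blinfun_apply (g' u)) (at u)" and g': "continuous_on UNIV g'"
    and min: "\<forall>\<^sub>F y in nhds x. f x - g (snd c x) \<le> f y - g (snd c y)"
  shows "\<bar>g' (snd c x) v\<bar> \<le> K * chart_norm c x v"
proof -
  have cA: "c \<in> charts A" and xc: "x \<in> fst c" using c by (auto simp: charts_at_def)
  obtain r where r: "r > 0" "cball (snd c x) r \<subseteq> snd c ` fst c" "closed (chart_inv c ` cball (snd c x) r)"
    using small_chart_balls_closed[OF c] by (metis order_refl)
  define \<zeta> where "\<zeta> u = \<beta> ((1 / r) *\<^sub>R (u - snd c x))" for u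
  define \<zeta>' where "\<zeta>' u = (1 / r) *\<^sub>R \<beta>' ((1 / r) *\<^sub>R (u - snd c x))" for u
  have \<zeta>: "(\<zeta> has_derivative blinfun_apply (\<zeta>' u)) (at u)" for u
    unfolding \<zeta>_def[abs_def] \<zeta>'_def by (rule unit_bump_scaled_derivative[OF bump])
  have \<zeta>': "continuous_on UNIV \<zeta>'"
    unfolding \<zeta>'_def[abs_def] by (rule unit_bump_scaled_continuous[OF bump])
  have \<zeta>01: "0 \<le> \<zeta> u" "\<zeta> u \<le> 1" "\<zeta> (snd c x) = 1" for u
    using bump by (auto simp: \<zeta>_def unit_bump_def)
  have \<zeta>out: "\<zeta> u = 0" if "u \<notin> cball (snd c x) r" for u
  proof -
    have "1 \<le> norm ((1 / r) *\<^sub>R (u - snd c x))"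
      using that r(1) by (simp add: dist_norm norm_minus_commute pos_le_divide_eq)
    then show ?thesis using bump unfolding \<zeta>_def unit_bump_def by blast
  qed
  have \<zeta>'0: "blinfun_apply (\<zeta>' (snd c x)) = (\<lambda>v. 0)"
    using \<zeta>01 by (intro differential_zero_maxmin[OF UNIV_I open_UNIV \<zeta>]) simp
  define h where "h u = g u - g (snd c x) + 1" for u
  have h: "(h has_derivative blinfun_apply (g' u)) (at u)" for u
    unfolding h_def[abs_def] using g[of u] by (auto intro!: derivative_eq_intros)
  have "C1_on UNIV \<zeta>" "C1_on UNIV h"
    unfolding C1_on_def using \<zeta> \<zeta>' h g' by blast+
  then have C1: "C1_on UNIV (\<lambda>u. \<zeta> u * h u)" by (rule C1_on_mult)
  define G where "G = (\<lambda>y. if y \<in> fst c then \<zeta> (snd c y) * h (snd c y) else 0)"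
  have G: "C1_on_manifold A G"
    unfolding G_def using \<zeta>out by (intro C1_on_manifold_extend[OF cA C1 _ r(2,3)]) simp
  have Gmin: "\<forall>\<^sub>F y in nhds x. f x - G x \<le> f y - G y"
  proof -
    \<comment> \<open>Multiplication by \<open>\<zeta> \<le> 1\<close> lowers \<open>h\<close> only
      where \<open>h\<close> is nonnegative. Since \<open>h\<close> equals 1 at the contact point,
      this holds nearby.\<close>
    have "isCont h (snd c x)" using h by (rule has_derivative_continuous)
    then have "(h \<longlongrightarrow> h (snd c x)) (nhds (snd c x))"
      by (simp add: isCont_def tendsto_at_iff_tendsto_nhds)
    then have "\<forall>\<^sub>F u in nhds (snd c x). 0 < h u"
      by (rule order_tendstoD) (simp add: h_def)
    from chart_eventually[OF cA xc this] min show ?thesis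
    proof eventually_elim
      case (elim y)
      have "G y \<le> 1 * h (snd c y)"
        unfolding G_def using elim \<zeta>01 by (auto intro: mult_right_mono)
      moreover have "G x = 1" using xc \<zeta>01 by (simp add: G_def h_def)
      ultimately show ?case using elim by (simp add: h_def)
    qed
  qed
  define \<xi> where "\<xi> = differential A G x"
  have "\<xi> \<in> subdifferential A \<Omega> f x"
    unfolding subdifferential_def \<xi>_def using G filter_leD[OF at_within_le_nhds Gmin] by blast
  then have K: "dual_norm A F x \<xi> \<le> K" by (rule bound)
  have der: "((\<lambda>u. \<zeta> u * h u) has_derivative blinfun_apply (g' (snd c x))) (at (snd c x))"
    using has_derivative_mult[OF \<zeta>[of "snd c x"] h[of "snd c x"]] \<zeta>01 \<zeta>'0 by (simp add: h_def)
  have \<xi>: "\<xi> (tangent_lift A c x w) = g' (snd c x) w" for w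
    unfolding \<xi>_def
  proof (rule differential_in_chart[OF G c der])
    show "\<forall>\<^sub>F u in nhds (snd c x). G (chart_inv c u) = \<zeta> u * h u"
      using chart_image_nhds[OF c chart_open(1)[OF cA] xc]
      by eventually_elim (use cA in \<open>auto simp: G_def\<close>)
  qed
  obtain k C where k: "k > 0" "\<And>v. k * norm v \<le> chart_norm c x v"
    using chart_norm_equiv[OF c] by metis
  show ?thesis
  proof (cases "v = 0")
    case True
    then show ?thesis using chart_norm_scaleR[OF c, of 0 0] by (simp add: blinfun.zero_right)
  next
    case False
    define n where "n = chart_norm c x v"
    have n: "n > 0" unfolding n_def
      using k(1) False by (intro less_le_trans[OF _ k(2)[of v]]) simp
    let ?S = "{\<bar>\<xi> t\<bar> | t. t \<in> tangent_space A x \<and> F (x, t) = 1}"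
    \<comment> \<open>\<open>Sup\<close> on the reals says something only about sets bounded above.
      A tangent vector of norm 1 has a coordinate vector of norm at most \<open>1 / k\<close>, on
      which the derivative is bounded.\<close>
    have bdd: "bdd_above ?S"
    proof (rule bdd_aboveI)
      fix s assume "s \<in> ?S"
      then obtain t where t: "t \<in> tangent_space A x" "F (x, t) = 1" "s = \<bar>\<xi> t\<bar>" by auto
      have lift: "tangent_lift A c x (t c) = t" using c t(1) by (rule tangent_lift_of_tangent)
      have "k * norm (t c) \<le> 1"
        using k(2)[of "t c"] t(2) lift by (simp add: chart_norm_def)
      then have "norm (t c) \<le> 1 / k" using k(1) by (simp add: field_simps)
      moreover have "s \<le> norm (g' (snd c x)) * norm (t c)"
        using norm_blinfun[of "g' (snd c x)" "t c"] \<xi>[of "t c"] lift t(3) by simp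
      ultimately show "s \<le> norm (g' (snd c x)) * (1 / k)"
        using mult_left_mono[of "norm (t c)" "1 / k" "norm (g' (snd c x))"] by simp
    qed
    have "F (x, tangent_lift A c x ((1 / n) *\<^sub>R v)) = 1"
      using chart_norm_scaleR[OF c, of "1 / n" v] n by (simp add: chart_norm_def[symmetric] n_def[symmetric])
    then have "\<bar>\<xi> (tangent_lift A c x ((1 / n) *\<^sub>R v))\<bar> \<in> ?S"
      using tangent_lift_in[OF c] by blast
    then have "\<bar>\<xi> (tangent_lift A c x ((1 / n) *\<^sub>R v))\<bar> \<le> dual_norm A F x \<xi>"
      unfolding dual_norm_def using bdd by (rule cSup_upper)
    then have "\<bar>g' (snd c x) v\<bar> / n \<le> K"
      using K n by (simp add: \<xi> blinfun.scaleR_right abs_mult)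
    then show ?thesis using n by (simp add: n_def[symmetric] pos_divide_le_eq)
  qed
qed

text \<open>The contact point supplied by the mean value theorem is known only to lie in the
  coordinate ball. The ball is therefore taken inside a set \<open>V\<close> where (P2) compares
  every tangent norm with the one at \<open>x\<close>. Exchanging the two points gives the absolute
  value.\<close>

lemma local_lipschitz_estimate:
  fixes \<beta> :: "'x \<Rightarrow> real"
  assumes bump: "unit_bump \<beta> \<beta>' L"
    and \<Omega>: "open \<Omega>" "x \<in> \<Omega>" and lsc: "lsc_on \<Omega> f"
    and bound: "\<And>y \<xi>. y \<in> \<Omega> \<Longrightarrow> \<xi> \<in> subdifferential A \<Omega> f y \<Longrightarrow> dual_norm A F y \<xi> \<le> K"
    and c: "c \<in> charts_at A x" and "\<epsilon> > 0"
  shows "\<forall>\<^sub>F y in nhds x. y \<in> fst c \<and> \<bar>f y - f x\<bar> \<le> K * (1 + \<epsilon>) * chart_norm c x (snd c y - snd c x)"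
proof -
  have cA: "c \<in> charts A" and xc: "x \<in> fst c" using c by (auto simp: charts_at_def)
  \<comment> \<open>Semicontinuity at \<open>x\<close> provides the lower bound on \<open>f\<close>
    that the variational principle starts from.\<close>
  have "\<forall>\<^sub>F y in at x within \<Omega>. f x - 1 < f y"
    using lsc \<Omega>(2) by (simp add: lsc_on_def)
  then have "\<forall>\<^sub>F y in nhds x. y \<in> \<Omega> \<longrightarrow> f x - 1 < f y"
    unfolding eventually_at_filter by eventually_elim auto
  moreover have "\<forall>\<^sub>F y in nhds x. y \<in> \<Omega>" using \<Omega> by (rule eventually_nhds_in_open)
  ultimately have "\<forall>\<^sub>F y in nhds x. y \<in> \<Omega> \<and> f x - 1 \<le> f y \<and> (\<forall>v. chart_norm c y v \<le> (1 + \<epsilon>) * chart_norm c x v)"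
    using chart_norm_locally_constant[OF c \<open>\<epsilon> > 0\<close>] by eventually_elim auto
  then obtain V where V: "open V" "x \<in> V" and VP: "\<And>y. y \<in> V \<Longrightarrow> y \<in> \<Omega>" "\<And>y. y \<in> V \<Longrightarrow> f x - 1 \<le> f y"
      "\<And>y v. y \<in> V \<Longrightarrow> chart_norm c y v \<le> (1 + \<epsilon>) * chart_norm c x v"
    unfolding eventually_nhds by blast
  obtain r where r: "r > 0" "cball (snd c x) r \<subseteq> snd c ` (fst c \<inter> V)"
    using chart_image_open[OF cA V(1)] xc V(2) unfolding open_contains_cball by blast
  have \<psi>V: "chart_inv c u \<in> V" "chart_inv c u \<in> fst c" "snd c (chart_inv c u) = u"
    if "u \<in> cball (snd c x) r" for u
    using that r(2) cA by auto
  have lsc': "lsc_on (cball (snd c x) r) (\<lambda>u. f (chart_inv c u))"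
    using lsc
  proof (rule lsc_on_compose)
    show "continuous_on (cball (snd c x) r) (chart_inv c)"
      using chart_continuous(2)[OF cA] by (rule continuous_on_subset) (use r in blast)
    show "chart_inv c ` cball (snd c x) r \<subseteq> \<Omega>"
      using \<psi>V VP by blast
  qed
  have key: "f (chart_inv c q) - f (chart_inv c p) \<le> K * (1 + \<epsilon>) * chart_norm c x (q - p)"
    if p: "p \<in> ball (snd c x) (r / 2)" and q: "q \<in> ball (snd c x) (r / 2)" for p q
  proof (cases "q = p")
    case True
    then show ?thesis using chart_norm_scaleR[OF c, of 0 0] by simp
  next
    case False
    show ?thesis
    proof (rule dense_le)
      fix a assume a: "a < f (chart_inv c q) - f (chart_inv c p)"
      have lower: "f x - 1 \<le> f (chart_inv c u)" if "u \<in> cball (snd c x) r" for u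
        using \<psi>V[OF that] VP by blast
      obtain w g g' where w: "w \<in> ball (snd c x) r"
        and g: "\<And>u. (g has_derivative blinfun_apply (g' u)) (at u)" "continuous_on UNIV g'"
        and min: "\<And>u. u \<in> cball (snd c x) r \<Longrightarrow> f (chart_inv c w) - g w \<le> f (chart_inv c u) - g u"
        and aw: "a < g' w (q - p)"
        using approximate_mean_value[OF bump r(1) lsc' lower p q a] by blast
      define y where "y = chart_inv c w"
      have y: "y \<in> V" "y \<in> fst c" "snd c y = w"
        using \<psi>V[of w] w by (auto simp: y_def)
      have cy: "c \<in> charts_at A y" using cA y by (simp add: charts_at_def)
      have "\<forall>\<^sub>F u in nhds (snd c y). u \<in> ball (snd c x) r"
        using w y(3) by (intro eventually_nhds_in_open) auto
      from chart_eventually[OF cA y(2) this]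
      have ymin: "\<forall>\<^sub>F y' in nhds y. f y - g (snd c y) \<le> f y' - g (snd c y')"
      proof eventually_elim
        case (elim y')
        then show ?case using min[of "snd c y'"] cA y by (simp add: y_def)
      qed
      have le: "\<bar>g' w (q - p)\<bar> \<le> K * chart_norm c y (q - p)"
        using subdifferential_bound[OF bump bound[OF VP(1)[OF y(1)]] cy g ymin] y(3) by simp
      obtain k C where k: "k > 0" "\<And>v. k * norm v \<le> chart_norm c y v"
        using chart_norm_equiv[OF cy] by metis
      have "0 < chart_norm c y (q - p)"
        using k(1) False by (intro less_le_trans[OF _ k(2)]) simp
      moreover have "0 \<le> K * chart_norm c y (q - p)" using le by linarith
      \<comment> \<open>The sign of \<open>K\<close> is deduced: a function touching
        \<open>f\<close> exists and \<open>q - p\<close> has positive norm. Leaving the sign open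
        allows a negative \<open>K\<close> to be refuted later for nontrivial
        \<open>X\<close>.\<close>
      ultimately have "K \<ge> 0" by (simp add: zero_le_mult_iff)
      then have "K * chart_norm c y (q - p) \<le> K * ((1 + \<epsilon>) * chart_norm c x (q - p))"
        using VP(3)[OF y(1)] by (rule mult_left_mono[rotated])
      then show "a \<le> K * (1 + \<epsilon>) * chart_norm c x (q - p)"
        using aw le by (simp add: mult.assoc)
    qed
  qed
  have "\<forall>\<^sub>F u in nhds (snd c x). u \<in> ball (snd c x) (r / 2)"
    using r(1) by (intro eventually_nhds_in_open) auto
  from chart_eventually[OF cA xc this] show ?thesis
  proof eventually_elim
    case (elim y)
    have x: "snd c x \<in> ball (snd c x) (r / 2)" using r(1) by simp
    show ?case
      using key[OF x, of "snd c y"] key[OF _ x, of "snd c y"] elim cA xc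
        chart_norm_minus[OF c, of "snd c x" "snd c y"]
      by (auto simp: abs_le_iff)
  qed
qed


section \<open>Lengths of paths\<close>

definition speed :: "(real \<Rightarrow> 'm) \<Rightarrow> real \<Rightarrow> real \<Rightarrow> real \<Rightarrow> real" where
  "speed \<gamma> a b t = F (\<gamma> t, velocity A \<gamma> a b t)"

lemma finsler_length_eq: "finsler_length A F \<gamma> a b = integral {a..b} (speed \<gamma> a b)"
  by (simp add: finsler_length_def speed_def[abs_def])

lemma C1_path_continuous: "C1_path_on A \<gamma> a b \<Longrightarrow> continuous_on {a..b} \<gamma>"
  by (simp add: C1_path_on_def)

lemma C1_path_eventually_in_chart:
  assumes "continuous_on {a..b} \<gamma>" "t \<in> {a..b}" "\<forall>\<^sub>F y in nhds (\<gamma> t). P y"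
  shows "\<forall>\<^sub>F s in at t within {a..b}. s \<in> {a..b} \<and> P (\<gamma> s)"
proof -
  have "filterlim \<gamma> (nhds (\<gamma> t)) (at t within {a..b})"
    using assms(1,2) by (simp add: continuous_on_def)
  then have "\<forall>\<^sub>F s in at t within {a..b}. P (\<gamma> s)"
    using assms(3) by (rule eventually_compose_filterlim[rotated])
  moreover have "\<forall>\<^sub>F s in at t within {a..b}. s \<in> {a..b}"
    by (simp add: eventually_at_filter)
  ultimately show ?thesis by eventually_elim simp
qed

text \<open>A velocity is a family over all charts, but the chain rule for transition maps recovers
  it from one coordinate derivative. \<open>a < b\<close> makes derivatives within
  \<open>{a..b}\<close> unique, also at the end points.\<close>

lemma velocity_in_chart:
  assumes path: "C1_path_on A \<gamma> a b" and "a < b" and t: "t \<in> {a..b}"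
    and c: "c \<in> charts_at A (\<gamma> t)"
    and v: "((snd c \<circ> \<gamma>) has_vector_derivative v) (at t within {a..b})"
  shows "velocity A \<gamma> a b t = tangent_lift A c (\<gamma> t) v"
proof
  fix c'
  show "velocity A \<gamma> a b t c' = tangent_lift A c (\<gamma> t) v c'"
  proof (cases "c' \<in> charts_at A (\<gamma> t)")
    case False then show ?thesis by (simp add: velocity_def tangent_lift_def)
  next
    case c': True
    let ?T = "transition_deriv c c' (\<gamma> t)"
    have T: "((snd c' \<circ> chart_inv c) has_derivative ?T) (at ((snd c \<circ> \<gamma>) t))"
      using transition_deriv[OF c c'] by simp
    have "((snd c' \<circ> chart_inv c) \<circ> (snd c \<circ> \<gamma>) has_derivative ?T \<circ> (\<lambda>s. s *\<^sub>R v)) (at t within {a..b})"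
    proof (rule diff_chain_within)
      show "((snd c \<circ> \<gamma>) has_derivative (\<lambda>s. s *\<^sub>R v)) (at t within {a..b})"
        using v by (simp add: has_vector_derivative_def)
      show "((snd c' \<circ> chart_inv c) has_derivative ?T) (at ((snd c \<circ> \<gamma>) t) within (snd c \<circ> \<gamma>) ` {a..b})"
        using T by (rule has_derivative_at_withinI)
    qed
    moreover have "?T \<circ> (\<lambda>s. s *\<^sub>R v) = (\<lambda>s. s *\<^sub>R ?T v)"
      using linear_cmul[OF has_derivative_linear[OF T]] by (simp add: fun_eq_iff)
    ultimately have "((snd c' \<circ> chart_inv c) \<circ> (snd c \<circ> \<gamma>) has_vector_derivative ?T v) (at t within {a..b})"
      by (simp add: has_vector_derivative_def)
    moreover have "\<forall>\<^sub>F s in at t within {a..b}. ((snd c' \<circ> chart_inv c) \<circ> (snd c \<circ> \<gamma>)) s = (snd c' \<circ> \<gamma>) s"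
      using C1_path_eventually_in_chart[OF C1_path_continuous[OF path] t
          eventually_nhds_in_open[OF chart_open(1)[OF charts_atD(1)[OF c]] charts_atD(2)[OF c]]]
      by eventually_elim (use c in \<open>auto simp: charts_at_def\<close>)
    moreover have "((snd c' \<circ> chart_inv c) \<circ> (snd c \<circ> \<gamma>)) t = (snd c' \<circ> \<gamma>) t"
      using c by (auto simp: charts_at_def)
    ultimately have "((snd c' \<circ> \<gamma>) has_vector_derivative ?T v) (at t within {a..b})"
      unfolding has_vector_derivative_def using t
      by (rule has_derivative_transform_eventually)
    then have "vector_derivative (snd c' \<circ> \<gamma>) (at t within {a..b}) = ?T v"
      using vector_derivative_within_cbox[of a b t "snd c' \<circ> \<gamma>" "?T v"] \<open>a < b\<close> t by simp
    then show ?thesis using c' by (simp add: velocity_def tangent_lift_def)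
  qed
qed

lemma C1_path_derivative:
  assumes path: "C1_path_on A \<gamma> a b" and "a < b" and c: "c \<in> charts A"
  obtains D where
    "\<And>t. t \<in> {a..b} \<Longrightarrow> \<gamma> t \<in> fst c \<Longrightarrow> ((snd c \<circ> \<gamma>) has_vector_derivative D t) (at t within {a..b})"
    "continuous_on ({a..b} \<inter> \<gamma> -` fst c) D"
    "\<And>t. t \<in> {a..b} \<Longrightarrow> \<gamma> t \<in> fst c \<Longrightarrow> velocity A \<gamma> a b t = tangent_lift A c (\<gamma> t) (D t)"
    "\<And>t. t \<in> {a..b} \<Longrightarrow> \<gamma> t \<in> fst c \<Longrightarrow> speed \<gamma> a b t = chart_norm c (\<gamma> t) (D t)"
proof -
  have "\<exists>D. (\<forall>t\<in>{a..b} \<inter> \<gamma> -` fst c. ((snd c \<circ> \<gamma>) has_vector_derivative D t) (at t within {a..b})) \<and>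
        continuous_on ({a..b} \<inter> \<gamma> -` fst c) D"
    using path c by (simp add: C1_path_on_def)
  then obtain D where
    D0: "\<forall>t\<in>{a..b} \<inter> \<gamma> -` fst c. ((snd c \<circ> \<gamma>) has_vector_derivative D t) (at t within {a..b})"
    and cont: "continuous_on ({a..b} \<inter> \<gamma> -` fst c) D"
    by (elim exE conjE)
  have D: "((snd c \<circ> \<gamma>) has_vector_derivative D t) (at t within {a..b})" if "t \<in> {a..b}" "\<gamma> t \<in> fst c" for t
    using D0 that by simp
  have vel: "velocity A \<gamma> a b t = tangent_lift A c (\<gamma> t) (D t)" if "t \<in> {a..b}" "\<gamma> t \<in> fst c" for t
    using velocity_in_chart[OF path \<open>a < b\<close> that(1) _ D[OF that]] that c by (simp add: charts_at_def)
  show ?thesis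
    using that[OF D cont vel] vel by (simp add: speed_def chart_norm_def)
qed

lemma speed_nonneg:
  assumes "C1_path_on A \<gamma> a b" "a < b" "t \<in> {a..b}"
  shows "0 \<le> speed \<gamma> a b t"
proof -
  obtain c where c: "c \<in> charts_at A (\<gamma> t)" by (rule charts_at_exists)
  obtain D where "\<And>t. t \<in> {a..b} \<Longrightarrow> \<gamma> t \<in> fst c \<Longrightarrow> speed \<gamma> a b t = chart_norm c (\<gamma> t) (D t)"
    using C1_path_derivative[OF assms(1,2) charts_atD(1)[OF c]] by metis
  then show ?thesis using assms(3) c charts_atD(2)[OF c] by (simp add: chart_norm_nonneg)
qed

lemma chart_norm_tendsto:
  assumes c: "c \<in> charts_at A x" and D: "(D \<longlongrightarrow> v) G"
  shows "((\<lambda>s. chart_norm c x (D s)) \<longlongrightarrow> chart_norm c x v) G"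
proof -
  obtain k C where C: "C > 0" "\<And>v. chart_norm c x v \<le> C * norm v"
    using chart_norm_equiv[OF c] by metis
  have "\<bar>chart_norm c x w - chart_norm c x v\<bar> \<le> C * norm (w - v)" for w
    using chart_norm_triangle[OF c, of "w - v" v] chart_norm_triangle[OF c, of "v - w" w]
      chart_norm_minus[OF c, of v w] C(2)[of "w - v"] by simp
  then have "\<forall>\<^sub>F s in G. norm (chart_norm c x (D s) - chart_norm c x v) \<le> C * norm (D s - v)"
    by simp
  moreover have "((\<lambda>s. C * norm (D s - v)) \<longlongrightarrow> 0) G"
    by (intro tendsto_mult_right_zero tendsto_norm_zero LIM_zero D)
  ultimately have "((\<lambda>s. chart_norm c x (D s) - chart_norm c x v) \<longlongrightarrow> 0) G"
    by (rule Lim_null_comparison)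
  then show ?thesis by (simp add: LIM_zero_iff)
qed

text \<open>The base point is frozen: \<open>chart_norm c (\<gamma> t) (D s)\<close> is one fixed
  norm of a continuous function of \<open>s\<close>, and (P2) bounds its relative difference to the
  speed at \<open>s\<close>.\<close>

lemma speed_continuous:
  assumes path: "C1_path_on A \<gamma> a b" and "a < b"
  shows "continuous_on {a..b} (speed \<gamma> a b)"
  unfolding continuous_on_def
proof
  fix t assume t: "t \<in> {a..b}"
  obtain c where c: "c \<in> charts_at A (\<gamma> t)" by (rule charts_at_exists)
  have cA: "c \<in> charts A" and tc: "\<gamma> t \<in> fst c" using charts_atD[OF c] .
  obtain D where D: "continuous_on ({a..b} \<inter> \<gamma> -` fst c) D"
    and sp: "\<And>t. t \<in> {a..b} \<Longrightarrow> \<gamma> t \<in> fst c \<Longrightarrow> speed \<gamma> a b t = chart_norm c (\<gamma> t) (D t)"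
    using C1_path_derivative[OF path \<open>a < b\<close> cA] by metis
  let ?G = "at t within {a..b}"
  let ?N = "\<lambda>s. chart_norm c (\<gamma> t) (D s)"
  have ev: "\<forall>\<^sub>F s in ?G. s \<in> {a..b} \<and> \<gamma> s \<in> fst c"
    by (intro C1_path_eventually_in_chart[OF C1_path_continuous[OF path] t]
        eventually_nhds_in_open[OF chart_open(1)[OF cA] tc])
  have "(D \<longlongrightarrow> D t) (at t within ({a..b} \<inter> \<gamma> -` fst c))"
    using D t tc by (simp add: continuous_on_def)
  moreover have "at t within ({a..b} \<inter> \<gamma> -` fst c) = ?G"
  proof -
    have "?G \<le> at t within ({a..b} \<inter> \<gamma> -` fst c)"
    proof (rule filter_leI)
      fix P assume "eventually P (at t within ({a..b} \<inter> \<gamma> -` fst c))"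
      then have "\<forall>\<^sub>F s in ?G. s \<in> {a..b} \<inter> \<gamma> -` fst c \<longrightarrow> P s"
        unfolding eventually_at_filter by eventually_elim auto
      with ev show "eventually P ?G" by eventually_elim auto
    qed
    then show ?thesis by (rule antisym[rotated]) (rule at_le, auto)
  qed
  ultimately have N: "(?N \<longlongrightarrow> ?N t) ?G"
    by (intro chart_norm_tendsto[OF c]) simp
  have "((\<lambda>s. speed \<gamma> a b s - ?N s) \<longlongrightarrow> 0) ?G"
  proof (rule tendstoI)
    fix \<eta> :: real assume "\<eta> > 0"
    define n where "n = ?N t + 1"
    have n: "n > 0" using chart_norm_nonneg[OF c, of "D t"] by (simp add: n_def)
    \<comment> \<open>\<open>\<epsilon> \<le> 1\<close> gives \<open>S \<le> 2 * ?N s\<close>, so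
      both errors are at most \<open>2 * n * \<epsilon>\<close>, which is at most
      \<open>\<eta> / 2\<close>.\<close>
    define \<epsilon> where "\<epsilon> = min 1 (\<eta> / (4 * n))"
    have \<epsilon>: "0 < \<epsilon>" "\<epsilon> \<le> 1" "4 * n * \<epsilon> \<le> \<eta>"
      using \<open>\<eta> > 0\<close> n by (auto simp: \<epsilon>_def min_def field_simps)
    have "\<forall>\<^sub>F s in ?G. ?N s < n"
      using N by (rule order_tendstoD) (simp add: n_def)
    with ev C1_path_eventually_in_chart[OF C1_path_continuous[OF path] t
        chart_norm_locally_constant[OF c \<epsilon>(1)]]
    show "\<forall>\<^sub>F s in ?G. dist (speed \<gamma> a b s - ?N s) 0 < \<eta>"
    proof eventually_elim
      case (elim s)
      define S where "S = speed \<gamma> a b s"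
      have S: "S = chart_norm c (\<gamma> s) (D s)" using sp elim by (simp add: S_def)
      have 1: "S \<le> ?N s + \<epsilon> * ?N s" "?N s \<le> S + \<epsilon> * S"
        using elim unfolding S by (simp_all add: algebra_simps)
      have 0: "0 \<le> ?N s" using c by (rule chart_norm_nonneg)
      have "S \<le> 2 * ?N s"
        using 1(1) mult_right_mono[OF \<epsilon>(2) 0] by linarith
      then have "S \<le> 2 * n" "?N s \<le> 2 * n"
        using elim n by linarith+
      then have "\<epsilon> * S \<le> 2 * n * \<epsilon>" "\<epsilon> * ?N s \<le> 2 * n * \<epsilon>"
        using \<epsilon>(1) by (simp_all add: mult.commute[of \<epsilon>] mult_right_mono)
      then have "\<bar>S - ?N s\<bar> \<le> 2 * n * \<epsilon>"
        using 1 by (intro abs_leI) linarith+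
      moreover have "2 * n * \<epsilon> < \<eta>" using \<epsilon>(3) mult_pos_pos[OF n \<epsilon>(1)] by linarith
      ultimately show ?case by (simp add: S_def)
    qed
  qed
  from tendsto_add[OF this N] have "(speed \<gamma> a b \<longlongrightarrow> ?N t) ?G" by simp
  then show "(speed \<gamma> a b \<longlongrightarrow> speed \<gamma> a b t) ?G"
    using sp[OF t tc] by simp
qed

lemma C1_length_nonneg:
  assumes "C1_path_on A \<gamma> a b" "a < b"
  shows "0 \<le> finsler_length A F \<gamma> a b"
  unfolding finsler_length_eq using assms
  by (intro integral_nonneg integrable_continuous_real speed_continuous) (auto simp: speed_nonneg)

text \<open>Restriction and translation are cases of \<open>\<sigma> = 1\<close>, reversal of
  \<open>\<sigma> = - 1\<close>. The velocity is multiplied by \<open>\<sigma>\<close>, so its norm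
  is unchanged.\<close>

lemma C1_path_reparam:
  fixes \<sigma> d :: real
  assumes path: "C1_path_on A \<gamma> a b" and "a < b" "a' < b'" and \<sigma>: "\<bar>\<sigma>\<bar> = 1"
    and sub: "\<And>t. t \<in> {a'..b'} \<Longrightarrow> \<sigma> * t + d \<in> {a..b}"
  shows "C1_path_on A (\<lambda>t. \<gamma> (\<sigma> * t + d)) a' b'"
    and "\<And>t. t \<in> {a'..b'} \<Longrightarrow> speed (\<lambda>t. \<gamma> (\<sigma> * t + d)) a' b' t = speed \<gamma> a b (\<sigma> * t + d)"
proof -
  let ?\<theta> = "\<lambda>t. \<sigma> * t + d"
  have der: "((snd c \<circ> (\<lambda>t. \<gamma> (?\<theta> t))) has_vector_derivative \<sigma> *\<^sub>R w) (at t within {a'..b'})"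
    if w: "((snd c \<circ> \<gamma>) has_vector_derivative w) (at (?\<theta> t) within {a..b})" for c :: "('m, 'x) chart" and t w
  proof -
    have "(?\<theta> has_derivative (\<lambda>h. \<sigma> * h)) (at t within {a'..b'})"
      by (auto intro!: derivative_eq_intros)
    moreover have "((snd c \<circ> \<gamma>) has_derivative (\<lambda>h. h *\<^sub>R w)) (at (?\<theta> t) within ?\<theta> ` {a'..b'})"
      using w unfolding has_vector_derivative_def by (rule has_derivative_subset) (use sub in auto)
    ultimately have "((snd c \<circ> \<gamma>) \<circ> ?\<theta> has_derivative (\<lambda>h. h *\<^sub>R w) \<circ> (\<lambda>h. \<sigma> * h)) (at t within {a'..b'})"
      by (rule diff_chain_within)
    then show ?thesis
      by (simp add: has_vector_derivative_def comp_def mult.commute)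
  qed
  show C1: "C1_path_on A (\<lambda>t. \<gamma> (?\<theta> t)) a' b'"
    unfolding C1_path_on_def
  proof (intro conjI ballI)
    show "continuous_on {a'..b'} (\<lambda>t. \<gamma> (?\<theta> t))"
      by (rule continuous_on_compose2[OF C1_path_continuous[OF path]]) (use sub in \<open>auto intro!: continuous_intros\<close>)
    fix c assume c: "c \<in> charts A"
    obtain D where
      D: "\<And>t. t \<in> {a..b} \<Longrightarrow> \<gamma> t \<in> fst c \<Longrightarrow> ((snd c \<circ> \<gamma>) has_vector_derivative D t) (at t within {a..b})"
      and cont: "continuous_on ({a..b} \<inter> \<gamma> -` fst c) D"
      using C1_path_derivative[OF path \<open>a < b\<close> c] by metis
    have "continuous_on ({a'..b'} \<inter> (\<lambda>t. \<gamma> (?\<theta> t)) -` fst c) (\<lambda>t. \<sigma> *\<^sub>R D (?\<theta> t))"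
      by (intro continuous_on_scaleR continuous_on_const continuous_on_compose2[OF cont] continuous_intros)
        (use sub in auto)
    then show "\<exists>D. (\<forall>t\<in>{a'..b'} \<inter> (\<lambda>t. \<gamma> (?\<theta> t)) -` fst c.
        ((snd c \<circ> (\<lambda>t. \<gamma> (?\<theta> t))) has_vector_derivative D t) (at t within {a'..b'})) \<and>
        continuous_on ({a'..b'} \<inter> (\<lambda>t. \<gamma> (?\<theta> t)) -` fst c) D"
      using der D sub by (intro exI[of _ "\<lambda>t. \<sigma> *\<^sub>R D (?\<theta> t)"]) auto
  qed
  fix t assume t: "t \<in> {a'..b'}"
  obtain c where c: "c \<in> charts_at A (\<gamma> (?\<theta> t))" by (rule charts_at_exists)
  obtain D where
    D: "\<And>t. t \<in> {a..b} \<Longrightarrow> \<gamma> t \<in> fst c \<Longrightarrow> ((snd c \<circ> \<gamma>) has_vector_derivative D t) (at t within {a..b})"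
    and sp: "\<And>t. t \<in> {a..b} \<Longrightarrow> \<gamma> t \<in> fst c \<Longrightarrow> speed \<gamma> a b t = chart_norm c (\<gamma> t) (D t)"
    using C1_path_derivative[OF path \<open>a < b\<close> charts_atD(1)[OF c]] by metis
  have "velocity A (\<lambda>t. \<gamma> (?\<theta> t)) a' b' t = tangent_lift A c (\<gamma> (?\<theta> t)) (\<sigma> *\<^sub>R D (?\<theta> t))"
    using velocity_in_chart[OF C1 \<open>a' < b'\<close> t c der[OF D[OF sub[OF t] charts_atD(2)[OF c]]]] .
  then have "speed (\<lambda>t. \<gamma> (?\<theta> t)) a' b' t = chart_norm c (\<gamma> (?\<theta> t)) (\<sigma> *\<^sub>R D (?\<theta> t))"
    by (simp add: speed_def chart_norm_def)
  then show "speed (\<lambda>t. \<gamma> (?\<theta> t)) a' b' t = speed \<gamma> a b (?\<theta> t)"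
    using sp[OF sub[OF t] charts_atD(2)[OF c]] chart_norm_scaleR[OF c] \<sigma> by simp
qed

text \<open>Velocities are derivatives within the parameter interval, so the speed on the smaller
  interval first has to be identified with the original one.\<close>

lemma C1_path_restrict:
  assumes "C1_path_on A \<gamma> a b" "a < b" "a' < b'" "{a'..b'} \<subseteq> {a..b}"
  shows "C1_path_on A \<gamma> a' b'"
    and "finsler_length A F \<gamma> a' b' = integral {a'..b'} (speed \<gamma> a b)"
    and "finsler_length A F \<gamma> a' b' \<le> finsler_length A F \<gamma> a b"
proof -
  have sub: "\<And>t. t \<in> {a'..b'} \<Longrightarrow> 1 * t + 0 \<in> {a..b}" using assms(4) by auto
  note r = C1_path_reparam[OF assms(1-3) abs_one sub]
  show "C1_path_on A \<gamma> a' b'" using r(1) by simp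
  show eq: "finsler_length A F \<gamma> a' b' = integral {a'..b'} (speed \<gamma> a b)"
    unfolding finsler_length_eq using r(2) by (intro integral_cong) simp
  have cont: "continuous_on {a..b} (speed \<gamma> a b)"
    using assms(1,2) by (rule speed_continuous)
  show "finsler_length A F \<gamma> a' b' \<le> finsler_length A F \<gamma> a b"
    unfolding eq unfolding finsler_length_eq
    using assms(4) cont speed_nonneg[OF assms(1,2)]
    by (intro integral_subset_le integrable_continuous_real) (auto intro: continuous_on_subset)
qed

lemma C1_path_shift:
  assumes "C1_path_on A \<gamma> a b" "a < b"
  shows "C1_path_on A (\<lambda>t. \<gamma> (t + d)) (a - d) (b - d)"
    and "finsler_length A F (\<lambda>t. \<gamma> (t + d)) (a - d) (b - d) = finsler_length A F \<gamma> a b"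
proof -
  have sub: "\<And>t. t \<in> {a - d..b - d} \<Longrightarrow> 1 * t + d \<in> {a..b}" by auto
  have "a - d < b - d" using assms(2) by simp
  note r = C1_path_reparam[OF assms this abs_one sub]
  show "C1_path_on A (\<lambda>t. \<gamma> (t + d)) (a - d) (b - d)" using r(1) by simp
  have "finsler_length A F (\<lambda>t. \<gamma> (t + d)) (a - d) (b - d) = integral {a - d..b - d} (\<lambda>t. speed \<gamma> a b (t + d))"
    unfolding finsler_length_eq using r(2) by (intro integral_cong) simp
  then show "finsler_length A F (\<lambda>t. \<gamma> (t + d)) (a - d) (b - d) = finsler_length A F \<gamma> a b"
    unfolding finsler_length_eq by (simp only: integral_shift_real_ivl)
qed

lemma C1_path_reverse:
  assumes "C1_path_on A \<gamma> a b" "a < b"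
  shows "C1_path_on A (\<lambda>t. \<gamma> (- t)) (- b) (- a)"
    and "finsler_length A F (\<lambda>t. \<gamma> (- t)) (- b) (- a) = finsler_length A F \<gamma> a b"
proof -
  have sub: "\<And>t. t \<in> {- b..- a} \<Longrightarrow> - 1 * t + 0 \<in> {a..b}" by auto
  have "- b < - a" "\<bar>- 1 :: real\<bar> = 1" using assms(2) by simp_all
  note r = C1_path_reparam[OF assms this sub]
  show "C1_path_on A (\<lambda>t. \<gamma> (- t)) (- b) (- a)" using r(1) by simp
  have "finsler_length A F (\<lambda>t. \<gamma> (- t)) (- b) (- a) = integral {- b..- a} (\<lambda>t. speed \<gamma> a b (- t))"
    unfolding finsler_length_eq using r(2) by (intro integral_cong) simp
  also have "\<dots> = finsler_length A F \<gamma> a b"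
    unfolding finsler_length_eq using integral_reflect_real[of b a "speed \<gamma> a b"] by simp
  finally show "finsler_length A F (\<lambda>t. \<gamma> (- t)) (- b) (- a) = finsler_length A F \<gamma> a b" .
qed

text \<open>All derivatives are taken within \<open>{a..b}\<close> and see values on the interval
  only. This allows the pieces of a path defined by cases to be treated separately.\<close>

lemma C1_path_cong:
  assumes eq: "\<And>t. t \<in> {a..b} \<Longrightarrow> \<gamma> t = \<eta> t"
  shows "C1_path_on A \<gamma> a b = C1_path_on A \<eta> a b"
    and "finsler_length A F \<gamma> a b = finsler_length A F \<eta> a b"
proof -
  have impl: "C1_path_on A \<eta> a b" if \<gamma>: "C1_path_on A \<gamma> a b" and eq: "\<And>t. t \<in> {a..b} \<Longrightarrow> \<gamma> t = \<eta> t" for \<gamma> \<eta>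
    unfolding C1_path_on_def
  proof (intro conjI ballI)
    show "continuous_on {a..b} \<eta>"
      using C1_path_continuous[OF \<gamma>] eq by (metis continuous_on_cong)
    fix c assume "c \<in> charts A"
    then have "\<exists>D. (\<forall>t\<in>{a..b} \<inter> \<gamma> -` fst c. ((snd c \<circ> \<gamma>) has_vector_derivative D t) (at t within {a..b})) \<and>
        continuous_on ({a..b} \<inter> \<gamma> -` fst c) D"
      using \<gamma> by (simp add: C1_path_on_def)
    then obtain D where
      D: "\<forall>t\<in>{a..b} \<inter> \<gamma> -` fst c. ((snd c \<circ> \<gamma>) has_vector_derivative D t) (at t within {a..b})"
      and cont: "continuous_on ({a..b} \<inter> \<gamma> -` fst c) D"
      by (elim exE conjE)
    have S: "{a..b} \<inter> \<gamma> -` fst c = {a..b} \<inter> \<eta> -` fst c" using eq by auto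
    have "((snd c \<circ> \<eta>) has_vector_derivative D t) (at t within {a..b})" if t: "t \<in> {a..b}" "\<eta> t \<in> fst c" for t
    proof (rule has_vector_derivative_transform[OF t(1)])
      show "((snd c \<circ> \<gamma>) has_vector_derivative D t) (at t within {a..b})"
        using D t eq by simp
    qed (simp add: eq)
    then show "\<exists>D. (\<forall>t\<in>{a..b} \<inter> \<eta> -` fst c. ((snd c \<circ> \<eta>) has_vector_derivative D t) (at t within {a..b})) \<and>
        continuous_on ({a..b} \<inter> \<eta> -` fst c) D"
      using cont unfolding S by blast
  qed
  show "C1_path_on A \<gamma> a b = C1_path_on A \<eta> a b"
    using impl[of \<gamma> \<eta>] impl[of \<eta> \<gamma>] eq by metis
  have "speed \<gamma> a b t = speed \<eta> a b t" if t: "t \<in> {a..b}" for t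
  proof -
    have der: "vector_derivative (snd c \<circ> \<gamma>) (at t within {a..b}) = vector_derivative (snd c \<circ> \<eta>) (at t within {a..b})" for c :: "('m, 'x) chart"
      using eq t by (intro vector_derivative_cong_eq always_eventually) auto
    show ?thesis unfolding speed_def velocity_def der eq[OF t] ..
  qed
  then show "finsler_length A F \<gamma> a b = finsler_length A F \<eta> a b"
    unfolding finsler_length_eq by (rule integral_cong)
qed


text \<open>Since \<open>f\<close> need not have a derivative along the path,
  \<open>local_increment_bound\<close> replaces the fundamental theorem. The majorant is a multiple
  of a primitive of the speed, raised by a small linear term that disappears as
  \<open>\<epsilon>\<close> tends to 0.\<close>

lemma C1_path_estimate:
  assumes path: "C1_path_on A \<gamma> a b" and "a < b" and "K \<ge> 0"
    and loc: "\<And>t c \<epsilon>. t \<in> {a..b} \<Longrightarrow> c \<in> charts_at A (\<gamma> t) \<Longrightarrow> \<epsilon> > 0 \<Longrightarrow>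
      \<forall>\<^sub>F y in nhds (\<gamma> t). \<bar>f y - f (\<gamma> t)\<bar> \<le> K * (1 + \<epsilon>) * chart_norm c (\<gamma> t) (snd c y - snd c (\<gamma> t))"
  shows "\<bar>f (\<gamma> b) - f (\<gamma> a)\<bar> \<le> K * finsler_length A F \<gamma> a b"
proof -
  define J where "J = speed \<gamma> a b"
  have J: "continuous_on {a..b} J" unfolding J_def using path \<open>a < b\<close> by (rule speed_continuous)
  have J0: "0 \<le> J t" if "t \<in> {a..b}" for t
    unfolding J_def using path \<open>a < b\<close> that by (rule speed_nonneg)
  define I where "I s = integral {a..s} J" for s
  have Imono: "I s \<le> I t" if "a \<le> s" "s \<le> t" "t \<le> b" for s t
    unfolding I_def using that J J0
    by (intro integral_subset_le integrable_continuous_real) (auto intro: continuous_on_subset)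
  have est: "\<bar>f (\<gamma> b) - f (\<gamma> a)\<bar> \<le> K * (1 + \<epsilon>) * (I b + 2 * \<epsilon> * (b - a))" if \<epsilon>: "\<epsilon> > 0" for \<epsilon>
  proof -
    \<comment> \<open>One \<open>\<epsilon>\<close> accounts for the deviation of the path from its
      tangent, measured in the norm at \<open>\<gamma> t\<close>, the other for replacing
      \<open>\<bar>s - t\<bar> * J t\<close> by the increment of \<open>I\<close>.\<close>
    define W where "W s = I s + 2 * \<epsilon> * s" for s
    define V where "V s = K * (1 + \<epsilon>) * W s" for s
    have Wmono: "W s \<le> W t" if "a \<le> s" "s \<le> t" "t \<le> b" for s t
      using Imono[OF that] \<epsilon> that by (simp add: W_def add_mono)
    have "\<bar>(f \<circ> \<gamma>) b - (f \<circ> \<gamma>) a\<bar> \<le> V b - V a"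
    proof (rule local_increment_bound)
      show "V s \<le> V t" if "a \<le> s" "s \<le> t" "t \<le> b" for s t
        unfolding V_def using \<open>K \<ge> 0\<close> \<epsilon> by (intro mult_left_mono Wmono that) simp
    next
      fix t assume t: "t \<in> {a..b}"
      obtain c where c: "c \<in> charts_at A (\<gamma> t)" by (rule charts_at_exists)
      obtain D where
        D: "\<And>t. t \<in> {a..b} \<Longrightarrow> \<gamma> t \<in> fst c \<Longrightarrow> ((snd c \<circ> \<gamma>) has_vector_derivative D t) (at t within {a..b})"
        and sp: "\<And>t. t \<in> {a..b} \<Longrightarrow> \<gamma> t \<in> fst c \<Longrightarrow> speed \<gamma> a b t = chart_norm c (\<gamma> t) (D t)"
        using C1_path_derivative[OF path \<open>a < b\<close> charts_atD(1)[OF c]] by metis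
      have Jt: "J t = chart_norm c (\<gamma> t) (D t)"
        unfolding J_def using sp t charts_atD(2)[OF c] .
      obtain k C where C: "C > 0" "\<And>v. chart_norm c (\<gamma> t) v \<le> C * norm v"
        using chart_norm_equiv[OF c] by metis
      have "((snd c \<circ> \<gamma>) has_derivative (\<lambda>h. h *\<^sub>R D t)) (at t within {a..b})"
        using D[OF t charts_atD(2)[OF c]] by (simp add: has_vector_derivative_def)
      then obtain d1 where "d1 > 0" and d1: "\<And>s. s \<in> {a..b} \<Longrightarrow> norm (s - t) < d1 \<Longrightarrow>
          norm ((snd c \<circ> \<gamma>) s - (snd c \<circ> \<gamma>) t - (s - t) *\<^sub>R D t) \<le> \<epsilon> / C * norm (s - t)"
        unfolding has_derivative_within_alt using divide_pos_pos[OF \<epsilon> C(1)] by blast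
      have "(I has_derivative (\<lambda>h. h *\<^sub>R J t)) (at t within {a..b})"
        using integral_has_vector_derivative[OF J t] unfolding has_vector_derivative_def I_def[abs_def] .
      then obtain d2 where "d2 > 0" and d2: "\<And>s. s \<in> {a..b} \<Longrightarrow> norm (s - t) < d2 \<Longrightarrow>
          norm (I s - I t - (s - t) *\<^sub>R J t) \<le> \<epsilon> * norm (s - t)"
        unfolding has_derivative_within_alt using \<epsilon> by blast
      have "\<forall>\<^sub>F s in at t within {a..b}. dist s t < min d1 d2"
        unfolding eventually_at using \<open>d1 > 0\<close> \<open>d2 > 0\<close> by (intro exI[of _ "min d1 d2"]) auto
      with C1_path_eventually_in_chart[OF C1_path_continuous[OF path] t loc[OF t c \<epsilon>]]
      show "\<forall>\<^sub>F s in at t within {a..b}. \<bar>(f \<circ> \<gamma>) s - (f \<circ> \<gamma>) t\<bar> \<le> \<bar>V s - V t\<bar>"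
      proof eventually_elim
        case (elim s)
        then have s: "s \<in> {a..b}" "norm (s - t) < d1" "norm (s - t) < d2"
          by (auto simp: dist_norm)
        define N where "N = chart_norm c (\<gamma> t)"
        define w where "w = snd c (\<gamma> s) - snd c (\<gamma> t) - (s - t) *\<^sub>R D t"
        have "norm w \<le> \<epsilon> / C * \<bar>s - t\<bar>" using d1[OF s(1,2)] by (simp add: w_def)
        then have "C * norm w \<le> \<epsilon> * \<bar>s - t\<bar>" using C(1) by (simp add: field_simps)
        then have Nw: "N w \<le> \<epsilon> * \<bar>s - t\<bar>" using C(2)[of w] by (simp add: N_def)
        have "N (snd c (\<gamma> s) - snd c (\<gamma> t)) = N (w + (s - t) *\<^sub>R D t)"
          by (simp add: w_def)
        also have "\<dots> \<le> N w + \<bar>s - t\<bar> * J t"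
          unfolding N_def Jt chart_norm_scaleR[OF c, symmetric] using c by (rule chart_norm_triangle)
        finally have 1: "N (snd c (\<gamma> s) - snd c (\<gamma> t)) \<le> \<epsilon> * \<bar>s - t\<bar> + \<bar>s - t\<bar> * J t"
          using Nw by linarith
        have "\<bar>(s - t) * J t\<bar> \<le> \<bar>I s - I t\<bar> + \<epsilon> * \<bar>s - t\<bar>"
          using d2[OF s(1,3)] by simp
        then have 2: "\<bar>s - t\<bar> * J t \<le> \<bar>I s - I t\<bar> + \<epsilon> * \<bar>s - t\<bar>"
          using J0[OF t] by (simp add: abs_mult)
        \<comment> \<open>\<open>I\<close> and the linear term both increase, so the absolute values
          of their increments add without loss.\<close>
        have 3: "\<bar>I s - I t\<bar> + 2 * \<epsilon> * \<bar>s - t\<bar> = \<bar>W s - W t\<bar>"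
        proof (cases "s \<le> t")
          case True
          then have "I s \<le> I t" "W s \<le> W t" using Imono[of s t] Wmono[of s t] s t by auto
          then show ?thesis using True by (simp add: W_def algebra_simps)
        next
          case False
          then have "I t \<le> I s" "W t \<le> W s" using Imono[of t s] Wmono[of t s] s t by auto
          then show ?thesis using False by (simp add: W_def algebra_simps)
        qed
        have "\<bar>f (\<gamma> s) - f (\<gamma> t)\<bar> \<le> K * (1 + \<epsilon>) * N (snd c (\<gamma> s) - snd c (\<gamma> t))"
          using elim by (simp add: N_def)
        also have "\<dots> \<le> K * (1 + \<epsilon>) * \<bar>W s - W t\<bar>"
        proof (rule mult_left_mono)
          show "N (snd c (\<gamma> s) - snd c (\<gamma> t)) \<le> \<bar>W s - W t\<bar>" using 1 2 3 by linarith
          show "0 \<le> K * (1 + \<epsilon>)" using \<open>K \<ge> 0\<close> \<epsilon> by simp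
        qed
        also have "\<dots> = \<bar>V s - V t\<bar>"
          using \<open>K \<ge> 0\<close> \<epsilon> by (simp add: V_def abs_mult flip: right_diff_distrib)
        finally show ?case by simp
      qed
    qed (use \<open>a < b\<close> in simp)
    then show ?thesis
      by (simp add: V_def W_def I_def algebra_simps)
  qed
  have "((\<lambda>\<epsilon>. K * (1 + \<epsilon>) * (I b + 2 * \<epsilon> * (b - a))) \<longlongrightarrow> K * (1 + 0) * (I b + 2 * 0 * (b - a))) (at_right 0)"
    by (intro tendsto_intros)
  then have "\<bar>f (\<gamma> b) - f (\<gamma> a)\<bar> \<le> K * (1 + 0) * (I b + 2 * 0 * (b - a))"
  proof (rule tendsto_lowerbound)
    show "\<forall>\<^sub>F \<epsilon> in at_right 0. \<bar>f (\<gamma> b) - f (\<gamma> a)\<bar> \<le> K * (1 + \<epsilon>) * (I b + 2 * \<epsilon> * (b - a))"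
      using eventually_at_right_less[of "0::real"] by eventually_elim (rule est)
  qed simp
  then show ?thesis by (simp add: I_def J_def finsler_length_eq)
qed

text \<open>Inside a piece, derivatives within the piece and within the whole interval agree with
  the two-sided one. At the two ends they may differ, but finitely many points do not change an
  integral.\<close>

lemma length_eq_sum:
  assumes pieces: "\<And>i. i < n \<Longrightarrow> s i < s (Suc i) \<and> C1_path_on A \<gamma> (s i) (s (Suc i))"
  shows "finsler_length A F \<gamma> (s 0) (s n) = (\<Sum>i<n. finsler_length A F \<gamma> (s i) (s (Suc i)))"
proof -
  define J where "J = speed \<gamma> (s 0) (s n)"
  have mono: "s i \<le> s j" if "i \<le> j" "j \<le> n" for i j
    using that
  proof (induction j rule: dec_induct)
    case (step j)
    then show ?case using pieces[of j] by simp
  qed simp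
  have piece: "(J has_integral finsler_length A F \<gamma> (s i) (s (Suc i))) {s i..s (Suc i)}" if "i < n" for i
  proof (rule has_integral_spike_finite[where S="{s i, s (Suc i)}"])
    have lt: "s i < s (Suc i)" and path: "C1_path_on A \<gamma> (s i) (s (Suc i))"
      using pieces[OF that] by auto
    show "(speed \<gamma> (s i) (s (Suc i)) has_integral finsler_length A F \<gamma> (s i) (s (Suc i))) {s i..s (Suc i)}"
      unfolding finsler_length_eq using speed_continuous[OF path lt]
      by (intro integrable_integral integrable_continuous_real)
    fix t assume "t \<in> {s i..s (Suc i)} - {s i, s (Suc i)}"
    then have t: "s i < t" "t < s (Suc i)" by auto
    moreover have "s 0 \<le> s i" "s (Suc i) \<le> s n" using mono[of 0 i] mono[of "Suc i" n] that by auto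
    ultimately have "at t within {s 0..s n} = at t" "at t within {s i..s (Suc i)} = at t"
      by (auto intro!: at_within_interior)
    then have "velocity A \<gamma> (s 0) (s n) t = velocity A \<gamma> (s i) (s (Suc i)) t"
      by (simp only: velocity_def)
    then show "J t = speed \<gamma> (s i) (s (Suc i)) t"
      by (simp add: J_def speed_def)
  qed simp
  have "(J has_integral (\<Sum>i<k. finsler_length A F \<gamma> (s i) (s (Suc i)))) {s 0..s k}" if "k \<le> n" for k
    using that
  proof (induction k)
    case 0 then show ?case by (simp add: has_integral_refl)
  next
    case (Suc k)
    then show ?case
      using has_integral_combine[of "s 0" "s k" "s (Suc k)" J] mono[of 0 k] mono[of k "Suc k"] piece[of k]
      by simp
  qed
  from this[of n] show ?thesis
    unfolding finsler_length_eq J_def[symmetric] by (simp add: integral_unique finsler_length_eq)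
qed

section \<open>The Finsler metric\<close>

text \<open>Concatenations of \<open>C\<^sup>1\<close> paths from \<open>p\<close>, recorded with their total length but without a
  common parametrisation.\<close>

inductive chain :: "'m \<Rightarrow> 'm \<Rightarrow> real \<Rightarrow> bool" for p where
  chain_start: "chain p p 0"
| chain_step: "chain p (\<gamma> a) l \<Longrightarrow> C1_path_on A \<gamma> a b \<Longrightarrow> a < b \<Longrightarrow>
    chain p (\<gamma> b) (l + finsler_length A F \<gamma> a b)"

lemma chain_piece:
  assumes "C1_path_on A \<gamma> a b" "a < b"
  shows "chain (\<gamma> a) (\<gamma> b) (finsler_length A F \<gamma> a b)"
  using chain_step[OF chain_start assms] by simp

lemma chain_nonneg: "chain p q l \<Longrightarrow> 0 \<le> l"
  by (induction rule: chain.induct) (simp_all add: C1_length_nonneg)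

lemma chain_trans:
  assumes "chain q r l'" "chain p q l"
  shows "chain p r (l + l')"
  using assms
proof (induction rule: chain.induct)
  case (chain_step \<gamma> a l' b)
  then show ?case using chain.chain_step[of p \<gamma> a "l + l'" b] by (simp add: add.assoc)
qed simp

lemma chain_sym:
  assumes "chain p q l"
  shows "chain q p l"
  using assms
proof (induction rule: chain.induct)
  case (chain_step \<gamma> a l b)
  have "chain (\<gamma> b) (\<gamma> a) (finsler_length A F \<gamma> a b)"
    using chain_piece[OF C1_path_reverse(1)[OF chain_step(2,3)]] chain_step(3)
    by (simp add: C1_path_reverse(2)[OF chain_step(2,3)])
  from chain_trans[OF chain_step(4) this] show ?case by (simp add: add.commute)
qed (rule chain_start)

lemma piecewise_path_imp_chain:
  assumes "piecewise_C1_path A \<gamma> a b"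
  shows "chain (\<gamma> a) (\<gamma> b) (finsler_length A F \<gamma> a b)"
proof -
  obtain n s where s: "s 0 = a" "s n = b"
    and pieces: "\<And>i. i < n \<Longrightarrow> s i < s (Suc i) \<and> C1_path_on A \<gamma> (s i) (s (Suc i))"
    using assms unfolding piecewise_C1_path_def by blast
  have "chain (\<gamma> (s 0)) (\<gamma> (s k)) (\<Sum>i<k. finsler_length A F \<gamma> (s i) (s (Suc i)))" if "k \<le> n" for k
    using that
  proof (induction k)
    case 0 then show ?case by (simp add: chain_start)
  next
    case (Suc k)
    then show ?case using chain_step[of "\<gamma> (s 0)" \<gamma> "s k" _ "s (Suc k)"] pieces[of k] by simp
  qed
  from this[of n] show ?thesis
    using length_eq_sum[of n s \<gamma>] pieces s by simp
qed

lemma C1_path_const: "C1_path_on A (\<lambda>t. p) a b"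
  unfolding C1_path_on_def
  by (intro conjI ballI continuous_on_const exI[of _ "\<lambda>t. 0"]) (simp add: comp_def)

lemma length_const:
  assumes "a < b"
  shows "finsler_length A F (\<lambda>t. p) a b = 0"
proof -
  obtain c where c: "c \<in> charts_at A p" by (rule charts_at_exists)
  have "speed (\<lambda>t. p) a b t = 0" if t: "t \<in> {a..b}" for t
  proof -
    have "velocity A (\<lambda>t. p) a b t = tangent_lift A c p 0"
      using velocity_in_chart[OF C1_path_const assms t c] by (simp add: comp_def)
    then show ?thesis
      using chart_norm_scaleR[OF c, of 0 0] by (simp add: speed_def chart_norm_def)
  qed
  then have "finsler_length A F (\<lambda>t. p) a b = integral {a..b} (\<lambda>t. 0)"
    unfolding finsler_length_eq by (rule integral_cong)
  then show ?thesis by simp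
qed

lemma chain_imp_piecewise_path:
  assumes "chain p q l"
  shows "\<exists>\<gamma> a b. piecewise_C1_path A \<gamma> a b \<and> \<gamma> a = p \<and> \<gamma> b = q \<and> finsler_length A F \<gamma> a b = l"
  using assms
proof (induction rule: chain.induct)
  case chain_start
  \<comment> \<open>A path needs an interval of positive length, so the empty chain is realised by a
    constant path; \<open>real\<close> lists its end points as break points.\<close>
  have "piecewise_C1_path A (\<lambda>t. p) 0 1"
    unfolding piecewise_C1_path_def
    by (intro conjI exI[of _ 1] exI[of _ real]) (auto simp: C1_path_const)
  then show ?case using length_const[of 0 1 p] by (intro exI[of _ "\<lambda>t. p"] exI[of _ 0] exI[of _ 1]) simp
next
  case (chain_step \<eta> a' l b')
  then obtain \<gamma> a b where pw: "piecewise_C1_path A \<gamma> a b" and \<gamma>: "\<gamma> a = p" "\<gamma> b = \<eta> a'"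
    and l: "finsler_length A F \<gamma> a b = l" by blast
  obtain n s where s: "s 0 = a" "s n = b" and "a < b"
    and pieces: "\<And>i. i < n \<Longrightarrow> s i < s (Suc i) \<and> C1_path_on A \<gamma> (s i) (s (Suc i))"
    using pw unfolding piecewise_C1_path_def by blast
  have s_le: "s i \<le> b" if "i \<le> n" for i
    using that
  proof (induction i rule: inc_induct)
    case (step i)
    then show ?case using pieces[of i] by simp
  qed (simp add: s)
  define e where "e = b + (b' - a')"
  have "b < e" using chain_step(3) by (simp add: e_def)
  define \<kappa> where "\<kappa> t = (if t \<le> b then \<gamma> t else \<eta> (t + (a' - b)))" for t
  have \<kappa>1: "\<kappa> t = \<gamma> t" if "t \<le> b" for t using that by (simp add: \<kappa>_def)
  have \<kappa>2: "\<kappa> t = \<eta> (t + (a' - b))" if "b \<le> t" for t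
    using that \<gamma>(2) by (cases "t = b") (auto simp: \<kappa>_def)
  \<comment> \<open>Index \<open>n\<close> still belongs to the old subdivision, with
    \<open>s n = b\<close>. Only \<open>Suc n\<close> is new, so the last piece runs over
    \<open>{b..e}\<close>.\<close>
  define s' where "s' i = (if i \<le> n then s i else e)" for i
  have ends: "a' - (a' - b) = b" "b' - (a' - b) = e" by (simp_all add: e_def)
  have last: "C1_path_on A \<kappa> b e" "finsler_length A F \<kappa> b e = finsler_length A F \<eta> a' b'"
    using C1_path_shift[OF chain_step(2,3), of "a' - b"] C1_path_cong[of b e \<kappa> "\<lambda>t. \<eta> (t + (a' - b))"] \<kappa>2
    unfolding ends by auto
  have eq: "C1_path_on A \<kappa> (s i) (s (Suc i)) = C1_path_on A \<gamma> (s i) (s (Suc i))"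
    "finsler_length A F \<kappa> (s i) (s (Suc i)) = finsler_length A F \<gamma> (s i) (s (Suc i))" if "i < n" for i
    using C1_path_cong[of "s i" "s (Suc i)" \<kappa> \<gamma>] \<kappa>1 s_le[of "Suc i"] that by auto
  have pieces': "s' i < s' (Suc i) \<and> C1_path_on A \<kappa> (s' i) (s' (Suc i))" if "i < Suc n" for i
  proof (cases "i < n")
    case True
    then show ?thesis using pieces[of i] eq(1)[of i] by (simp add: s'_def)
  next
    case False
    then have "i = n" using that by simp
    then show ?thesis using last(1) \<open>b < e\<close> s by (simp add: s'_def)
  qed
  have s'ends: "s' 0 = a" "s' (Suc n) = e" using s by (simp_all add: s'_def)
  have "finsler_length A F \<kappa> a e = (\<Sum>i<Suc n. finsler_length A F \<kappa> (s' i) (s' (Suc i)))"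
    using length_eq_sum[of "Suc n" s' \<kappa>] pieces' unfolding s'ends by blast
  also have "\<dots> = (\<Sum>i<n. finsler_length A F \<gamma> (s i) (s (Suc i))) + finsler_length A F \<eta> a' b'"
    using eq(2) last(2) s by (simp add: s'_def)
  also have "(\<Sum>i<n. finsler_length A F \<gamma> (s i) (s (Suc i))) = l"
    using length_eq_sum[of n s \<gamma>] pieces s l by simp
  finally have len: "finsler_length A F \<kappa> a e = l + finsler_length A F \<eta> a' b'" .
  have "continuous_on {a..e} \<kappa>"
  proof -
    have "continuous_on {a..b} \<kappa>"
    proof (rule continuous_on_eq)
      show "continuous_on {a..b} \<gamma>" using pw by (simp add: piecewise_C1_path_def)
    qed (simp add: \<kappa>1)
    moreover have "continuous_on {b..e} \<kappa>" using last(1) by (rule C1_path_continuous)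
    moreover have "{a..e} = {a..b} \<union> {b..e}" using \<open>a < b\<close> \<open>b < e\<close> by auto
    ultimately show ?thesis by (simp add: continuous_on_closed_Un)
  qed
  then have "piecewise_C1_path A \<kappa> a e"
    unfolding piecewise_C1_path_def using \<open>a < b\<close> \<open>b < e\<close> s'ends pieces'
    by (intro conjI exI[of _ "Suc n"] exI[of _ s']) auto
  moreover have "\<kappa> a = p" "\<kappa> e = \<eta> b'"
    using \<kappa>1[of a] \<kappa>2[of e] \<gamma> \<open>a < b\<close> \<open>b < e\<close> by (simp_all add: e_def)
  ultimately show ?case using len by blast
qed

text \<open>Chains realise exactly the lengths of piecewise C1 paths, so the infimum can be handled
  with objects that concatenate without a common parametrisation.\<close>

lemma finsler_dist_eq: "finsler_dist A F p q = Inf {l. chain p q l}"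
proof -
  have "{finsler_length A F \<gamma> a b | \<gamma> a b. piecewise_C1_path A \<gamma> a b \<and> \<gamma> a = p \<and> \<gamma> b = q} = {l. chain p q l}"
  proof (intro equalityI subsetI)
    show "l \<in> {l. chain p q l}" if "l \<in> {finsler_length A F \<gamma> a b | \<gamma> a b. piecewise_C1_path A \<gamma> a b \<and> \<gamma> a = p \<and> \<gamma> b = q}" for l
      using that piecewise_path_imp_chain by auto
    show "l \<in> {finsler_length A F \<gamma> a b | \<gamma> a b. piecewise_C1_path A \<gamma> a b \<and> \<gamma> a = p \<and> \<gamma> b = q}" if "l \<in> {l. chain p q l}" for l
      using chain_imp_piecewise_path[of p q l] that by auto
  qed
  then show ?thesis by (simp add: finsler_dist_def)
qed

lemma finsler_dist_le: "chain p q l \<Longrightarrow> finsler_dist A F p q \<le> l"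
  unfolding finsler_dist_eq by (intro cInf_lower bdd_belowI[of _ 0]) (auto simp: chain_nonneg)


section \<open>The Finsler metric and the topology of the manifold\<close>

lemma chart_segment:
  assumes c: "c \<in> charts A"
    and seg: "\<And>t. t \<in> {0..1} \<Longrightarrow> u + t *\<^sub>R (v - u) \<in> snd c ` fst c"
    and M: "\<And>t. t \<in> {0..1} \<Longrightarrow> chart_norm c (chart_inv c (u + t *\<^sub>R (v - u))) (v - u) \<le> M"
  obtains l where "chain (chart_inv c u) (chart_inv c v) l" "l \<le> M"
proof -
  define \<mu> where "\<mu> t = u + t *\<^sub>R (v - u)" for t :: real
  define \<gamma> where "\<gamma> t = chart_inv c (\<mu> t)" for t
  have \<mu>: "(\<mu> has_derivative (\<lambda>h. h *\<^sub>R (v - u))) (at t within {0..1})" for t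
    unfolding \<mu>_def by (auto intro!: derivative_eq_intros)
  have c\<mu>: "continuous_on S \<mu>" for S
    unfolding \<mu>_def by (intro continuous_intros)
  have \<gamma>in: "\<gamma> t \<in> fst c" "snd c (\<gamma> t) = \<mu> t" if "t \<in> {0..1}" for t
    using chart_inv_in[OF c seg[OF that]] by (simp_all add: \<gamma>_def \<mu>_def)
  have C1: "C1_path_on A \<gamma> 0 1"
    unfolding C1_path_on_def
  proof (intro conjI ballI)
    show "continuous_on {0..1} \<gamma>"
      unfolding \<gamma>_def by (rule continuous_on_compose2[OF chart_continuous(2)[OF c] c\<mu>]) (use seg in \<open>auto simp: \<mu>_def\<close>)
    fix c' assume c': "c' \<in> charts A"
    obtain T where T: "\<And>w. w \<in> snd c ` (fst c \<inter> fst c') \<Longrightarrow>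
        ((snd c' \<circ> chart_inv c) has_derivative blinfun_apply (T w)) (at w)"
      and cT: "continuous_on (snd c ` (fst c \<inter> fst c')) T"
      using transition_C1[OF c c'] unfolding C1_on_def by blast
    let ?S = "{0..1} \<inter> \<gamma> -` fst c'"
    have \<mu>S: "\<mu> t \<in> snd c ` (fst c \<inter> fst c')" if "t \<in> ?S" for t
      using \<gamma>in[of t] that by (metis IntD1 IntD2 IntI image_eqI vimageD)
    have "((snd c' \<circ> \<gamma>) has_vector_derivative T (\<mu> t) (v - u)) (at t within {0..1})" if t: "t \<in> ?S" for t
    proof -
      have "((snd c' \<circ> chart_inv c) \<circ> \<mu> has_derivative T (\<mu> t) \<circ> (\<lambda>h. h *\<^sub>R (v - u))) (at t within {0..1})"
        using \<mu>
      proof (rule diff_chain_within)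
        show "((snd c' \<circ> chart_inv c) has_derivative T (\<mu> t)) (at (\<mu> t) within \<mu> ` {0..1})"
          using T[OF \<mu>S[OF t]] by (rule has_derivative_at_withinI)
      qed
      then show ?thesis
        by (simp add: has_vector_derivative_def comp_def \<gamma>_def blinfun.scaleR_right)
    qed
    moreover have "continuous_on ?S (\<lambda>t. T (\<mu> t))"
      by (rule continuous_on_compose2[OF cT c\<mu>]) (use \<mu>S in blast)
    then have "continuous_on ?S (\<lambda>t. T (\<mu> t) (v - u))"
      by (intro continuous_intros)
    ultimately show "\<exists>D. (\<forall>t\<in>?S. ((snd c' \<circ> \<gamma>) has_vector_derivative D t) (at t within {0..1})) \<and> continuous_on ?S D"
      by (intro exI[of _ "\<lambda>t. T (\<mu> t) (v - u)"]) simp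
  qed
  have sp: "speed \<gamma> 0 1 t \<le> M" if t: "t \<in> {0..1}" for t
  proof -
    have "((snd c \<circ> \<gamma>) has_vector_derivative (v - u)) (at t within {0..1})"
      unfolding has_vector_derivative_def
      by (rule has_derivative_transform[OF t _ \<mu>]) (simp add: \<gamma>in)
    then have "velocity A \<gamma> 0 1 t = tangent_lift A c (\<gamma> t) (v - u)"
      using c \<gamma>in(1)[OF t] by (intro velocity_in_chart[OF C1 _ t]) (simp_all add: charts_at_def)
    then show ?thesis
      using M[OF t] by (simp add: speed_def chart_norm_def \<gamma>_def \<mu>_def)
  qed
  have ends: "\<gamma> 0 = chart_inv c u" "\<gamma> 1 = chart_inv c v" by (simp_all add: \<gamma>_def \<mu>_def)
  have "finsler_length A F \<gamma> 0 1 \<le> integral {0..1::real} (\<lambda>t. M)"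
    unfolding finsler_length_eq
  proof (rule integral_le)
    show "speed \<gamma> 0 1 integrable_on {0..1}"
      using speed_continuous[OF C1] by (intro integrable_continuous_real) simp
    show "(\<lambda>t. M) integrable_on {0..1::real}"
      by (intro integrable_continuous_real continuous_on_const)
  qed (rule sp)
  then show ?thesis
    using that[of "finsler_length A F \<gamma> 0 1"] chain_piece[OF C1] by (simp add: ends)
qed

text \<open>Coordinate segments suffice: (P2) with \<open>\<epsilon> = 1\<close> bounds the tangent
  norms near \<open>x\<close> by \<open>2 * C\<close> times the norm of \<open>X\<close>. This gives
  openness of metric balls and the existence of connecting chains.\<close>

lemma short_chains_nearby:
  assumes "e > 0"
  shows "\<forall>\<^sub>F y in nhds x. \<exists>l<e. chain x y l"
proof -
  obtain c where c: "c \<in> charts_at A x" by (rule charts_at_exists)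
  have cA: "c \<in> charts A" and xc: "x \<in> fst c" using charts_atD[OF c] .
  obtain k C where C: "C > 0" "\<And>v. chart_norm c x v \<le> C * norm v"
    using chart_norm_equiv[OF c] by metis
  have "\<forall>\<^sub>F y in nhds x. \<forall>v. chart_norm c y v \<le> 2 * C * norm v"
    using chart_norm_locally_constant[OF c zero_less_one]
  proof eventually_elim
    case (elim y)
    show ?case
    proof
      fix v
      have "chart_norm c y v \<le> 2 * chart_norm c x v" using elim by simp
      then show "chart_norm c y v \<le> 2 * C * norm v" using C(2)[of v] by simp
    qed
  qed
  then obtain V where V: "open V" "x \<in> V" "\<And>y v. y \<in> V \<Longrightarrow> chart_norm c y v \<le> 2 * C * norm v"
    unfolding eventually_nhds by blast
  obtain r where r: "r > 0" "ball (snd c x) r \<subseteq> snd c ` (fst c \<inter> V)"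
    using chart_image_open[OF cA V(1)] xc V(2) unfolding open_contains_ball by blast
  define r' where "r' = min r (e / (2 * C))"
  have r': "r' > 0" "r' \<le> r" "2 * C * r' \<le> e"
    using r(1) C(1) \<open>e > 0\<close> by (auto simp: r'_def min_def field_simps)
  have "\<forall>\<^sub>F u in nhds (snd c x). u \<in> ball (snd c x) r'"
    using r'(1) by (intro eventually_nhds_in_open) auto
  from chart_eventually[OF cA xc this] show ?thesis
  proof eventually_elim
    case (elim y)
    define u where "u = snd c x"
    define v where "v = snd c y"
    have seg: "u + t *\<^sub>R (v - u) \<in> ball u r" if "t \<in> {0..1}" for t
    proof -
      have "norm (t *\<^sub>R (v - u)) \<le> 1 * norm (v - u)"
        unfolding norm_scaleR using that by (intro mult_right_mono) auto
      then show ?thesis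
        using elim r'(2) by (simp add: u_def v_def dist_norm norm_minus_commute)
    qed
    then have seg': "u + t *\<^sub>R (v - u) \<in> snd c ` (fst c \<inter> V)" if "t \<in> {0..1}" for t
      using that r(2) unfolding u_def by blast
    obtain l where l: "chain (chart_inv c u) (chart_inv c v) l" "l \<le> 2 * C * norm (v - u)"
    proof (rule chart_segment[OF cA])
      show "u + t *\<^sub>R (v - u) \<in> snd c ` fst c" if "t \<in> {0..1}" for t
        using seg'[OF that] by blast
      show "chart_norm c (chart_inv c (u + t *\<^sub>R (v - u))) (v - u) \<le> 2 * C * norm (v - u)" if "t \<in> {0..1}" for t
        using seg'[OF that] cA by (intro V(3)) auto
    qed
    have "norm (v - u) < r'" using elim by (simp add: u_def v_def dist_norm norm_minus_commute)
    then have "2 * C * norm (v - u) < 2 * C * r'" using C(1) by simp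
    then have "l < e" using l(2) r'(3) by linarith
    then show ?case using l(1) elim cA xc by (auto simp: u_def v_def)
  qed
qed

text \<open>Connectedness: short chains make the set reachable from \<open>p\<close> open, and
  reversing them does the same for its complement. Only a nonempty set of lengths lets
  \<open>finsler_dist A F p q < r\<close> produce a chain.\<close>

lemma chain_exists: "\<exists>l. chain p q l"
proof -
  define R where "R = {q. \<exists>l. chain p q l}"
  have "\<exists>T. open T \<and> x \<in> T \<and> T \<subseteq> R" if "x \<in> R" for x
  proof -
    obtain T where T: "open T" "x \<in> T" "\<And>y. y \<in> T \<Longrightarrow> \<exists>l<1. chain x y l"
      using short_chains_nearby[of 1 x] unfolding eventually_nhds by auto
    then have "T \<subseteq> R" using that unfolding R_def by (blast intro: chain_trans)
    then show ?thesis using T by blast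
  qed
  then have 1: "open R" by (subst open_subopen) blast
  have "\<exists>T. open T \<and> x \<in> T \<and> T \<subseteq> - R" if "x \<in> - R" for x
  proof -
    obtain T where T: "open T" "x \<in> T" "\<And>y. y \<in> T \<Longrightarrow> \<exists>l<1. chain x y l"
      using short_chains_nearby[of 1 x] unfolding eventually_nhds by auto
    then have "T \<subseteq> - R" using that unfolding R_def by (blast intro: chain_trans chain_sym)
    then show ?thesis using T by blast
  qed
  then have 2: "open (- R)" by (subst open_subopen) blast
  have "p \<in> R" unfolding R_def using chain_start by blast
  moreover have "connected (UNIV :: 'm set)"
    using finsler by (simp add: C1_finsler_manifold_def C1_banach_manifold_def)
  then have "R \<inter> UNIV = {} \<or> - R \<inter> UNIV = {}"
    using 1 2 by (rule connectedD) auto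
  ultimately have "- R = {}" by auto
  then have "q \<in> R" by auto
  then show ?thesis by (simp add: R_def)
qed

lemma finsler_dist_lessD:
  assumes "finsler_dist A F p q < r"
  obtains l where "chain p q l" "l < r"
proof -
  have "{l. chain p q l} \<noteq> {}" using chain_exists by simp
  then obtain l where "l \<in> {l. chain p q l}" "l < r"
    using cInf_lessD[of "{l. chain p q l}" r] assms unfolding finsler_dist_eq by blast
  then show ?thesis using that by simp
qed

text \<open>A chain to \<open>x\<close> of length \<open>l < r\<close> leaves \<open>r - l\<close>
  for a further short chain. Openness refers to the topology of the type, in which charts and
  subdifferentials are formulated.\<close>

lemma finsler_ball_open: "open (finsler_ball A F p r)"
proof (subst open_subopen, rule ballI)
  fix x assume "x \<in> finsler_ball A F p r"
  then obtain l where l: "chain p x l" "l < r"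
    using finsler_dist_lessD unfolding finsler_ball_def by blast
  obtain T where T: "open T" "x \<in> T" "\<And>y. y \<in> T \<Longrightarrow> \<exists>l'<r - l. chain x y l'"
    using short_chains_nearby[of "r - l" x] l(2) unfolding eventually_nhds by auto
  have "finsler_dist A F p y < r" if yT: "y \<in> T" for y
  proof -
    obtain l' where "l' < r - l" "chain x y l'" using T(3)[OF yT] by blast
    then show ?thesis using finsler_dist_le[OF chain_trans[OF _ l(1)]] by fastforce
  qed
  then show "\<exists>T. open T \<and> x \<in> T \<and> T \<subseteq> finsler_ball A F p r"
    using T by (auto simp: finsler_ball_def)
qed

section \<open>The Lipschitz estimate on balls and the case of a negative bound\<close>

lemma lipschitz_of_subdifferential_bound:
  fixes \<beta> :: "'x \<Rightarrow> real"
  assumes bump: "unit_bump \<beta> \<beta>' L" and "K \<ge> 0"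
    and lsc: "lsc_on (finsler_ball A F p (4 * \<delta>)) f"
    and bound: "\<And>x \<xi>. x \<in> finsler_ball A F p (4 * \<delta>) \<Longrightarrow>
      \<xi> \<in> subdifferential A (finsler_ball A F p (4 * \<delta>)) f x \<Longrightarrow> dual_norm A F x \<xi> \<le> K"
    and y: "y \<in> finsler_ball A F p \<delta>" and z: "z \<in> finsler_ball A F p \<delta>"
  shows "\<bar>f y - f z\<bar> \<le> K * finsler_dist A F y z"
proof -
  let ?\<Omega> = "finsler_ball A F p (4 * \<delta>)"
  obtain ly where ly: "chain p y ly" "ly < \<delta>"
    using y finsler_dist_lessD unfolding finsler_ball_def by blast
  obtain lz where lz: "chain p z lz" "lz < \<delta>"
    using z finsler_dist_lessD unfolding finsler_ball_def by blast
  \<comment> \<open>\<open>ly + l\<close> is the length of a chain from \<open>p\<close> through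
    \<open>y\<close> to \<open>w\<close>. Keeping it below \<open>4 * \<delta>\<close> keeps all
    intermediate points in the ball, and the condition passes to initial parts because lengths are
    nonnegative.\<close>
  have est: "\<bar>f w - f y\<bar> \<le> K * l" if "chain y w l" "ly + l < 4 * \<delta>" for w l
    using that
  proof (induction rule: chain.induct)
    case (chain_step \<gamma> a l b)
    note path = chain_step(2,3)
    have len: "0 \<le> finsler_length A F \<gamma> a b" using path by (rule C1_length_nonneg)
    \<comment> \<open>An intermediate point is reached by cutting the last piece at
      \<open>t\<close>; for \<open>t = a\<close> the piece would degenerate, and the chain without
      it serves.\<close>
    have in\<Omega>: "\<gamma> t \<in> ?\<Omega>" if t: "t \<in> {a..b}" for t
    proof -
      have "\<exists>l'. chain y (\<gamma> t) l' \<and> l' \<le> l + finsler_length A F \<gamma> a b"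
      proof (cases "t = a")
        case True
        then show ?thesis using chain_step(1) len by (intro exI[of _ l]) simp
      next
        case False
        then have "a < t" "{a..t} \<subseteq> {a..b}" using t by auto
        note restr = C1_path_restrict[OF path this]
        show ?thesis
          using chain.chain_step[OF chain_step(1) restr(1) \<open>a < t\<close>] restr(3) by fastforce
      qed
      then obtain l' where l': "chain y (\<gamma> t) l'" "l' \<le> l + finsler_length A F \<gamma> a b" by blast
      show ?thesis
        using finsler_dist_le[OF chain_trans[OF l'(1) ly(1)]] l'(2) chain_step(5)
        by (simp add: finsler_ball_def)
    qed
    have "\<bar>f (\<gamma> b) - f (\<gamma> a)\<bar> \<le> K * finsler_length A F \<gamma> a b"
    proof (rule C1_path_estimate[OF path \<open>K \<ge> 0\<close>])
      fix t c and \<epsilon> :: real assume t: "t \<in> {a..b}" and c: "c \<in> charts_at A (\<gamma> t)" and \<epsilon>: "\<epsilon> > 0"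
      show "\<forall>\<^sub>F y in nhds (\<gamma> t). \<bar>f y - f (\<gamma> t)\<bar> \<le> K * (1 + \<epsilon>) * chart_norm c (\<gamma> t) (snd c y - snd c (\<gamma> t))"
      proof -
        have "\<forall>\<^sub>F y in nhds (\<gamma> t). y \<in> fst c \<and>
            \<bar>f y - f (\<gamma> t)\<bar> \<le> K * (1 + \<epsilon>) * chart_norm c (\<gamma> t) (snd c y - snd c (\<gamma> t))"
          by (rule local_lipschitz_estimate[OF bump finsler_ball_open in\<Omega>[OF t] lsc _ c \<epsilon>]) (rule bound)
        then show ?thesis by eventually_elim simp
      qed
    qed
    moreover have "\<bar>f (\<gamma> a) - f y\<bar> \<le> K * l"
      using chain_step(4,5) len by simp
    ultimately show ?case by (simp add: distrib_left)
  qed simp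
  define d where "d = finsler_dist A F y z"
  have d: "d < 2 * \<delta>"
    using finsler_dist_le[OF chain_trans[OF lz(1) chain_sym[OF ly(1)]]] ly(2) lz(2) by (simp add: d_def)
  have est': "\<bar>f z - f y\<bar> \<le> K * (d + \<epsilon>)" if "0 < \<epsilon>" "\<epsilon> < \<delta>" for \<epsilon>
  proof -
    obtain l where l: "chain y z l" "l < d + \<epsilon>"
      using finsler_dist_lessD[of y z "d + \<epsilon>"] \<open>0 < \<epsilon>\<close> by (auto simp: d_def)
    have "\<bar>f z - f y\<bar> \<le> K * l"
      using l d ly(2) that by (intro est) linarith+
    also have "\<dots> \<le> K * (d + \<epsilon>)"
      using l(2) \<open>K \<ge> 0\<close> by (intro mult_left_mono) auto
    finally show ?thesis .
  qed
  have "\<delta> > 0" using ly chain_nonneg[OF ly(1)] by linarith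
  have "((\<lambda>\<epsilon>. K * (d + \<epsilon>)) \<longlongrightarrow> K * (d + 0)) (at_right 0)"
    by (intro tendsto_intros)
  then have "\<bar>f z - f y\<bar> \<le> K * (d + 0)"
  proof (rule tendsto_lowerbound)
    show "\<forall>\<^sub>F \<epsilon> in at_right 0. \<bar>f z - f y\<bar> \<le> K * (d + \<epsilon>)"
      using eventually_at_right_real[OF \<open>\<delta> > 0\<close>] by eventually_elim (simp add: est')
  qed simp
  then show ?thesis by (simp add: d_def abs_minus_commute)
qed

text \<open>The local estimate would bound an absolute value by a negative multiple of the norm of
  the displacement, so all points near \<open>x\<close> would have the same coordinates. But the
  chart image contains a ball, which is a single point only if \<open>'x\<close> is trivial.\<close>

lemma model_space_trivial_if_bound_negative:
  fixes \<beta> :: "'x \<Rightarrow> real"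
  assumes bump: "unit_bump \<beta> \<beta>' L" and \<Omega>: "open \<Omega>" "x \<in> \<Omega>" and lsc: "lsc_on \<Omega> f"
    and bound: "\<And>y \<xi>. y \<in> \<Omega> \<Longrightarrow> \<xi> \<in> subdifferential A \<Omega> f y \<Longrightarrow> dual_norm A F y \<xi> \<le> K"
    and "K < 0"
  shows "(v :: 'x) = 0"
proof (rule ccontr)
  assume v: "v \<noteq> 0"
  obtain c where c: "c \<in> charts_at A x" by (rule charts_at_exists)
  have cA: "c \<in> charts A" and xc: "x \<in> fst c" using charts_atD[OF c] .
  obtain k C where k: "k > 0" "\<And>v. k * norm v \<le> chart_norm c x v"
    using chart_norm_equiv[OF c] by metis
  have "\<forall>\<^sub>F y in nhds x. y \<in> fst c \<and> \<bar>f y - f x\<bar> \<le> K * (1 + 1) * chart_norm c x (snd c y - snd c x)"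
    by (rule local_lipschitz_estimate[OF bump \<Omega> lsc _ c zero_less_one]) (rule bound)
  then have "\<forall>\<^sub>F y in nhds x. snd c y = snd c x"
  proof eventually_elim
    case (elim y)
    let ?N = "chart_norm c x (snd c y - snd c x)"
    have "0 \<le> K * (1 + 1) * ?N"
      using elim abs_ge_zero[of "f y - f x"] by linarith
    then have "?N \<le> 0" using \<open>K < 0\<close> by (simp add: zero_le_mult_iff)
    then have "k * norm (snd c y - snd c x) \<le> 0" using k(2) order_trans by blast
    then show ?case using k(1) by (simp add: mult_le_0_iff)
  qed
  then obtain V where V: "open V" "x \<in> V" "\<And>y. y \<in> V \<Longrightarrow> snd c y = snd c x"
    unfolding eventually_nhds by blast
  obtain r where r: "r > 0" "cball (snd c x) r \<subseteq> snd c ` (fst c \<inter> V)"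
    using chart_image_open[OF cA V(1)] xc V(2) unfolding open_contains_cball by blast
  have "snd c x + (r / norm v) *\<^sub>R v \<in> cball (snd c x) r"
    using r(1) v by (simp add: dist_norm)
  then have "snd c x + (r / norm v) *\<^sub>R v \<in> snd c ` (fst c \<inter> V)"
    by (rule subsetD[OF r(2)])
  then obtain y where "y \<in> V" "snd c x + (r / norm v) *\<^sub>R v = snd c y"
    by (elim imageE IntE)
  then have "snd c x + (r / norm v) *\<^sub>R v = snd c x"
    using V(3) by metis
  then show False using r(1) v by simp
qed

end

theorem theorem2p16:
  fixes A :: "('m::t2_space, 'x::banach) chart set"
    and F :: "'m \<times> ('m, 'x) tangent \<Rightarrow> real"
    and p :: 'm and \<delta> K :: real and f :: "'m \<Rightarrow> real"
  assumes "C1_finsler_manifold A F"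
    and "\<exists>b :: 'x \<Rightarrow> real. C1_lipschitz_bump b"
    and "\<delta> > 0"
    and "lsc_on (finsler_ball A F p (4 * \<delta>)) f"
    and "\<forall>x\<in>finsler_ball A F p (4 * \<delta>).
           \<forall>\<xi>\<in>subdifferential A (finsler_ball A F p (4 * \<delta>)) f x. dual_norm A F x \<xi> \<le> K"
  shows "\<forall>y\<in>finsler_ball A F p \<delta>. \<forall>z\<in>finsler_ball A F p \<delta>.
           \<bar>f y - f z\<bar> \<le> K * finsler_dist A F y z"
proof -
  interpret finsler_manifold A F by standard (fact assms(1))
  obtain \<beta> :: "'x \<Rightarrow> real" and \<beta>' L where bump: "unit_bump \<beta> \<beta>' L"
    using assms(2) unit_bump_exists by blast
  show ?thesis
  proof (cases "K \<ge> 0")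
    case True
    show ?thesis
      by (intro ballI lipschitz_of_subdifferential_bound[OF bump True assms(4)]) (simp_all add: assms(5))
  next
    case False
    have "finsler_dist A F p p \<le> 0" by (rule finsler_dist_le[OF chain_start])
    then have "p \<in> finsler_ball A F p (4 * \<delta>)"
      using \<open>\<delta> > 0\<close> by (simp add: finsler_ball_def)
    then have trivial: "(v :: 'x) = 0" for v
    proof (rule model_space_trivial_if_bound_negative[OF bump finsler_ball_open _ assms(4)])
      show "dual_norm A F x \<xi> \<le> K"
        if "x \<in> finsler_ball A F p (4 * \<delta>)" "\<xi> \<in> subdifferential A (finsler_ball A F p (4 * \<delta>)) f x" for x \<xi>
        using assms(5) that by blast
      show "K < 0" using False by simp
    qed
    \<comment> \<open>The model space is trivial, so all lengths vanish and the bound \<open>0\<close> can replace \<open>K\<close>.\<close>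
    have length0: "finsler_length A F \<gamma> a b = 0" for \<gamma> a b
    proof -
      have velocity0: "velocity A \<gamma> a b = (\<lambda>t c. 0)"
        by (intro ext) (rule trivial)
      show ?thesis by (simp only: finsler_length_def velocity0 F_zero integral_0)
    qed
    have len: "l = 0" if "chain y z l" for y z l
      using that by (induction rule: chain.induct) (simp_all add: length0)
    have dist: "finsler_dist A F y z = 0" for y z
    proof -
      obtain l where l: "chain y z l" using chain_exists ..
      then have "chain y z 0" unfolding len[OF l] .
      then have "0 \<in> {l. chain y z l}" by simp
      moreover have "{l. chain y z l} \<subseteq> {0}"
      proof
        show "l \<in> {0}" if "l \<in> {l. chain y z l}" for l using len[of y z l] that by simp
      qed
      ultimately have "{l. chain y z l} = {0}" by fast
      then show ?thesis by (simp add: finsler_dist_eq)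
    qed
    have "\<bar>f y - f z\<bar> \<le> 0 * finsler_dist A F y z"
      if "y \<in> finsler_ball A F p \<delta>" "z \<in> finsler_ball A F p \<delta>" for y z
    proof (rule lipschitz_of_subdifferential_bound[OF bump order_refl assms(4) _ that])
      fix x \<xi>
      assume "x \<in> finsler_ball A F p (4 * \<delta>)" "\<xi> \<in> subdifferential A (finsler_ball A F p (4 * \<delta>)) f x"
      then have "dual_norm A F x \<xi> \<le> K" using assms(5) by simp
      then show "dual_norm A F x \<xi> \<le> 0" using False by simp
    qed
    then show ?thesis unfolding dist mult_zero_right by (intro ballI)
  qed
qed

end
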